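(* Let $\varepsilon_1>0$ be a constant. Assume the initial data $(U_0,V_0)$ of the system of heat equations $$\begin{cases}\partial_tU-\partial_z^2U=0,\quad \partial_tV-\partial_z^2V=0,\qquad t>0,\ z>0,\\ (U,V)|_{t=0}=(U_0,V_0),\quad (U,V)|_{z=0}=(0,0),\end{cases}$$ satisfy the compatibility condition and the bound $$\|(U_0,V_0)\|_{H^3_{\mu_{in}}}\le\varepsilon_1 .$$ Let $(U,V)\in L^\infty([0,+\infty[\,;H^3_\mu)$ be the corresponding solution. If, in addition, $$\int_0^{+\infty}zU_0(z)\,dz=\int_0^{+\infty}zV_0(z)\,dz=0,$$ then there exists a constant $C_1>0$ such that for all $t\ge0$, $$\|\partial_z(U,V)\|_{L^\infty_z}+\|z\partial_z(U,V)\|_{L^\infty_z}+\|z\partial_z^2(U,V)\|_{L^\infty_z}\le C_1\varepsilon_1(1+t)^{-\frac32}.$$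
   Context: Here $U=U(t,z)$, $V=V(t,z)$ with $z\in\mathbb R_+=(0,\infty)$. Weights: $\mu=\mu(t,z)=\exp\big(\frac{z^2}{4(1+t)}\big)$ and $\mu_{in}=\mu(0,z)=\exp\big(\frac{z^2}{4}\big)$. For a weight $\nu$, $\|h\|_{L^2_\nu}=\big(\int_{\mathbb R_+}\nu\,h^2\,dz\big)^{1/2}$ and, for an integer $m\ge 0$, $\|h\|_{H^m_\nu}=\big(\sum_{i=0}^m\|\partial_z^ih\|_{L^2_\nu}^2\big)^{1/2}$. The statement $(U,V)\in L^\infty([0,+\infty[;H^3_\mu)$ means that $\|(U,V)(t,\cdot)\|_{H^3_{\mu(t,\cdot)}}$ is bounded in $t$ (time-dependent weight). For a vector-valued function $\mathbf A=(A_1,\dots,A_n)$ and a norm $\|\cdot\|$, $\|\mathbf A\|=(\sum_j\|A_j\|^2)^{1/2}$. The compatibility condition is compatibility of the initial data with the boundary condition, i.e. $U_0|_{z=0}=V_0|_{z=0}=0$. *)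

theory Defs
  imports "HOL-Probability.Essential_Supremum"
begin

text \<open>
  Functions of \<open>z\<close> are total functions on the reals; the notions below only depend on their
  restriction to \<open>{0..}\<close>, and the weak notions only on that to \<open>{0<..}\<close>.
\<close>

definition test_fun :: "(real \<Rightarrow> real) \<Rightarrow> bool" where
  "test_fun \<phi> \<longleftrightarrow> (\<forall>n x. ((deriv ^^ n) \<phi>) differentiable (at x)) \<and>
     (\<exists>a b. 0 < a \<and> a \<le> b \<and> (\<forall>x. x \<notin> {a..b} \<longrightarrow> \<phi> x = 0))"

definition locally_integrable :: "(real \<Rightarrow> real) \<Rightarrow> bool" where
  "locally_integrable h \<longleftrightarrow> (\<forall>a b. 0 < a \<and> a \<le> b \<longrightarrow> set_integrable lebesgue {a..b} h)"

definition has_weak_deriv :: "nat \<Rightarrow> (real \<Rightarrow> real) \<Rightarrow> (real \<Rightarrow> real) \<Rightarrow> bool" where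
  "has_weak_deriv i h g \<longleftrightarrow> locally_integrable h \<and> locally_integrable g \<and>
     (\<forall>\<phi>. test_fun \<phi> \<longrightarrow>
        (LINT z:{0<..}|lebesgue. h z * (deriv ^^ i) \<phi> z)
          = (-1) ^ i * (LINT z:{0<..}|lebesgue. g z * \<phi> z))"

text \<open>
  A weak derivative is determined only up to null sets; \<open>weak_deriv\<close> picks a representative, and
  is used only in integrals and essential suprema, which do not depend on the choice.
\<close>

definition weak_deriv :: "nat \<Rightarrow> (real \<Rightarrow> real) \<Rightarrow> real \<Rightarrow> real" where
  "weak_deriv i h = (SOME g. has_weak_deriv i h g)"

definition L2_norm_wt :: "(real \<Rightarrow> real) \<Rightarrow> (real \<Rightarrow> real) \<Rightarrow> real" where
  "L2_norm_wt \<nu> h = sqrt (LINT z:{0<..}|lebesgue. \<nu> z * (h z)\<^sup>2)"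

definition Sobolev :: "nat \<Rightarrow> (real \<Rightarrow> real) \<Rightarrow> (real \<Rightarrow> real) set" where
  "Sobolev m \<nu> = {h. \<forall>i\<le>m. \<exists>g. has_weak_deriv i h g \<and>
     set_integrable lebesgue {0<..} (\<lambda>z. \<nu> z * (g z)\<^sup>2)}"

definition Sobolev_norm :: "nat \<Rightarrow> (real \<Rightarrow> real) \<Rightarrow> (real \<Rightarrow> real) \<Rightarrow> real" where
  "Sobolev_norm m \<nu> h = sqrt (\<Sum>i\<le>m. (L2_norm_wt \<nu> (weak_deriv i h))\<^sup>2)"

text \<open>
  \<open>Linf_norm\<close> is meaningful only for members of \<open>Linf\<close>.
\<close>

definition Linf :: "(real \<Rightarrow> real) set" where
  "Linf = {h \<in> borel_measurable (lebesgue_on {0<..}).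
     esssup (lebesgue_on {0<..}) (\<lambda>z. ereal \<bar>h z\<bar>) < \<infinity>}"

definition Linf_norm :: "(real \<Rightarrow> real) \<Rightarrow> real" where
  "Linf_norm h = real_of_ereal (esssup (lebesgue_on {0<..}) (\<lambda>z. ereal \<bar>h z\<bar>))"

definition pair_norm :: "((real \<Rightarrow> real) \<Rightarrow> real) \<Rightarrow> (real \<Rightarrow> real) \<Rightarrow> (real \<Rightarrow> real) \<Rightarrow> real" where
  "pair_norm N A B = sqrt ((N A)\<^sup>2 + (N B)\<^sup>2)"

definition \<mu> :: "real \<Rightarrow> real \<Rightarrow> real" where
  "\<mu> t z = exp (z\<^sup>2 / (4 * (1 + t)))"

definition \<mu>_in :: "real \<Rightarrow> real" where
  "\<mu>_in = \<mu> 0"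

text \<open>
  Solutions are classical in the open quadrant and continuous up to its boundary; the initial
  datum is thereby represented by its continuous version on \<open>{0..}\<close>, whose value at \<open>0\<close> is its
  trace.
\<close>

definition heat_solution :: "(real \<Rightarrow> real) \<Rightarrow> (real \<Rightarrow> real \<Rightarrow> real) \<Rightarrow> bool" where
  "heat_solution u0 u \<longleftrightarrow>
     continuous_on ({0..} \<times> {0..}) (\<lambda>(t, z). u t z) \<and>
     (\<forall>t>0. \<forall>z>0. (\<lambda>s. u s z) differentiable (at t) \<and>
        u t differentiable (at z) \<and> deriv (u t) differentiable (at z) \<and>
        deriv (\<lambda>s. u s z) t - deriv (deriv (u t)) z = 0) \<and>
     (\<forall>z\<ge>0. u 0 z = u0 z) \<and>
     (\<forall>t\<ge>0. u t 0 = 0)"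

end

theory Submission
  imports Defs "HOL-Probability.Distributions"
begin

text \<open>
  The weighted Sobolev bound forces \<open>U0\<close> and its first two derivatives to decay like \<open>exp (- z)\<close>.
  Integrating from infinity three more times gives functions \<open>f 0, \<dots>, f 5\<close> on the half line with
  \<open>(f k)' = f (k + 1)\<close> and \<open>f 3 = U0\<close>, all of size \<open>\<epsilon> exp (- z)\<close>. The boundary condition says
  \<open>f 3 0 = 0\<close> and the vanishing moment says \<open>f 1 0 = 0\<close>, so the even extensions of \<open>f 0, f 2, f 4\<close> and the
  odd extensions of \<open>f 1, f 3, f 5\<close> still form a chain of derivatives on the whole line, up to a jump
  of the last one at the origin.

  By the maximum principle \<open>U t z\<close> is the average of the odd extension of \<open>U0\<close> over a Gaussian of
  variance \<open>2 t\<close> around \<open>z\<close>. Differentiating under the integral bounds \<open>U\<close> for small times. For large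
  times, with \<open>s = sqrt (2 t)\<close>, Gaussian integration by parts moves all derivatives from \<open>f k\<close> to
  the density: the average of \<open>f k\<close> is \<open>s ^ (- k)\<close> times an average of \<open>f 0\<close> against the \<open>k\<close>-th
  Hermite polynomial. The factor \<open>z\<close> costs one power of \<open>s\<close>, which leaves \<open>s ^ (- 3)\<close> for \<open>z \<partial>\<^sub>z U\<close>.
\<close>

section \<open>Smooth bump functions\<close>

text \<open>The rate is a count of derivatives. The first derivative of \<open>U0\<close> is
  \<open>f 4\<close>, four steps above the bounded \<open>f 0\<close>, hence
  \<open>s ^ (- 4)\<close>; the weight \<open>z\<close> gives back one power, and
  \<open>s ^ (- 3)\<close> is of order \<open>(1 + t) powr (- 3 / 2)\<close>. The other two norms
  decay faster. Without the vanishing moment the odd extension of \<open>f 1\<close> would jump at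
  0, and integration by parts would have to stop at \<open>f 2\<close>. The same parity obstruction
  appears at the top: \<open>f 5 0\<close>, the second derivative of \<open>U0\<close> at 0, need
  not vanish. That jump is harmless because for \<open>s > 0\<close> the Gaussian gives no mass to
  the single point where \<open>z + s * x = 0\<close>. Two obstacles shape the rest. Derivatives of
  the data are weak and known only up to null sets, so the chain is built by integrating the third
  one and identified with \<open>U0\<close> only afterwards; this needs a fundamental theorem of
  calculus for weak derivatives, obtained from explicit smooth test functions. And the half line is
  unbounded, so uniqueness requires an a priori bound on \<open>U\<close>; the weighted Sobolev
  bound supplies one on every finite time interval.\<close>

definition bump_fun :: "real \<Rightarrow> real \<Rightarrow> real \<Rightarrow> real poly \<Rightarrow> nat \<Rightarrow> real \<Rightarrow> real" where
  "bump_fun c a b p k x = (if a < x \<and> x < b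
     then poly p x * (1 / (c * (x - a) * (b - x))) ^ k * exp (- 1 / (c * (x - a) * (b - x))) else 0)"

text \<open>The term of degree \<open>k + 2\<close> of the exponential series is below the whole
  sum. With \<open>r = 1 / w\<close> the bound becomes a multiple of \<open>w\<^sup>2\<close>, and
  this square makes bumps differentiable at the ends of their support.\<close>

lemma power_exp_minus_bound:
  fixes r :: real
  assumes "r > 0"
  shows "r ^ k * exp (- r) \<le> fact (k + 2) / r\<^sup>2"
proof -
  have "r ^ (k + 2) / fact (k + 2) \<le> exp r"
    using sum_le_suminf[OF summable_exp[of r], of "{k + 2}"] assms
    by (simp add: exp_def field_simps del: fact_Suc power_Suc power_Suc2 add_2_eq_Suc')
  then have "r ^ k * r\<^sup>2 \<le> fact (k + 2) * exp r"
    by (simp add: power_add divide_le_eq mult.commute del: fact_Suc power_Suc add_2_eq_Suc')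
  then show ?thesis
    using assms by (simp add: exp_minus divide_simps mult.commute del: fact_Suc add_2_eq_Suc')
qed

lemma has_real_derivative_0_quadratic:
  fixes f q :: "real \<Rightarrow> real"
  assumes "\<And>x. \<bar>f x\<bar> \<le> (x - x0)\<^sup>2 * \<bar>q x\<bar>" and q: "isCont q x0"
  shows "(f has_real_derivative 0) (at x0)"
proof -
  have f0: "f x0 = 0" using assms(1)[of x0] by simp
  have "((\<lambda>x. \<bar>x - x0\<bar> * \<bar>q x\<bar>) \<longlongrightarrow> \<bar>x0 - x0\<bar> * \<bar>q x0\<bar>) (at x0)"
    using q unfolding isCont_def by (intro tendsto_intros)
  then have lim: "((\<lambda>x. \<bar>x - x0\<bar> * \<bar>q x\<bar>) \<longlongrightarrow> 0) (at x0)" by simp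
  have "((\<lambda>x. (f x - f x0) / (x - x0)) \<longlongrightarrow> 0) (at x0)"
  proof (rule Lim_null_comparison[OF _ lim], rule eventuallyI)
    fix x
    show "norm ((f x - f x0) / (x - x0)) \<le> \<bar>x - x0\<bar> * \<bar>q x\<bar>"
    proof (cases "x = x0")
      case False
      have "\<bar>f x\<bar> \<le> \<bar>x - x0\<bar> * (\<bar>x - x0\<bar> * \<bar>q x\<bar>)"
        using assms(1)[of x] by (metis mult.assoc power2_abs power2_eq_square)
      then show ?thesis using False f0 by (simp add: divide_simps mult.commute)
    qed simp
  qed
  then show ?thesis by (simp add: has_field_derivative_iff)
qed

text \<open>With \<open>w = c * (x - a) * (b - x)\<close>, functions of the form polynomial times
  \<open>(1 / w) ^ k * exp (- 1 / w)\<close> are closed under differentiation; this is why bumps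
  carry the parameters \<open>p\<close> and \<open>k\<close>. Outside the open interval the
  exponential beats every power of \<open>1 / w\<close>, so the derivative is 0 there.\<close>

lemma bump_fun_has_derivative:
  assumes c: "c > 0"
  shows "\<exists>p' k'. \<forall>x. (bump_fun c a b p k has_real_derivative bump_fun c a b p' k' x) (at x)"
proof -
  define W where "W = smult c ([:- a, 1:] * [:b, - 1:])"
  have W: "poly W x = c * (x - a) * (b - x)" for x by (simp add: W_def algebra_simps)
  have W': "poly (pderiv W) x = c * (b - x) - c * (x - a)" for x
    by (simp add: W_def pderiv_mult pderiv_smult pderiv_pCons algebra_simps)
  \<comment> \<open>Found by multiplying the derivative of
    \<open>p * W ^ (- k) * exp (- 1 / W)\<close> by
    \<open>W ^ (k + 2) * exp (1 / W)\<close>.\<close>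
  define p' where "p' = pderiv p * W\<^sup>2 - smult (of_nat k) (p * pderiv W * W) + p * pderiv W"
  have "(bump_fun c a b p k has_real_derivative bump_fun c a b p' (k + 2) x) (at x)" for x
  proof (cases "a < x \<and> x < b")
    case True
    have pos: "poly W x > 0" using True c by (simp add: W)
    have dW: "(poly W has_real_derivative poly (pderiv W) x) (at x)" by (rule poly_DERIV)
    define g where "g x = 1 / poly W x" for x
    have dg: "(g has_real_derivative (- poly (pderiv W) x / (poly W x)\<^sup>2)) (at x)"
      unfolding g_def using pos
      by (auto intro!: derivative_eq_intros dW simp: power2_eq_square)
    have "((\<lambda>x. poly p x * g x ^ k * exp (- g x)) has_real_derivative
       (poly (pderiv p) x * g x ^ k +
        poly p x * (of_nat k * g x ^ (k - 1) * (- poly (pderiv W) x / (poly W x)\<^sup>2)))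
         * exp (- g x) +
        poly p x * g x ^ k * (exp (- g x) * (poly (pderiv W) x / (poly W x)\<^sup>2)))
       (at x)"
      by (auto intro!: derivative_eq_intros dg poly_DERIV simp: algebra_simps)
    then have "((\<lambda>x. poly p x * (1 / poly W x) ^ k * exp (- 1 / poly W x)) has_real_derivative
       (poly (pderiv p) x * (1 / poly W x) ^ k +
        poly p x * (of_nat k * (1 / poly W x) ^ (k - 1) * (- poly (pderiv W) x / (poly W x)\<^sup>2)))
         * exp (- 1 / poly W x) +
        poly p x * (1 / poly W x) ^ k * (exp (- 1 / poly W x) * (poly (pderiv W) x / (poly W x)\<^sup>2)))
       (at x)"
      by (simp add: g_def)
    also have "(poly (pderiv p) x * (1 / poly W x) ^ k +
        poly p x * (of_nat k * (1 / poly W x) ^ (k - 1) * (- poly (pderiv W) x / (poly W x)\<^sup>2)))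
         * exp (- 1 / poly W x) +
        poly p x * (1 / poly W x) ^ k * (exp (- 1 / poly W x) * (poly (pderiv W) x / (poly W x)\<^sup>2))
      = poly p' x * (1 / poly W x) ^ (k + 2) * exp (- 1 / poly W x)"
    proof -
      \<comment> \<open>For \<open>k = 0\<close> the exponent \<open>k - 1\<close> truncates to 0;
        the factor \<open>real k\<close> keeps the identity true.\<close>
      have k: "real k * (1 / poly W x) ^ (k - 1) = real k * (poly W x * (1 / poly W x) ^ k)"
        using pos by (cases k) auto
      define R where "R = (1 / poly W x) ^ k"
      have "poly p x * (of_nat k * (1 / poly W x) ^ (k - 1) * (- poly (pderiv W) x / (poly W x)\<^sup>2))
          = poly p x * (real k * (poly W x * (1 / poly W x) ^ k)) * (- poly (pderiv W) x / (poly W x)\<^sup>2)"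
        by (simp only: k)
      then show ?thesis using pos unfolding power_add R_def[symmetric]
        by (simp add: p'_def power2_eq_square field_simps)
    qed
    also have "\<dots> = bump_fun c a b p' (k + 2) x"
      using True by (simp add: bump_fun_def W)
    finally have D: "((\<lambda>x. poly p x * (1 / poly W x) ^ k * exp (- 1 / poly W x))
      has_real_derivative bump_fun c a b p' (k + 2) x) (at x)" .
    show ?thesis
      by (rule has_field_derivative_transform_within_open[OF D, of "{a<..<b}"])
        (use True in \<open>auto simp: bump_fun_def W\<close>)
  next
    case False
    \<comment> \<open>The point \<open>x\<close> lies at or beyond one of the two ends, so one of
      the factors in \<open>(y - a)\<^sup>2 * (b - y)\<^sup>2\<close> is at most
      \<open>(y - x)\<^sup>2\<close>. The sum of both squares bounds the other factor, whichever end
      it is.\<close>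
    define q where "q x = poly p x * fact (k + 2) * c\<^sup>2 * ((x - a)\<^sup>2 + (b - x)\<^sup>2)" for x
    have "\<bar>bump_fun c a b p k y\<bar> \<le> (y - x)\<^sup>2 * \<bar>q y\<bar>" for y
    proof (cases "a < y \<and> y < b")
      case True
      define w where "w = c * (y - a) * (b - y)"
      have w: "w > 0" using True c by (simp add: w_def)
      have "(1 / w) ^ k * exp (- (1 / w)) \<le> fact (k + 2) / (1 / w)\<^sup>2"
        using w by (intro power_exp_minus_bound) simp
      then have "\<bar>bump_fun c a b p k y\<bar> \<le> \<bar>poly p y\<bar> * (fact (k + 2) * w\<^sup>2)"
        using True w unfolding bump_fun_def w_def[symmetric]
        by (simp add: abs_mult mult.assoc divide_simps mult_left_mono)
      also have "\<dots> = \<bar>poly p y\<bar> * fact (k + 2) * c\<^sup>2 * ((y - a)\<^sup>2 * (b - y)\<^sup>2)"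
        by (simp add: w_def power_mult_distrib)
      also have "\<dots> \<le> \<bar>poly p y\<bar> * fact (k + 2) * c\<^sup>2 * ((y - x)\<^sup>2 * ((y - a)\<^sup>2 + (b - y)\<^sup>2))"
      proof (intro mult_left_mono)
        consider "x \<le> a" | "x \<ge> b" using False by linarith
        then show "(y - a)\<^sup>2 * (b - y)\<^sup>2 \<le> (y - x)\<^sup>2 * ((y - a)\<^sup>2 + (b - y)\<^sup>2)"
        proof cases
          case 1
          then have "(y - a)\<^sup>2 \<le> (y - x)\<^sup>2" using True by (intro power_mono) auto
          then show ?thesis by (intro mult_mono) auto
        next
          case 2
          then have "(b - y)\<^sup>2 \<le> (x - y)\<^sup>2" using True by (intro power_mono) auto
          then have "(b - y)\<^sup>2 * (y - a)\<^sup>2 \<le> (x - y)\<^sup>2 * ((y - a)\<^sup>2 + (b - y)\<^sup>2)"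
            by (intro mult_mono) auto
          then show ?thesis by (simp add: power2_commute mult.commute)
        qed
      qed auto
      also have "\<dots> = (y - x)\<^sup>2 * \<bar>q y\<bar>"
        by (simp add: q_def abs_mult)
      finally show ?thesis .
    qed (auto simp: bump_fun_def)
    moreover have "isCont q x" unfolding q_def by (intro continuous_intros)
    ultimately have "(bump_fun c a b p k has_real_derivative 0) (at x)"
      by (rule has_real_derivative_0_quadratic)
    moreover have "bump_fun c a b p' (k + 2) x = 0" using False by (auto simp: bump_fun_def)
    ultimately show ?thesis by simp
  qed
  then show ?thesis by blast
qed

text \<open>Smoothness by invariance: a set in which each function has a derivative from the same
  set contains all iterated derivatives of its members.\<close>

lemma deriv_funpow_differentiable:
  assumes "f \<in> S" and S: "\<And>f. f \<in> S \<Longrightarrow> \<exists>g\<in>S. \<forall>x. (f has_real_derivative g x) (at x)"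
  shows "((deriv ^^ n) f) differentiable (at (x::real))"
proof -
  have "(deriv ^^ n) f \<in> S"
  proof (induction n)
    case (Suc n)
    then obtain g where "g \<in> S" and g: "\<forall>x. ((deriv ^^ n) f has_real_derivative g x) (at x)"
      using S by blast
    moreover have "deriv ((deriv ^^ n) f) = g" using g by (auto intro!: ext DERIV_imp_deriv)
    ultimately show ?case by simp
  qed (use assms in simp)
  then show ?thesis using S real_differentiable_def by blast
qed

definition bump :: "real \<Rightarrow> real \<Rightarrow> real \<Rightarrow> real \<Rightarrow> real" where
  "bump c a b x = (if a < x \<and> x < b then exp (- 1 / (c * (x - a) * (b - x))) else 0)"

lemma bump_eq_bump_fun: "bump c a b = bump_fun c a b 1 0"
  by (auto simp: bump_def bump_fun_def)

lemma bump_smooth: "c > 0 \<Longrightarrow> ((deriv ^^ n) (bump c a b)) differentiable (at x)"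
  unfolding bump_eq_bump_fun
  by (rule deriv_funpow_differentiable[of _ "{bump_fun c a b p k | p k. True}"])
    (use bump_fun_has_derivative in \<open>blast+\<close>)

lemma bump_continuous: "c > 0 \<Longrightarrow> continuous_on S (bump c a b)"
  using bump_smooth[of c 0 a b]
  by (auto intro!: continuous_at_imp_continuous_on differentiable_imp_continuous_within)

lemma bump_bounds: "c > 0 \<Longrightarrow> 0 \<le> bump c a b x \<and> bump c a b x \<le> 1"
  by (auto simp: bump_def)

lemma bump_translate: "bump c (a + d) (b + d) x = bump c a b (x - d)"
  by (simp add: bump_def algebra_simps)

text \<open>
  As \<open>c\<close> tends to infinity these bumps tend boundedly to the indicator of \<open>(a, b)\<close>; testing against
  them yields integrals over intervals without any mollification.
\<close>

lemma test_fun_bump: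
  assumes "c > 0" "0 < a" "a \<le> b"
  shows "test_fun (bump c a b)"
  unfolding test_fun_def
proof (intro conjI allI)
  show "((deriv ^^ n) (bump c a b)) differentiable (at x)" for n x using assms by (simp add: bump_smooth)
  have "\<forall>x. x \<notin> {a..b} \<longrightarrow> bump c a b x = 0" by (auto simp: bump_def)
  then show "\<exists>a' b'. 0 < a' \<and> a' \<le> b' \<and> (\<forall>x. x \<notin> {a'..b'} \<longrightarrow> bump c a b x = 0)"
    using assms by blast
qed

lemma bump_tendsto_indicator:
  "(\<lambda>n. bump (real (Suc n)) a b x) \<longlonglongrightarrow> indicator {a<..<b} x"
proof (cases "a < x \<and> x < b")
  case True
  have "(\<lambda>n. exp (- (1 / ((x - a) * (b - x))) * inverse (real (Suc n)))) \<longlonglongrightarrow> exp (- (1 / ((x - a) * (b - x))) * 0)"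
    by (intro tendsto_intros LIMSEQ_inverse_real_of_nat)
  then show ?thesis using True by (simp add: bump_def field_simps)
next
  case False
  then have "bump c a b x = 0" for c by (auto simp: bump_def)
  then show ?thesis using False by (auto simp: indicator_def)
qed

text \<open>A smooth approximation of a trapezoid that rises on \<open>[a, a + \<eta>]\<close> and
  falls on \<open>[b, b + \<eta>]\<close>. The two bumps are translates of each other, so rise and
  fall cancel and the support is compact; testing with it compares the integrals of a function near
  \<open>a\<close> and near \<open>b\<close>.\<close>

definition trap_fun :: "real \<Rightarrow> real \<Rightarrow> real \<Rightarrow> real \<Rightarrow> real \<Rightarrow> real" where
  "trap_fun c a b \<eta> x = integral {0..x} (\<lambda>y. bump c a (a + \<eta>) y - bump c b (b + \<eta>) y)"

lemma trap_fun_has_derivative: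
  assumes "c > 0" "0 < a" "a < b" "\<eta> > 0"
  shows "(trap_fun c a b \<eta> has_real_derivative (bump c a (a + \<eta>) x - bump c b (b + \<eta>) x)) (at x)"
proof (cases "x < a")
  case True
  \<comment> \<open>Differentiating an indefinite integral over \<open>{0..x}\<close> needs
    \<open>x > 0\<close>; to the left of \<open>a\<close>, also where the interval is empty, the
    function is locally 0.\<close>
  have "trap_fun c a b \<eta> y = 0" if "y < a" for y
  proof -
    have "trap_fun c a b \<eta> y = integral {0..y} (\<lambda>_. 0)" unfolding trap_fun_def
      by (rule integral_cong) (use that assms in \<open>auto simp: bump_def\<close>)
    then show ?thesis by simp
  qed
  then have "((\<lambda>_. 0) has_real_derivative (bump c a (a + \<eta>) x - bump c b (b + \<eta>) x)) (at x)"
    using assms True by (simp add: bump_def)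
  then show ?thesis
    by (rule has_field_derivative_transform_within_open[of _ _ _ "{..<a}"])
      (use True \<open>\<And>y. y < a \<Longrightarrow> _ = 0\<close> in auto)
next
  case False
  have "((\<lambda>u. integral {0..u} (\<lambda>y. bump c a (a + \<eta>) y - bump c b (b + \<eta>) y)) has_real_derivative
     (bump c a (a + \<eta>) x - bump c b (b + \<eta>) x)) (at x within {0..x + 1})"
    by (rule integral_has_real_derivative) (use assms False in \<open>auto intro!: continuous_intros bump_continuous\<close>)
  moreover have "at x within {0..x + 1} = at x"
    by (rule at_within_interior) (use assms False in auto)
  ultimately show ?thesis unfolding trap_fun_def by simp
qed

lemma integral_bump_translate:
  assumes "c > 0" "0 < a" "0 < b" "\<eta> > 0" "x \<ge> a + \<eta>" "x \<ge> b + \<eta>"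
  shows "integral {0..x} (bump c a (a + \<eta>)) = integral {0..x} (bump c b (b + \<eta>))"
proof -
  have *: "integral {0..x} (bump c d (d + \<eta>)) = integral {0..\<eta>} (bump c 0 \<eta>)"
    if d: "0 < d" "x \<ge> d + \<eta>" for d
  proof -
    have "(bump c 0 \<eta> has_integral integral {0..\<eta>} (bump c 0 \<eta>)) {0..\<eta>}"
      using assms by (intro integrable_integral integrable_continuous_interval bump_continuous) auto
    from has_integral_affinity[OF this[unfolded cbox_interval[symmetric]], of 1 "-d"]
    have "((\<lambda>x. bump c 0 \<eta> (x - d)) has_integral integral {0..\<eta>} (bump c 0 \<eta>)) {d..\<eta> + d}"
      by (simp add: cbox_interval image_affinity_atLeastAtMost_diff add.commute)
    then have "(bump c d (d + \<eta>) has_integral integral {0..\<eta>} (bump c 0 \<eta>)) {d..d + \<eta>}"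
      using bump_translate[of c 0 d \<eta>, abs_def] by (simp add: add.commute)
    then have "(bump c d (d + \<eta>) has_integral integral {0..\<eta>} (bump c 0 \<eta>)) {0..x}"
      by (rule has_integral_on_superset) (use d assms in \<open>auto simp: bump_def\<close>)
    then show ?thesis by (rule integral_unique)
  qed
  show ?thesis using *[of a] *[of b] assms by simp
qed

lemma trap_fun_support:
  assumes "c > 0" "0 < a" "a < b" "\<eta> > 0" "x \<notin> {a..b + \<eta>}"
  shows "trap_fun c a b \<eta> x = 0"
proof (cases "x < a")
  case True
  have "trap_fun c a b \<eta> x = integral {0..x} (\<lambda>_. 0)" unfolding trap_fun_def
    by (rule integral_cong) (use True assms in \<open>auto simp: bump_def\<close>)
  then show ?thesis by simp
next
  case False
  then have "trap_fun c a b \<eta> x = integral {0..x} (bump c a (a + \<eta>)) - integral {0..x} (bump c b (b + \<eta>))"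
    unfolding trap_fun_def using assms
    by (intro integral_diff integrable_continuous_interval bump_continuous) auto
  then show ?thesis using integral_bump_translate[of c a b \<eta> x] assms False by simp
qed

lemma test_fun_trap_fun:
  assumes "c > 0" "0 < a" "a < b" "\<eta> > 0"
  shows "test_fun (trap_fun c a b \<eta>)"
  unfolding test_fun_def
proof (intro conjI allI)
  let ?f = "\<lambda>x. bump c a (a + \<eta>) x - bump c b (b + \<eta>) x"
  let ?B = "\<lambda>p k q l x. bump_fun c a (a + \<eta>) p k x - bump_fun c b (b + \<eta>) q l x"
  \<comment> \<open>An invariant set: the derivative of the trapezoid is a difference of bumps, and
    differences of bumps reproduce themselves.\<close>
  let ?S = "insert (trap_fun c a b \<eta>) {?B p k q l | p k q l. True}"
  show "((deriv ^^ n) (trap_fun c a b \<eta>)) differentiable (at x)" for n x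
  proof (rule deriv_funpow_differentiable[of _ ?S])
    fix f assume "f \<in> ?S"
    then consider "f = trap_fun c a b \<eta>" | p k q l where "f = ?B p k q l" by blast
    then show "\<exists>g\<in>?S. \<forall>x. (f has_real_derivative g x) (at x)"
    proof cases
      case 1
      have "?f = ?B 1 0 1 0" by (simp add: bump_eq_bump_fun)
      then have "?f \<in> ?S" by blast
      then show ?thesis using 1 trap_fun_has_derivative[OF assms] by (intro bexI[of _ ?f]) simp_all
    next
      case 2
      obtain p' k' where "\<forall>x. (bump_fun c a (a + \<eta>) p k has_real_derivative bump_fun c a (a + \<eta>) p' k' x) (at x)"
        using bump_fun_has_derivative assms(1) by blast
      moreover obtain q' l' where "\<forall>x. (bump_fun c b (b + \<eta>) q l has_real_derivative bump_fun c b (b + \<eta>) q' l' x) (at x)"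
        using bump_fun_has_derivative assms(1) by blast
      ultimately have "\<forall>x. (f has_real_derivative ?B p' k' q' l' x) (at x)"
        unfolding 2 by (blast intro: DERIV_diff)
      moreover have "?B p' k' q' l' \<in> ?S" by blast
      ultimately show ?thesis by (intro bexI[of _ "?B p' k' q' l'"]) simp_all
    qed
  qed simp
  have "\<forall>x. x \<notin> {a..b + \<eta>} \<longrightarrow> trap_fun c a b \<eta> x = 0" "a \<le> b + \<eta>"
    using assms trap_fun_support by auto
  then show "\<exists>a' b'. 0 < a' \<and> a' \<le> b' \<and> (\<forall>x. x \<notin> {a'..b'} \<longrightarrow> trap_fun c a b \<eta> x = 0)"
    using assms(2) by blast
qed

section \<open>Weak derivatives\<close>

lemma set_lebesgue_integral_support:
  fixes f :: "'a \<Rightarrow> real"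
  assumes "A \<subseteq> B" "\<And>x. x \<in> B - A \<Longrightarrow> f x = 0"
  shows "(LINT x:B|M. f x) = (LINT x:A|M. f x)"
    and "set_integrable M B f \<longleftrightarrow> set_integrable M A f"
proof -
  have "indicator B x *\<^sub>R f x = indicator A x *\<^sub>R f x" for x
    using assms by (auto simp: indicator_def)
  then show "(LINT x:B|M. f x) = (LINT x:A|M. f x)" "set_integrable M B f \<longleftrightarrow> set_integrable M A f"
    by (simp_all only: set_lebesgue_integral_def set_integrable_def)
qed

lemma locally_integrableD:
  "locally_integrable h \<Longrightarrow> 0 < a \<Longrightarrow> set_integrable lebesgue {a..b} h"
  by (cases "a \<le> b") (auto simp: locally_integrable_def)

lemma test_funE:
  assumes "test_fun \<phi>"
  obtains a b where "0 < a" "a \<le> b" "\<And>x. x \<notin> {a..b} \<Longrightarrow> \<phi> x = 0"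
  using assms unfolding test_fun_def by blast

lemma test_fun_differentiable: "test_fun \<phi> \<Longrightarrow> \<phi> differentiable (at x)"
  unfolding test_fun_def by (metis funpow_0)

lemma test_fun_continuous: "test_fun \<phi> \<Longrightarrow> continuous_on S \<phi>"
  by (auto intro!: continuous_at_imp_continuous_on differentiable_imp_continuous_within
      dest: test_fun_differentiable)

lemma test_fun_deriv:
  assumes "test_fun \<phi>"
  shows "test_fun (deriv \<phi>)"
proof -
  obtain a b where ab: "0 < a" "a \<le> b" "\<And>x. x \<notin> {a..b} \<Longrightarrow> \<phi> x = 0" using test_funE[OF assms] by blast
  have "deriv \<phi> x = 0" if "x \<notin> {a..b}" for x
  proof -
    have "(\<phi> has_real_derivative 0) (at x)"
      by (rule has_field_derivative_transform_within_open[of "\<lambda>_. 0" _ _ "- {a..b}"])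
        (use that ab in auto)
    then show ?thesis by (rule DERIV_imp_deriv)
  qed
  moreover have "(deriv ^^ n) (deriv \<phi>) differentiable (at x)" for n x
    using assms unfolding test_fun_def by (metis funpow_Suc_right o_apply)
  ultimately show ?thesis using ab unfolding test_fun_def by blast
qed

lemma test_fun_has_derivative: "test_fun \<phi> \<Longrightarrow> (\<phi> has_real_derivative deriv \<phi> x) (at x)"
  using test_fun_differentiable DERIV_deriv_iff_real_differentiable by blast

lemma set_integrable_mult_continuous:
  fixes h \<phi> :: "real \<Rightarrow> real"
  assumes "set_integrable lebesgue {a..b} h" "continuous_on {a..b} \<phi>"
  shows "set_integrable lebesgue {a..b} (\<lambda>z. h z * \<phi> z)"
proof -
  have "(\<lambda>z. \<phi> z * h z) absolutely_integrable_on {a..b}"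
  proof (rule absolutely_integrable_bounded_measurable_product_real)
    show "\<phi> \<in> borel_measurable (lebesgue_on {a..b})"
      by (rule continuous_imp_measurable_on_sets_lebesgue) (use assms in auto)
    show "bounded (\<phi> ` {a..b})" using assms(2) compact_continuous_image compact_imp_bounded by blast
  qed (use assms in auto)
  then show ?thesis by (simp add: mult.commute)
qed

lemma set_integrable_mult_test_fun:
  assumes "locally_integrable h" "test_fun \<phi>"
  shows "set_integrable lebesgue {0<..} (\<lambda>z. h z * \<phi> z)"
proof -
  obtain a b where ab: "0 < a" "a \<le> b" "\<And>x. x \<notin> {a..b} \<Longrightarrow> \<phi> x = 0" using test_funE[OF assms(2)] by blast
  have "set_integrable lebesgue {a..b} (\<lambda>z. h z * \<phi> z)"
    by (intro set_integrable_mult_continuous locally_integrableD test_fun_continuous assms ab)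
  then show ?thesis using set_lebesgue_integral_support(2)[of "{a..b}" "{0<..}"] ab by force
qed

lemma locally_integrable_diff:
  "locally_integrable g \<Longrightarrow> locally_integrable g' \<Longrightarrow> locally_integrable (\<lambda>x. g x - g' x)"
  unfolding locally_integrable_def by (auto intro: set_integral_diff)

text \<open>The differentiation theorem wants integrability on every box, whereas \<open>h\<close>
  may fail to be integrable near 0. It is therefore applied to the truncations \<open>H n\<close>,
  whose countably many exceptional sets are united; near a given \<open>x > 0\<close> a late
  truncation agrees with \<open>h\<close>.\<close>

lemma lebesgue_points:
  assumes h: "locally_integrable h"
  obtains N where "negligible N"
    "\<And>x. x > 0 \<Longrightarrow> x \<notin> N \<Longrightarrow>
      (\<lambda>m. (LINT y:{x..x + inverse (real (Suc m))}|lebesgue. h y) * real (Suc m)) \<longlonglongrightarrow> h x"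
proof -
  define H where "H n x = (if x \<ge> inverse (real (Suc n)) then h x else 0)" for n x
  have int: "H n integrable_on cbox a b" for n a b
  proof -
    have "set_integrable lebesgue {max a (inverse (real (Suc n)))..b} h"
      by (intro locally_integrableD h) (simp add: less_max_iff_disj)
    moreover have "indicator {max a (inverse (real (Suc n)))..b} x *\<^sub>R h x = indicator {a..b} x *\<^sub>R H n x" for x
      by (auto simp: indicator_def H_def)
    ultimately have "set_integrable lebesgue {a..b} (H n)" by (simp add: set_integrable_def)
    then show ?thesis unfolding cbox_interval by (rule set_lebesgue_integral_eq_integral(1))
  qed
  have "\<exists>N. negligible N \<and> (\<forall>x e. x \<notin> N \<longrightarrow> 0 < e \<longrightarrow>
      (\<exists>d>0. \<forall>k. 0 < k \<and> k < d \<longrightarrow> \<bar>integral {x..x + k} (H n) / k - H n x\<bar> < e))" for n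
    using integrable_ccontinuous_explicit[of "H n", OF int]
    by (simp add: cbox_interval divide_inverse mult.commute) metis
  then obtain N where N: "\<And>n. negligible (N n)"
    "\<And>n x e. x \<notin> N n \<Longrightarrow> 0 < e \<Longrightarrow>
      \<exists>d>0. \<forall>k. 0 < k \<and> k < d \<longrightarrow> \<bar>integral {x..x + k} (H n) / k - H n x\<bar> < e"
    by metis
  show ?thesis
  proof (rule that)
    show "negligible (\<Union>n. N n)" by (intro negligible_countable_Union) (use N in auto)
    fix x :: real assume x: "x > 0" "x \<notin> (\<Union>n. N n)"
    obtain n where n: "inverse (real (Suc n)) < x" using x reals_Archimedean by blast
    have eq: "integral {x..x + k} (H n) = (LINT y:{x..x + k}|lebesgue. h y)" for k
    proof -
      have "integral {x..x + k} (H n) = integral {x..x + k} h"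
        by (rule integral_cong) (use n in \<open>auto simp: H_def\<close>)
      then show ?thesis
        using set_lebesgue_integral_eq_integral(2)[OF locally_integrableD[OF h x(1)]] by simp
    qed
    show "(\<lambda>m. (LINT y:{x..x + inverse (real (Suc m))}|lebesgue. h y) * real (Suc m)) \<longlonglongrightarrow> h x"
    proof (rule LIMSEQ_I)
      fix e :: real assume "e > 0"
      then obtain d where d: "d > 0"
        "\<And>k. 0 < k \<and> k < d \<Longrightarrow> \<bar>integral {x..x + k} (H n) / k - H n x\<bar> < e"
        using N(2)[of x n e] x by blast
      obtain m0 where m0: "inverse (real (Suc m0)) < d" using d reals_Archimedean by blast
      have "norm ((LINT y:{x..x + inverse (real (Suc m))}|lebesgue. h y) * real (Suc m) - h x) < e"
        if "m \<ge> m0" for m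
      proof -
        have "inverse (real (Suc m)) \<le> inverse (real (Suc m0))" using that by (intro le_imp_inverse_le) auto
        then have "inverse (real (Suc m)) < d" using m0 by (rule le_less_trans)
        then have "0 < inverse (real (Suc m)) \<and> inverse (real (Suc m)) < d" by simp
        from d(2)[OF this] show ?thesis using n by (simp add: eq H_def divide_inverse)
      qed
      then show "\<exists>no. \<forall>m\<ge>no. norm ((LINT y:{x..x + inverse (real (Suc m))}|lebesgue. h y) * real (Suc m) - h x) < e"
        by blast
    qed
  qed
qed

lemma bump_integral_tendsto:
  assumes h: "locally_integrable h" and a: "0 < a" "a < b"
  shows "(\<lambda>n. LINT z:{0<..}|lebesgue. h z * bump (real (Suc n)) a b z) \<longlonglongrightarrow> (LINT z:{a..b}|lebesgue. h z)"
proof -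
  have hab: "set_integrable lebesgue {a..b} h" using h a by (intro locally_integrableD)
  have eq: "(LINT z:{0<..}|lebesgue. h z * bump (real (Suc n)) a b z)
     = (LINT z:{a..b}|lebesgue. h z * bump (real (Suc n)) a b z)" for n
    by (rule set_lebesgue_integral_support(1)) (use a in \<open>auto simp: bump_def\<close>)
  have "(\<lambda>n. LINT z|lebesgue. indicator {a..b} z *\<^sub>R (h z * bump (real (Suc n)) a b z))
    \<longlonglongrightarrow> (LINT z|lebesgue. indicator {a..b} z *\<^sub>R h z)"
  proof (rule integral_dominated_convergence)
    show "integrable lebesgue (\<lambda>z. norm (indicator {a..b} z *\<^sub>R h z))"
      using hab unfolding set_integrable_def by (rule integrable_norm)
    show "(\<lambda>z. indicator {a..b} z *\<^sub>R h z) \<in> borel_measurable lebesgue"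
      using hab unfolding set_integrable_def by (rule borel_measurable_integrable)
    show "(\<lambda>z. indicator {a..b} z *\<^sub>R (h z * bump (real (Suc n)) a b z)) \<in> borel_measurable lebesgue" for n
      using set_integrable_mult_continuous[OF hab bump_continuous[of "real (Suc n)"]]
      unfolding set_integrable_def by (intro borel_measurable_integrable) simp
    show "AE z in lebesgue. norm (indicator {a..b} z *\<^sub>R (h z * bump (real (Suc n)) a b z))
        \<le> norm (indicator {a..b} z *\<^sub>R h z)" for n
      using bump_bounds[of "real (Suc n)" a b]
      by (intro AE_I2) (auto simp: abs_mult indicator_def mult_left_le)
    \<comment> \<open>At the two end points the bumps vanish while the closed interval has indicator
      1.\<close>
    have "AE z in lebesgue. z \<notin> {a, b}"
      by (rule AE_not_in) (auto simp: negligible_iff_null_sets[symmetric])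
    then show "AE z in lebesgue. (\<lambda>n. indicator {a..b} z *\<^sub>R (h z * bump (real (Suc n)) a b z))
        \<longlonglongrightarrow> indicator {a..b} z *\<^sub>R h z"
    proof (rule AE_mp, intro AE_I2 impI)
      fix z assume z: "z \<notin> {a, b}"
      have "(\<lambda>n. indicator {a..b} z *\<^sub>R (h z * bump (real (Suc n)) a b z))
        \<longlonglongrightarrow> indicator {a..b} z *\<^sub>R (h z * indicator {a<..<b} z)"
        by (intro tendsto_intros bump_tendsto_indicator)
      then show "(\<lambda>n. indicator {a..b} z *\<^sub>R (h z * bump (real (Suc n)) a b z))
        \<longlonglongrightarrow> indicator {a..b} z *\<^sub>R h z"
        using z by (auto simp: indicator_def split: if_splits)
    qed
  qed
  then show ?thesis unfolding eq by (simp add: set_lebesgue_integral_def)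
qed

lemma AE_positive_realsI:
  assumes "negligible N" "\<And>x. x > 0 \<Longrightarrow> x \<notin> N \<Longrightarrow> P x"
  shows "AE x in lebesgue. x > 0 \<longrightarrow> P x"
proof -
  have "AE x in lebesgue. x \<notin> N" using assms(1) by (intro AE_not_in) (simp add: negligible_iff_null_sets)
  then show ?thesis by eventually_elim (use assms(2) in auto)
qed

text \<open>The du Bois-Reymond lemma. Bumps show that the integral over every interval vanishes,
  and at Lebesgue points these integrals recover the function.\<close>

lemma locally_integrable_zero:
  assumes h: "locally_integrable h" and 0: "\<And>\<phi>. test_fun \<phi> \<Longrightarrow> (LINT z:{0<..}|lebesgue. h z * \<phi> z) = 0"
  shows "AE x in lebesgue. x > 0 \<longrightarrow> h x = 0"
proof -
  obtain N where N: "negligible N"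
    "\<And>x. x > 0 \<Longrightarrow> x \<notin> N \<Longrightarrow>
      (\<lambda>m. (LINT y:{x..x + inverse (real (Suc m))}|lebesgue. h y) * real (Suc m)) \<longlonglongrightarrow> h x"
    using lebesgue_points[OF h] by blast
  have "(LINT y:{a..b}|lebesgue. h y) = 0" if "0 < a" "a < b" for a b
  proof -
    have "(\<lambda>n. LINT z:{0<..}|lebesgue. h z * bump (real (Suc n)) a b z) \<longlonglongrightarrow> (LINT z:{a..b}|lebesgue. h z)"
      by (intro bump_integral_tendsto h that)
    moreover have "(LINT z:{0<..}|lebesgue. h z * bump (real (Suc n)) a b z) = 0" for n
      by (intro 0 test_fun_bump) (use that in auto)
    ultimately show ?thesis by (simp add: LIMSEQ_const_iff)
  qed
  then have "h x = 0" if "x > 0" "x \<notin> N" for x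
    using N(2)[OF that] that by (simp add: LIMSEQ_const_iff)
  with N(1) show ?thesis by (rule AE_positive_realsI)
qed

lemma has_weak_derivD:
  assumes "has_weak_deriv i h g" "test_fun \<phi>"
  shows "(LINT z:{0<..}|lebesgue. h z * (deriv ^^ i) \<phi> z) = (-1) ^ i * (LINT z:{0<..}|lebesgue. g z * \<phi> z)"
  using assms unfolding has_weak_deriv_def by blast

text \<open>Makes the arbitrary representative chosen by \<open>weak_deriv\<close> harmless.\<close>

lemma has_weak_deriv_unique:
  assumes "has_weak_deriv i h g" "has_weak_deriv i h g'"
  shows "AE x in lebesgue. x > 0 \<longrightarrow> g x = g' x"
proof -
  have loc: "locally_integrable g" "locally_integrable g'" using assms by (auto simp: has_weak_deriv_def)
  have "AE x in lebesgue. x > 0 \<longrightarrow> g x - g' x = 0"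
  proof (rule locally_integrable_zero)
    show "locally_integrable (\<lambda>x. g x - g' x)" by (rule locally_integrable_diff[OF loc])
    fix \<phi> assume t: "test_fun \<phi>"
    have "(-1) ^ i * (LINT z:{0<..}|lebesgue. g z * \<phi> z) = (-1) ^ i * (LINT z:{0<..}|lebesgue. g' z * \<phi> z)"
      using has_weak_derivD[OF assms(1) t] has_weak_derivD[OF assms(2) t] by simp
    then have "(LINT z:{0<..}|lebesgue. g z * \<phi> z) = (LINT z:{0<..}|lebesgue. g' z * \<phi> z)" by simp
    then show "(LINT z:{0<..}|lebesgue. (g z - g' z) * \<phi> z) = 0"
      using set_integral_diff(2)[OF set_integrable_mult_test_fun[OF loc(1) t] set_integrable_mult_test_fun[OF loc(2) t]]
      by (simp add: left_diff_distrib)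
  qed
  then show ?thesis by simp
qed

text \<open>Membership in \<open>Sobolev\<close> relates each order to \<open>h\<close> separately.
  Testing the identity of order \<open>i\<close> with the derivative of a test function links
  consecutive orders directly.\<close>

lemma has_weak_deriv_Suc:
  assumes "has_weak_deriv i h g" "has_weak_deriv (Suc i) h g'"
  shows "has_weak_deriv 1 g g'"
  unfolding has_weak_deriv_def
proof (intro conjI allI impI)
  fix \<phi> assume t: "test_fun \<phi>"
  have "(-1) ^ i * (LINT z:{0<..}|lebesgue. g z * deriv \<phi> z)
      = (-1) ^ Suc i * (LINT z:{0<..}|lebesgue. g' z * \<phi> z)"
    using has_weak_derivD[OF assms(1) test_fun_deriv[OF t]] has_weak_derivD[OF assms(2) t]
    by (simp only: funpow_Suc_right o_apply)
  then have "(LINT z:{0<..}|lebesgue. g z * deriv \<phi> z) = - (LINT z:{0<..}|lebesgue. g' z * \<phi> z)"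
    by (cases "even i") (simp_all add: minus_equation_iff)
  then show "(LINT z:{0<..}|lebesgue. g z * (deriv ^^ 1) \<phi> z)
      = (-1) ^ 1 * (LINT z:{0<..}|lebesgue. g' z * \<phi> z)"
    by simp
qed (use assms in \<open>simp_all add: has_weak_deriv_def\<close>)

section \<open>The fundamental theorem of calculus for weak derivatives\<close>

definition clamp_up :: "real \<Rightarrow> real \<Rightarrow> real" where
  "clamp_up \<eta> u = max 0 (min u \<eta>)"

lemma continuous_on_clamp_up: "continuous_on S (\<lambda>z. clamp_up \<eta> (z - a))"
  unfolding clamp_up_def by (intro continuous_intros)

lemma integral_bump_tendsto_clamp:
  assumes "0 < a" "\<eta> > 0"
  shows "(\<lambda>n. integral {0..x} (bump (real (Suc n)) a (a + \<eta>))) \<longlonglongrightarrow> clamp_up \<eta> (x - a)"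
proof -
  have "(\<lambda>n. integral {0..x} (bump (real (Suc n)) a (a + \<eta>))) \<longlonglongrightarrow> integral {0..x} (indicator {a<..<a + \<eta>})"
  proof (rule dominated_convergence(2)[where h = "\<lambda>_. 1"])
    show "bump (real (Suc n)) a (a + \<eta>) integrable_on {0..x}" for n
      by (intro integrable_continuous_interval bump_continuous) simp
    show "norm (bump (real (Suc n)) a (a + \<eta>) y) \<le> 1" for n y
      using bump_bounds[of "real (Suc n)" a "a + \<eta>" y] by simp
  qed (use bump_tendsto_indicator in auto)
  also have "integral {0..x} (indicator {a<..<a + \<eta>}) = measure lebesgue ({a<..<a + \<eta>} \<inter> {0..x})"
    by (rule integral_indicator) (auto intro: bounded_set_imp_lmeasurable)
  also have "{a<..<a + \<eta>} \<inter> {0..x} = (if x \<ge> a + \<eta> then {a<..<a + \<eta>} else {a<..x})"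
    using assms by auto
  also have "measure lebesgue \<dots> = clamp_up \<eta> (x - a)"
    using assms by (auto simp: clamp_up_def max_def min_def)
  finally show ?thesis .
qed

text \<open>The genuine trapezoid is only piecewise linear and thus no test function, so the
  identity is reached as the limit of smooth trapezoids of increasing sharpness.\<close>

lemma weak_deriv_trapezoid:
  assumes w: "has_weak_deriv 1 h g" and ab: "0 < a" "a < b" "\<eta> > 0"
  shows "(LINT z:{a..a + \<eta>}|lebesgue. h z) - (LINT z:{b..b + \<eta>}|lebesgue. h z)
     = - (LINT z:{a..b + \<eta>}|lebesgue. g z * (clamp_up \<eta> (z - a) - clamp_up \<eta> (z - b)))"
proof -
  have loc: "locally_integrable g" "locally_integrable h" using w by (auto simp: has_weak_deriv_def)
  define T where "T n = trap_fun (real (Suc n)) a b \<eta>" for n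
  have T: "T n x = integral {0..x} (bump (real (Suc n)) a (a + \<eta>)) - integral {0..x} (bump (real (Suc n)) b (b + \<eta>))" for n x
    unfolding T_def trap_fun_def
    by (intro integral_diff integrable_continuous_interval bump_continuous) auto
  have bnd: "0 \<le> integral {0..x} (bump (real (Suc n)) d (d + \<eta>)) \<and> integral {0..x} (bump (real (Suc n)) d (d + \<eta>)) \<le> \<bar>x\<bar>" for n d x
  proof -
    have "integral {0..x} (bump (real (Suc n)) d (d + \<eta>)) \<le> integral {0..x} (\<lambda>_. 1)"
      by (intro integral_le integrable_continuous_interval bump_continuous) (use bump_bounds in auto)
    then show ?thesis
      using bump_bounds by (auto intro!: integral_nonneg integrable_continuous_interval bump_continuous split: if_splits simp: max_def)
  qed
  \<comment> \<open>A bound free of \<open>n\<close>, which provides the dominating function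
    \<open>\<bar>g z * z\<bar>\<close> below.\<close>
  have Tb: "\<bar>T n x\<bar> \<le> \<bar>x\<bar>" for n x using bnd[of x n a] bnd[of x n b] unfolding T by linarith
  have test: "test_fun (T n)" for n unfolding T_def by (intro test_fun_trap_fun ab) simp
  have lhs: "(\<lambda>n. LINT z:{0<..}|lebesgue. h z * deriv (T n) z) \<longlonglongrightarrow>
    (LINT z:{a..a + \<eta>}|lebesgue. h z) - (LINT z:{b..b + \<eta>}|lebesgue. h z)"
  proof -
    have d: "deriv (T n) z = bump (real (Suc n)) a (a + \<eta>) z - bump (real (Suc n)) b (b + \<eta>) z" for n z
      unfolding T_def by (intro DERIV_imp_deriv trap_fun_has_derivative ab) simp
    have "(LINT z:{0<..}|lebesgue. h z * deriv (T n) z)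
      = (LINT z:{0<..}|lebesgue. h z * bump (real (Suc n)) a (a + \<eta>) z)
        - (LINT z:{0<..}|lebesgue. h z * bump (real (Suc n)) b (b + \<eta>) z)" for n
      unfolding d right_diff_distrib using ab
      by (intro set_integral_diff set_integrable_mult_test_fun test_fun_bump loc) auto
    then show ?thesis using ab
      by (simp only:) (intro tendsto_diff bump_integral_tendsto loc; simp)
  qed
  have gi: "set_integrable lebesgue {a..b + \<eta>} g" using loc ab by (intro locally_integrableD)
  have eqr: "(LINT z:{0<..}|lebesgue. g z * T n z) = (LINT z:{a..b + \<eta>}|lebesgue. g z * T n z)" for n
  proof (rule set_lebesgue_integral_support(1))
    show "g z * T n z = 0" if "z \<in> {0<..} - {a..b + \<eta>}" for z
      using trap_fun_support[of "real (Suc n)" a b \<eta> z] ab that by (simp add: T_def)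
  qed (use ab in auto)
  have rhs: "(\<lambda>n. LINT z:{0<..}|lebesgue. g z * T n z) \<longlonglongrightarrow>
     (LINT z:{a..b + \<eta>}|lebesgue. g z * (clamp_up \<eta> (z - a) - clamp_up \<eta> (z - b)))"
    unfolding eqr unfolding set_lebesgue_integral_def
  proof (rule integral_dominated_convergence)
    show "integrable lebesgue (\<lambda>z. norm (indicator {a..b + \<eta>} z *\<^sub>R (g z * z)))"
      using set_integrable_mult_continuous[OF gi, of "\<lambda>z. z"] unfolding set_integrable_def
      by (intro integrable_norm) (auto intro: continuous_intros)
    show "(\<lambda>z. indicator {a..b + \<eta>} z *\<^sub>R (g z * (clamp_up \<eta> (z - a) - clamp_up \<eta> (z - b)))) \<in> borel_measurable lebesgue"
      using set_integrable_mult_continuous[OF gi continuous_on_diff[OF continuous_on_clamp_up continuous_on_clamp_up]]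
      unfolding set_integrable_def by (rule borel_measurable_integrable)
    show "(\<lambda>z. indicator {a..b + \<eta>} z *\<^sub>R (g z * T n z)) \<in> borel_measurable lebesgue" for n
      using set_integrable_mult_continuous[OF gi test_fun_continuous[OF test]]
      unfolding set_integrable_def by (intro borel_measurable_integrable) simp
    show "AE z in lebesgue. norm (indicator {a..b + \<eta>} z *\<^sub>R (g z * T n z)) \<le> norm (indicator {a..b + \<eta>} z *\<^sub>R (g z * z))" for n
      using Tb[of n] by (intro AE_I2) (auto simp: abs_mult mult_left_mono)
    show "AE z in lebesgue. (\<lambda>n. indicator {a..b + \<eta>} z *\<^sub>R (g z * T n z)) \<longlonglongrightarrow>
       indicator {a..b + \<eta>} z *\<^sub>R (g z * (clamp_up \<eta> (z - a) - clamp_up \<eta> (z - b)))"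
      unfolding T using ab by (intro AE_I2 tendsto_intros integral_bump_tendsto_clamp) auto
  qed
  have "(LINT z:{0<..}|lebesgue. h z * deriv (T n) z) = - (LINT z:{0<..}|lebesgue. g z * T n z)" for n
    using has_weak_derivD[OF w test[of n]] by simp
  then show ?thesis using lhs tendsto_minus[OF rhs] LIMSEQ_unique by force
qed

lemma clamp_up_tendsto:
  "(\<lambda>m. clamp_up (inverse (real (Suc m))) u * real (Suc m)) \<longlonglongrightarrow> indicator {0<..} u"
proof (cases "u > 0")
  case True
  then obtain m0 where m0: "inverse (real (Suc m0)) < u" using reals_Archimedean by blast
  have "clamp_up (inverse (real (Suc m))) u * real (Suc m) = 1" if "m \<ge> m0" for m
  proof -
    have "inverse (real (Suc m)) \<le> inverse (real (Suc m0))" using that by (intro le_imp_inverse_le) auto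
    then have "inverse (real (Suc m)) < u" using m0 by (rule le_less_trans)
    then have "clamp_up (inverse (real (Suc m))) u = inverse (real (Suc m))"
      by (auto simp: clamp_up_def simp del: of_nat_Suc)
    then show ?thesis by simp
  qed
  then have "eventually (\<lambda>m. clamp_up (inverse (real (Suc m))) u * real (Suc m) = 1) sequentially"
    using eventually_sequentially by blast
  then show ?thesis using True by (simp add: tendsto_eventually)
qed (simp add: clamp_up_def)

text \<open>Divide the trapezoid identity by the width and let the width tend to 0. The left side
  converges at Lebesgue points of \<open>h\<close>, whence the null set \<open>N\<close>; on the
  right the normalised trapezoids tend to an indicator.\<close>

lemma weak_deriv_FTC:
  assumes w: "has_weak_deriv 1 h g"
  obtains N where "negligible N" "\<And>a b. 0 < a \<Longrightarrow> a < b \<Longrightarrow> a \<notin> N \<Longrightarrow> b \<notin> N \<Longrightarrow>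
    h b - h a = (LINT z:{a..b}|lebesgue. g z)"
proof -
  have loc: "locally_integrable g" "locally_integrable h" using w by (auto simp: has_weak_deriv_def)
  obtain N where N: "negligible N"
    "\<And>x. x > 0 \<Longrightarrow> x \<notin> N \<Longrightarrow>
      (\<lambda>m. (LINT y:{x..x + inverse (real (Suc m))}|lebesgue. h y) * real (Suc m)) \<longlonglongrightarrow> h x"
    using lebesgue_points[OF loc(2)] by blast
  show ?thesis
  proof (rule that[OF N(1)])
    fix a b :: real assume ab: "0 < a" "a < b" "a \<notin> N" "b \<notin> N"
    define e where "e m = inverse (real (Suc m))" for m
    \<comment> \<open>Widths at most 1 keep all trapezoids inside the fixed interval
      \<open>{a..b + 1}\<close>.\<close>
    have e: "e m > 0" "e m \<le> 1" for m by (auto simp: e_def divide_simps)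
    let ?c = "\<lambda>m z. clamp_up (e m) (z - a) - clamp_up (e m) (z - b)"
    have gi: "set_integrable lebesgue {a..b + 1} g" using loc ab by (intro locally_integrableD)
    have cs: "?c m z = 0" if "z \<notin> {a..b + e m}" for m z
      using that ab e[of m] by (auto simp: clamp_up_def min_def max_def)
    have "(\<lambda>m. LINT z|lebesgue. indicator {a..b + 1} z *\<^sub>R (g z * (?c m z * real (Suc m))))
       \<longlonglongrightarrow> (LINT z|lebesgue. indicator {a..b + 1} z *\<^sub>R (g z * (indicator {0<..} (z - a) - indicator {0<..} (z - b))))"
    proof (rule integral_dominated_convergence)
      show "integrable lebesgue (\<lambda>z. norm (indicator {a..b + 1} z *\<^sub>R g z))"
        using gi unfolding set_integrable_def by (rule integrable_norm)
      have "(\<lambda>z. (indicator {a..b + 1} z *\<^sub>R g z) * (indicator {a<..} z - indicator {b<..} z)) \<in> borel_measurable lebesgue"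
        using gi unfolding set_integrable_def
        by (intro borel_measurable_times borel_measurable_diff borel_measurable_indicator)
          (auto intro: borel_measurable_integrable)
      moreover have "indicator {0<..} (z - d) = (indicator {d<..} z :: real)" for z d :: real by (simp add: indicator_def)
      ultimately show "(\<lambda>z. indicator {a..b + 1} z *\<^sub>R (g z * (indicator {0<..} (z - a) - indicator {0<..} (z - b)))) \<in> borel_measurable lebesgue"
        by (simp add: mult.assoc)
      show "(\<lambda>z. indicator {a..b + 1} z *\<^sub>R (g z * (?c m z * real (Suc m)))) \<in> borel_measurable lebesgue" for m
        using set_integrable_mult_continuous[OF gi continuous_on_mult_right[OF
          continuous_on_diff[OF continuous_on_clamp_up continuous_on_clamp_up]]]
        unfolding set_integrable_def by (rule borel_measurable_integrable)
      show "AE z in lebesgue. norm (indicator {a..b + 1} z *\<^sub>R (g z * (?c m z * real (Suc m)))) \<le> norm (indicator {a..b + 1} z *\<^sub>R g z)" for m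
      proof (intro AE_I2)
        fix z
        have "\<bar>?c m z\<bar> \<le> e m" using e[of m] ab by (auto simp: clamp_up_def min_def max_def)
        then have "\<bar>?c m z\<bar> * real (Suc m) \<le> e m * real (Suc m)" by (intro mult_right_mono) auto
        then have "\<bar>?c m z * real (Suc m)\<bar> \<le> 1" by (simp add: e_def abs_mult)
        then show "norm (indicator {a..b + 1} z *\<^sub>R (g z * (?c m z * real (Suc m)))) \<le> norm (indicator {a..b + 1} z *\<^sub>R g z)"
          by (simp add: abs_mult indicator_def mult_left_le del: of_nat_Suc)
      qed
      show "AE z in lebesgue. (\<lambda>m. indicator {a..b + 1} z *\<^sub>R (g z * (?c m z * real (Suc m)))) \<longlonglongrightarrow>
         indicator {a..b + 1} z *\<^sub>R (g z * (indicator {0<..} (z - a) - indicator {0<..} (z - b)))"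
        unfolding left_diff_distrib e_def by (intro AE_I2 tendsto_intros clamp_up_tendsto)
    qed
    also have "(LINT z|lebesgue. indicator {a..b + 1} z *\<^sub>R (g z * (indicator {0<..} (z - a) - indicator {0<..} (z - b))))
      = (LINT z:{a<..b}|lebesgue. g z)"
      unfolding set_lebesgue_integral_def using ab
      by (intro Bochner_Integration.integral_cong) (auto simp: indicator_def)
    also have "\<dots> = (LINT z:{a..b}|lebesgue. g z)"
    proof -
      have "AE z in lebesgue. z \<notin> {a}" by (rule AE_not_in) (auto simp: negligible_iff_null_sets[symmetric])
      then have AE: "AE z in lebesgue. z \<in> {a<..b} \<longleftrightarrow> z \<in> {a..b}" by eventually_elim auto
      have "set_integrable lebesgue {a<..b} g" "set_integrable lebesgue {a..b} g"
        by (rule set_integrable_subset[OF gi]; auto)+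
      then show ?thesis using AE by (intro set_integral_cong_set) (auto simp: set_integrable_def set_borel_measurable_def intro: borel_measurable_integrable)
    qed
    finally have r: "(\<lambda>m. LINT z|lebesgue. indicator {a..b + 1} z *\<^sub>R (g z * (?c m z * real (Suc m)))) \<longlonglongrightarrow> (LINT z:{a..b}|lebesgue. g z)" .
    have l: "(\<lambda>m. ((LINT z:{b..b + e m}|lebesgue. h z) - (LINT z:{a..a + e m}|lebesgue. h z)) * real (Suc m)) \<longlonglongrightarrow> h b - h a"
      unfolding left_diff_distrib e_def using ab by (intro tendsto_diff N(2)) auto
    have "((LINT z:{b..b + e m}|lebesgue. h z) - (LINT z:{a..a + e m}|lebesgue. h z)) * real (Suc m)
      = (LINT z|lebesgue. indicator {a..b + 1} z *\<^sub>R (g z * (?c m z * real (Suc m))))" for m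
    proof -
      have "(LINT z:{b..b + e m}|lebesgue. h z) - (LINT z:{a..a + e m}|lebesgue. h z) = (LINT z:{a..b + e m}|lebesgue. g z * ?c m z)"
        using weak_deriv_trapezoid[OF w ab(1,2) e(1)[of m]] by simp
      also have "\<dots> = (LINT z:{a..b + 1}|lebesgue. g z * ?c m z)"
        by (rule set_lebesgue_integral_support(1)[symmetric]) (use e[of m] ab cs[of _ m] in auto)
      finally show ?thesis
        unfolding set_lebesgue_integral_def by (simp add: mult.assoc del: of_nat_Suc flip: integral_mult_left_zero)
    qed
    then show "h b - h a = (LINT z:{a..b}|lebesgue. g z)" using l r LIMSEQ_unique by force
  qed
qed

section \<open>Classical derivatives as weak derivatives\<close>

lemma test_fun_support:
  assumes "test_fun \<phi>"
  shows "\<exists>a b. 0 < a \<and> a \<le> b \<and> (\<forall>x. x \<notin> {a..b} \<longrightarrow> \<phi> x = 0 \<and> deriv \<phi> x = 0)"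
proof -
  obtain a1 b1 where 1: "0 < a1" "a1 \<le> b1" "\<And>x. x \<notin> {a1..b1} \<Longrightarrow> \<phi> x = 0"
    using test_funE[OF assms] by blast
  obtain a2 b2 where 2: "0 < a2" "a2 \<le> b2" "\<And>x. x \<notin> {a2..b2} \<Longrightarrow> deriv \<phi> x = 0"
    using test_funE[OF test_fun_deriv[OF assms]] by blast
  have "\<phi> x = 0 \<and> deriv \<phi> x = 0" if "x \<notin> {min a1 a2..max b1 b2}" for x
    using that by (intro conjI 1(3) 2(3)) auto
  then show ?thesis using 1(1,2) 2(1,2)
    by (intro exI[of _ "min a1 a2"] exI[of _ "max b1 b2"]) auto
qed

lemma set_lebesgue_integral_has_integral:
  fixes f :: "real \<Rightarrow> real"
  assumes "continuous_on {a..b} f" "(f has_integral I) {a..b}"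
  shows "(LINT z:{a..b}|lebesgue. f z) = I"
  using set_lebesgue_integral_eq_integral(2)[OF absolutely_integrable_continuous_real[OF assms(1)]]
    assms(2) by (simp add: integral_unique)

lemma locally_integrable_continuous: "continuous_on {0<..} f \<Longrightarrow> locally_integrable f"
  unfolding locally_integrable_def
  by (auto intro!: absolutely_integrable_continuous_real elim: continuous_on_subset)

lemma test_fun_integration_by_parts:
  assumes u: "\<And>z. z > 0 \<Longrightarrow> (u has_real_derivative u' z) (at z)"
    and cont: "continuous_on {0<..} u'" and t: "test_fun \<phi>"
  shows "(LINT z:{0<..}|lebesgue. u z * deriv \<phi> z) = - (LINT z:{0<..}|lebesgue. u' z * \<phi> z)"
proof -
  obtain a b where ab: "0 < a" "a \<le> b" and s: "\<forall>x. x \<notin> {a..b} \<longrightarrow> \<phi> x = 0 \<and> deriv \<phi> x = 0"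
    using test_fun_support[OF t] by blast
  \<comment> \<open>Widened beyond the support so that the boundary terms vanish;
    \<open>a / 2\<close> stays inside the open half line.\<close>
  let ?A = "{a / 2..b + 1}"
  have sub: "?A \<subseteq> {0<..}" using ab by auto
  have "continuous_on {0<..} u"
    using u by (auto intro!: continuous_at_imp_continuous_on DERIV_isCont)
  from continuous_on_subset[OF this sub] continuous_on_subset[OF cont sub]
  have cu: "continuous_on ?A u" "continuous_on ?A u'" .
  note cp = test_fun_continuous[OF t] test_fun_continuous[OF test_fun_deriv[OF t]]
  have D: "((\<lambda>z. u z * \<phi> z) has_real_derivative u z * deriv \<phi> z + u' z * \<phi> z) (at z within ?A)"
    if "z \<in> ?A" for z
  proof -
    have "z > 0" using that sub by (meson greaterThan_iff subsetD)
    from DERIV_mult[OF u[OF this] test_fun_has_derivative[OF t]]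
    show ?thesis by (simp only: add.commute mult.commute has_field_derivative_at_within)
  qed
  have "a / 2 \<le> b + 1" using ab by linarith
  then have "((\<lambda>z. u z * deriv \<phi> z + u' z * \<phi> z) has_integral (u (b + 1) * \<phi> (b + 1) - u (a / 2) * \<phi> (a / 2))) ?A"
    using D unfolding has_real_derivative_iff_has_vector_derivative
    by (rule fundamental_theorem_of_calculus)
  then have "((\<lambda>z. u z * deriv \<phi> z + u' z * \<phi> z) has_integral 0) ?A"
    using s[rule_format, of "b + 1"] s[rule_format, of "a / 2"] ab by simp
  then have "(LINT z:?A|lebesgue. u z * deriv \<phi> z + u' z * \<phi> z) = 0"
    by (rule set_lebesgue_integral_has_integral[rotated]) (intro continuous_intros cu cp)
  moreover have "(LINT z:?A|lebesgue. u z * deriv \<phi> z + u' z * \<phi> z)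
      = (LINT z:?A|lebesgue. u z * deriv \<phi> z) + (LINT z:?A|lebesgue. u' z * \<phi> z)"
    by (intro set_integral_add absolutely_integrable_continuous_real continuous_intros cu cp)
  moreover have "(LINT z:{0<..}|lebesgue. u z * deriv \<phi> z) = (LINT z:?A|lebesgue. u z * deriv \<phi> z)"
    "(LINT z:{0<..}|lebesgue. u' z * \<phi> z) = (LINT z:?A|lebesgue. u' z * \<phi> z)"
    by (intro set_lebesgue_integral_support(1); use ab s in auto)+
  ultimately show ?thesis by simp
qed

lemma set_integral_cong_positive:
  "(\<And>z::real. z > 0 \<Longrightarrow> f z = g z) \<Longrightarrow> (LINT z:{0<..}|lebesgue. f z) = (LINT z:{0<..}|lebesgue. g z :: real)"
  by (intro set_lebesgue_integral_cong) auto

lemma locally_integrable_cong: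
  assumes "\<And>z. z > 0 \<Longrightarrow> f z = g z"
  shows "locally_integrable f \<longleftrightarrow> locally_integrable g"
proof -
  have "set_integrable lebesgue {a..b} f \<longleftrightarrow> set_integrable lebesgue {a..b} g" if "0 < a" for a b
    by (intro set_integrable_cong) (use assms that in auto)
  then show ?thesis unfolding locally_integrable_def by blast
qed

text \<open>\<open>h\<close> and \<open>u\<close> are kept apart because a solution is identified
  with its Gaussian representation on the half line only, while differentiability
  \<open>at z\<close> concerns the representation.\<close>

lemma has_weak_deriv_classical:
  assumes h: "\<And>z. z > 0 \<Longrightarrow> h z = u z"
    and u: "\<And>z. z > 0 \<Longrightarrow> (u has_real_derivative u' z) (at z)"
    and u': "\<And>z. z > 0 \<Longrightarrow> (u' has_real_derivative u'' z) (at z)"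
    and cont: "continuous_on {0<..} u''"
  shows "has_weak_deriv 1 h u'" "has_weak_deriv 2 h u''"
proof -
  have cu: "continuous_on {0<..} u" "continuous_on {0<..} u'"
    using u u' by (auto intro!: continuous_at_imp_continuous_on DERIV_isCont)
  have loc: "locally_integrable h" "locally_integrable u'" "locally_integrable u''"
    using locally_integrable_cong[of h u, OF h] by (simp_all add: locally_integrable_continuous cu cont)
  have 1: "(LINT z:{0<..}|lebesgue. h z * deriv \<phi> z) = - (LINT z:{0<..}|lebesgue. u' z * \<phi> z)"
    if t: "test_fun \<phi>" for \<phi>
    using test_fun_integration_by_parts[OF u cu(2) t] set_integral_cong_positive[of "\<lambda>z. h z * deriv \<phi> z" "\<lambda>z. u z * deriv \<phi> z"] h
    by simp
  then show "has_weak_deriv 1 h u'" using loc by (simp add: has_weak_deriv_def)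
  have "(LINT z:{0<..}|lebesgue. h z * deriv (deriv \<phi>) z) = (LINT z:{0<..}|lebesgue. u'' z * \<phi> z)"
    if t: "test_fun \<phi>" for \<phi>
    using 1[OF test_fun_deriv[OF t]] test_fun_integration_by_parts[OF u' cont t] by simp
  then show "has_weak_deriv 2 h u''" using loc by (simp add: has_weak_deriv_def numeral_2_eq_2)
qed

section \<open>Chosen representatives and weighted norms\<close>

lemma locally_integrable_borel_measurable:
  assumes "locally_integrable g"
  shows "(\<lambda>x. indicator {0<..} x * g x) \<in> borel_measurable lebesgue"
proof (rule borel_measurable_LIMSEQ_real)
  show "(\<lambda>x. indicator {inverse (real (Suc n))..real (Suc n)} x * g x) \<in> borel_measurable lebesgue" for n
    using locally_integrableD[OF assms, of "inverse (real (Suc n))" "real (Suc n)"]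
    unfolding set_integrable_def real_scaleR_def by (intro borel_measurable_integrable) simp
  fix x :: real
  show "(\<lambda>n. indicator {inverse (real (Suc n))..real (Suc n)} x * g x) \<longlonglongrightarrow> indicator {0<..} x * g x"
  proof (cases "x > 0")
    case True
    have "eventually (\<lambda>n. inverse (real (Suc n)) < x) sequentially"
      using LIMSEQ_inverse_real_of_nat True by (rule order_tendstoD)
    moreover have "eventually (\<lambda>n. x < real (Suc n)) sequentially"
      using filterlim_sequentially_Suc[of real at_top] filterlim_real_sequentially
      unfolding filterlim_at_top_dense by simp
    ultimately have "eventually (\<lambda>n. indicator {inverse (real (Suc n))..real (Suc n)} x * g x = indicator {0<..} x * g x) sequentially"
      by eventually_elim (use True in \<open>auto simp: indicator_def\<close>)
    then show ?thesis by (rule tendsto_eventually)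
  next
    case False
    have "x \<notin> {inverse (real (Suc n))..real (Suc n)}" for n
    proof -
      have "inverse (real (Suc n)) > 0" by simp
      then have "\<not> inverse (real (Suc n)) \<le> x" using False by linarith
      then show ?thesis by simp
    qed
    then show ?thesis using False by simp
  qed
qed

text \<open>\<open>Sobolev\<close> provides integrability for some weak derivative, whereas the norm
  is formed with the chosen one. Uniqueness almost everywhere transfers it, once the chosen
  representative is known to be measurable.\<close>

lemma Sobolev_weak_deriv:
  assumes h: "h \<in> Sobolev m \<nu>" and i: "i \<le> m" and \<nu>: "continuous_on UNIV \<nu>" "\<And>z. \<nu> z > 0"
  shows "has_weak_deriv i h (weak_deriv i h)"
    and "set_integrable lebesgue {0<..} (\<lambda>z. \<nu> z * (weak_deriv i h z)\<^sup>2)"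
    and "(LINT z:{0<..}|lebesgue. \<nu> z * (weak_deriv i h z)\<^sup>2) \<le> (Sobolev_norm m \<nu> h)\<^sup>2"
proof -
  obtain g where g: "has_weak_deriv i h g" "set_integrable lebesgue {0<..} (\<lambda>z. \<nu> z * (g z)\<^sup>2)"
    using h i unfolding Sobolev_def by blast
  then show w: "has_weak_deriv i h (weak_deriv i h)" unfolding weak_deriv_def by (metis someI)
  have AE: "AE x in lebesgue. x > 0 \<longrightarrow> weak_deriv i h x = g x" by (rule has_weak_deriv_unique[OF w g(1)])
  have "\<nu> \<in> borel_measurable lebesgue"
    using borel_measurable_continuous_onI[OF \<nu>(1)] by (simp add: measurable_completion)
  moreover have "(\<lambda>x. indicator {0<..} x * weak_deriv i h x) \<in> borel_measurable lebesgue"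
    by (rule locally_integrable_borel_measurable) (use w in \<open>simp add: has_weak_deriv_def\<close>)
  ultimately have "(\<lambda>x. \<nu> x * (indicator {0<..} x * weak_deriv i h x)\<^sup>2) \<in> borel_measurable lebesgue"
    by measurable
  moreover have "(\<lambda>x. \<nu> x * (indicator {0<..} x * weak_deriv i h x)\<^sup>2) = (\<lambda>x. indicator {0<..} x *\<^sub>R (\<nu> x * (weak_deriv i h x)\<^sup>2))"
    by (auto simp: indicator_def)
  ultimately have meas: "(\<lambda>x. indicator {0<..} x *\<^sub>R (\<nu> x * (weak_deriv i h x)\<^sup>2)) \<in> borel_measurable lebesgue" by simp
  have "AE x in lebesgue. indicator {0<..} x *\<^sub>R (\<nu> x * (g x)\<^sup>2) = indicator {0<..} x *\<^sub>R (\<nu> x * (weak_deriv i h x)\<^sup>2)"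
    using AE by eventually_elim (auto simp: indicator_def)
  then show "set_integrable lebesgue {0<..} (\<lambda>z. \<nu> z * (weak_deriv i h z)\<^sup>2)"
    using g(2) meas unfolding set_integrable_def by (rule integrable_cong_AE_imp[rotated 2])
  have nn: "(LINT z:{0<..}|lebesgue. \<nu> z * (weak_deriv i h z)\<^sup>2) \<ge> 0" for i
    unfolding set_lebesgue_integral_def using \<nu>(2) by (intro integral_nonneg_AE AE_I2) (simp add: less_imp_le)
  have "(LINT z:{0<..}|lebesgue. \<nu> z * (weak_deriv i h z)\<^sup>2) = (L2_norm_wt \<nu> (weak_deriv i h))\<^sup>2"
    using nn[of i] by (simp add: L2_norm_wt_def)
  also have "\<dots> \<le> (\<Sum>i\<le>m. (L2_norm_wt \<nu> (weak_deriv i h))\<^sup>2)"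
    using i by (intro member_le_sum) auto
  also have "\<dots> = (Sobolev_norm m \<nu> h)\<^sup>2" by (simp add: Sobolev_norm_def sum_nonneg)
  finally show "(LINT z:{0<..}|lebesgue. \<nu> z * (weak_deriv i h z)\<^sup>2) \<le> (Sobolev_norm m \<nu> h)\<^sup>2" .
qed

lemma set_integral_exp_minus:
  fixes c :: real
  assumes "c > 0"
  shows "set_integrable lebesgue {a<..} (\<lambda>z. exp (- c * z))"
    and "(LINT z:{a<..}|lebesgue. exp (- c * z)) \<le> exp (- c * a) / c"
proof -
  have i: "((\<lambda>x. exp (- c * x)) has_integral exp (- c * a) / c) {a..}"
    using has_integral_exp_minus_to_infinity[OF assms] .
  then have s: "set_integrable lebesgue {a..} (\<lambda>z. exp (- c * z))"
    by (intro nonnegative_absolutely_integrable_1) auto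
  then show s': "set_integrable lebesgue {a<..} (\<lambda>z. exp (- c * z))"
    by (rule set_integrable_subset) auto
  have "(LINT z:{a<..}|lebesgue. exp (- c * z)) \<le> (LINT z:{a..}|lebesgue. exp (- c * z))"
    unfolding set_lebesgue_integral_def using s s' unfolding set_integrable_def
    by (intro integral_mono) (auto simp: indicator_def)
  also have "\<dots> = exp (- c * a) / c"
    using set_lebesgue_integral_eq_integral(2)[OF s] i by (simp add: integral_unique)
  finally show "(LINT z:{a<..}|lebesgue. exp (- c * z)) \<le> exp (- c * a) / c" .
qed

lemma \<mu>_continuous: "continuous_on UNIV (\<mu> t)"
  unfolding \<mu>_def by (cases "t = - 1") (auto intro!: continuous_intros)

lemma \<mu>_pos: "\<mu> t z > 0"
  by (simp add: \<mu>_def)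

text \<open>Expanding \<open>(z - 4 * (1 + t))\<^sup>2 \<ge> 0\<close> puts the parabola in the
  exponent above a line of slope 2. The prefactor grows with \<open>t\<close>, which is acceptable
  at time 0 and on bounded time intervals, where the bound is applied.\<close>

lemma inverse_\<mu>_le:
  assumes "t \<ge> 0"
  shows "1 / \<mu> t z \<le> exp (4 * (1 + t)) * exp (- 2 * z)"
proof -
  have "0 \<le> (z - 4 * (1 + t))\<^sup>2 / (4 * (1 + t))" using assms by simp
  also have "\<dots> = z\<^sup>2 / (4 * (1 + t)) + 4 * (1 + t) + - 2 * z"
    using assms by (simp add: field_simps power2_eq_square)
  finally have "- (z\<^sup>2 / (4 * (1 + t))) \<le> 4 * (1 + t) + - 2 * z" by simp
  then have "exp (- (z\<^sup>2 / (4 * (1 + t)))) \<le> exp (4 * (1 + t) + - 2 * z)" by (simp only: exp_le_cancel_iff)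
  then show ?thesis unfolding \<mu>_def exp_minus exp_add by (simp add: inverse_eq_divide exp_minus)
qed

text \<open>
  AM-GM replaces Cauchy-Schwarz; the choice \<open>\<rho> = exp (- a) / \<epsilon>\<close> will give a tail of size
  \<open>\<epsilon> exp (- a)\<close>.
\<close>

lemma weighted_L2_imp_L1:
  assumes t: "t \<ge> 0" and g: "locally_integrable g" and a: "a \<ge> 0" and \<rho>: "\<rho> > 0"
    and L2: "set_integrable lebesgue {0<..} (\<lambda>z. \<mu> t z * (g z)\<^sup>2)"
  shows "set_integrable lebesgue {a<..} g"
    and "(LINT z:{a<..}|lebesgue. \<bar>g z\<bar>) \<le>
      (\<rho> * (LINT z:{0<..}|lebesgue. \<mu> t z * (g z)\<^sup>2) + exp (4 * (1 + t)) * exp (- 2 * a) / \<rho>) / 2"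
proof -
  define B where "B z = (\<rho> * (\<mu> t z * (g z)\<^sup>2) + exp (4 * (1 + t)) * exp (- 2 * z) / \<rho>) / 2" for z
  have le: "\<bar>g z\<bar> \<le> B z" for z
  proof -
    define p where "p = \<rho> * \<mu> t z"
    have p: "p > 0" using \<rho> \<mu>_pos by (simp add: p_def)
    have "0 \<le> (p * \<bar>g z\<bar> - 1)\<^sup>2 / p" using p by simp
    also have "\<dots> = p * (g z)\<^sup>2 - 2 * \<bar>g z\<bar> + 1 / p" using p
      by (simp add: field_simps power2_eq_square)
    finally have "2 * \<bar>g z\<bar> \<le> p * (g z)\<^sup>2 + 1 / p" by simp
    also have "1 / p \<le> exp (4 * (1 + t)) * exp (- 2 * z) / \<rho>"
      using inverse_\<mu>_le[OF t, of z] \<rho> by (simp add: p_def divide_simps mult.commute)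
    finally show ?thesis by (simp add: B_def p_def mult.assoc)
  qed
  have L2a: "set_integrable lebesgue {a<..} (\<lambda>z. \<mu> t z * (g z)\<^sup>2)"
    by (rule set_integrable_subset[OF L2]) (use a in auto)
  have Bi: "set_integrable lebesgue {a<..} B"
    unfolding B_def using L2a set_integral_exp_minus(1)[of 2 a]
    by (intro set_integrable_divide set_integral_add set_integrable_mult_right) auto
  have "(\<lambda>x. indicator {a<..} x * (indicator {0<..} x * g x)) \<in> borel_measurable lebesgue"
    by (intro borel_measurable_times borel_measurable_indicator locally_integrable_borel_measurable g) simp
  moreover have "(\<lambda>x. indicator {a<..} x * (indicator {0<..} x * g x)) = (\<lambda>x. indicator {a<..} x *\<^sub>R g x)"
    using a by (auto simp: indicator_def)
  ultimately have meas: "(\<lambda>x. indicator {a<..} x *\<^sub>R g x) \<in> borel_measurable lebesgue" by simp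
  show gi: "set_integrable lebesgue {a<..} g"
    unfolding set_integrable_def
    by (rule Bochner_Integration.integrable_bound[OF Bi[unfolded set_integrable_def] meas])
      (use le in \<open>auto intro!: AE_I2 order_trans[OF le abs_ge_self] simp: indicator_def\<close>)
  have "(LINT z:{a<..}|lebesgue. \<bar>g z\<bar>) \<le> (LINT z:{a<..}|lebesgue. B z)"
    by (intro set_integral_mono Bi le set_integrable_abs gi)
  also have "\<dots> = (\<rho> * (LINT z:{a<..}|lebesgue. \<mu> t z * (g z)\<^sup>2)
      + exp (4 * (1 + t)) * (LINT z:{a<..}|lebesgue. exp (- 2 * z)) / \<rho>) / 2"
    unfolding B_def using L2a set_integral_exp_minus(1)[of 2 a]
    by (subst set_integral_divide_zero, subst set_integral_add)
       (auto intro!: set_integrable_mult_right set_integrable_divide)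
  also have "\<dots> \<le> (\<rho> * (LINT z:{0<..}|lebesgue. \<mu> t z * (g z)\<^sup>2)
      + exp (4 * (1 + t)) * exp (- 2 * a) / \<rho>) / 2"
  proof -
    have "(LINT z:{a<..}|lebesgue. exp (- 2 * z)) \<le> exp (- 2 * a)"
      using set_integral_exp_minus(2)[of 2 a] exp_gt_zero[of "-2 * a"] by linarith
    moreover have "(LINT z:{a<..}|lebesgue. \<mu> t z * (g z)\<^sup>2) \<le> (LINT z:{0<..}|lebesgue. \<mu> t z * (g z)\<^sup>2)"
      unfolding set_lebesgue_integral_def using L2a L2 a less_imp_le[OF \<mu>_pos] unfolding set_integrable_def
      by (intro integral_mono) (auto simp: indicator_def)
    ultimately show ?thesis using \<rho>
      by (intro divide_right_mono add_mono mult_left_mono) auto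
  qed
  finally show "(LINT z:{a<..}|lebesgue. \<bar>g z\<bar>) \<le>
      (\<rho> * (LINT z:{0<..}|lebesgue. \<mu> t z * (g z)\<^sup>2) + exp (4 * (1 + t)) * exp (- 2 * a) / \<rho>) / 2" .
qed

section \<open>Primitives vanishing at infinity\<close>

text \<open>The minus sign makes \<open>g\<close>, and not \<open>- g\<close>, the
  derivative.\<close>

definition tail :: "(real \<Rightarrow> real) \<Rightarrow> real \<Rightarrow> real" where
  "tail g z = - (LINT y:{z<..}|lebesgue. g y)"

lemma tail_cong_AE:
  assumes AE: "AE x in lebesgue. x > 0 \<longrightarrow> g x = g' x" and z: "z \<ge> 0"
    and g: "set_integrable lebesgue {0<..} g" and g': "set_integrable lebesgue {0<..} g'"
  shows "tail g z = tail g' z"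
proof -
  have "set_integrable lebesgue {z<..} g" by (rule set_integrable_subset[OF g]) (use z in auto)
  then have m: "(\<lambda>y. indicator {z<..} y *\<^sub>R g y) \<in> borel_measurable lebesgue"
    unfolding set_integrable_def by (rule borel_measurable_integrable)
  have "set_integrable lebesgue {z<..} g'" by (rule set_integrable_subset[OF g']) (use z in auto)
  then have m': "(\<lambda>y. indicator {z<..} y *\<^sub>R g' y) \<in> borel_measurable lebesgue"
    unfolding set_integrable_def by (rule borel_measurable_integrable)
  have "AE y in lebesgue. indicator {z<..} y *\<^sub>R g y = indicator {z<..} y *\<^sub>R g' y"
    using AE by eventually_elim (use z in \<open>auto simp: indicator_def\<close>)
  then show ?thesis unfolding tail_def set_lebesgue_integral_def
    by (simp only: integral_cong_AE[OF m m'])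
qed

lemma tail_split:
  assumes g: "set_integrable lebesgue {0<..} g" and az: "0 \<le> a" "a \<le> z"
  shows "g integrable_on {a..z}" "tail g z = tail g a + integral {a..z} g"
proof -
  have i: "set_integrable lebesgue {a<..z} g" "set_integrable lebesgue {z<..} g"
    by (rule set_integrable_subset[OF g]; use az in auto)+
  have "{a<..z} - {a..z} = {}" by auto
  then have n1: "negligible ({a<..z} - {a..z})" by simp
  have "{a..z} - {a<..z} \<subseteq> {a}" by auto
  then have n2: "negligible ({a..z} - {a<..z})" using negligible_subset negligible_sing by blast
  show gi: "g integrable_on {a..z}"
    by (rule integrable_spike_set[OF set_lebesgue_integral_eq_integral(1)[OF i(1)]])
      (rule negligible_subset[OF n1] negligible_subset[OF n2]; blast)+
  have "integral {a..z} g = integral {a<..z} g"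
    by (rule integral_spike_set) (rule negligible_subset[OF n1] negligible_subset[OF n2]; blast)+
  also have "\<dots> = (LINT y:{a<..z}|lebesgue. g y)" using set_lebesgue_integral_eq_integral(2)[OF i(1)] by simp
  finally have e: "integral {a..z} g = (LINT y:{a<..z}|lebesgue. g y)" .
  have "{a<..} = {a<..z} \<union> {z<..}" using az by auto
  moreover have "(LINT y:{a<..z} \<union> {z<..}|lebesgue. g y) = (LINT y:{a<..z}|lebesgue. g y) + (LINT y:{z<..}|lebesgue. g y)"
    by (rule set_integral_Un[OF _ i]) auto
  ultimately show "tail g z = tail g a + integral {a..z} g" using e unfolding tail_def by simp
qed

lemma tail_continuous:
  assumes g: "set_integrable lebesgue {0<..} g"
  shows "continuous_on {0..} (tail g)"
  unfolding continuous_on_eq_continuous_within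
proof
  fix x :: real assume x: "x \<in> {0..}"
  have "continuous_on {0..x + 1} (\<lambda>z. tail g 0 + integral {0..z} g)"
    by (intro continuous_intros indefinite_integral_continuous_1 tail_split(1)[OF g]) (use x in auto)
  then have "continuous_on {0..x + 1} (tail g)"
    by (rule continuous_on_eq) (rule tail_split(2)[OF g, symmetric]; simp)
  then have "continuous (at x within {0..x + 1}) (tail g)"
    using x by (simp add: continuous_on_eq_continuous_within)
  moreover have "at x within {0..x + 1} = at x within {0..}"
    by (rule at_within_nhd[of _ "{..<x + 1}"]) auto
  ultimately show "continuous (at x within {0..}) (tail g)" by simp
qed

lemma tail_has_derivative:
  assumes g: "set_integrable lebesgue {0<..} g" and c: "continuous_on {0<..} g" and z: "z > 0"
  shows "(tail g has_real_derivative g z) (at z)"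
proof -
  \<comment> \<open>The base point \<open>z / 2\<close> avoids 0, where \<open>g\<close> need not be
    continuous.\<close>
  have "continuous_on {z / 2..z + 1} g" by (rule continuous_on_subset[OF c]) (use z in auto)
  then have "((\<lambda>u. integral {z / 2..u} g) has_real_derivative g z) (at z within {z / 2..z + 1})"
    by (rule integral_has_real_derivative) (use z in auto)
  moreover have "at z within {z / 2..z + 1} = at z" by (rule at_within_interior) (use z in auto)
  ultimately have "((\<lambda>u. tail g (z / 2) + integral {z / 2..u} g) has_real_derivative g z) (at z)"
    by (auto intro!: derivative_eq_intros)
  then show ?thesis
    by (rule has_field_derivative_transform_within_open[of _ _ _ "{z / 2<..}"])
      (use z in \<open>auto intro!: tail_split(2)[OF g, symmetric]\<close>)
qed

text \<open>For \<open>c = 1\<close> the tail obeys the very bound of the integrand, so one constant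
  serves the whole chain of primitives.\<close>

lemma exp_decay_integrable:
  fixes c :: real
  assumes g: "continuous_on {0<..} g" and c: "c > 0" and b: "\<And>y. y > 0 \<Longrightarrow> \<bar>g y\<bar> \<le> K * exp (- c * y)"
  shows "set_integrable lebesgue {0<..} g"
    and "z \<ge> 0 \<Longrightarrow> \<bar>tail g z\<bar> \<le> K / c * exp (- c * z)"
proof -
  have m: "(\<lambda>y. indicator {0<..} y *\<^sub>R g y) \<in> borel_measurable lebesgue"
    using locally_integrable_borel_measurable[OF locally_integrable_continuous[OF g]] by simp
  have Ki: "set_integrable lebesgue {0<..} (\<lambda>y. K * exp (- c * y))"
    using set_integral_exp_minus(1)[OF c] by (rule set_integrable_mult_right)
  have ba: "\<bar>g y\<bar> \<le> \<bar>K * exp (- c * y)\<bar>" if "y > 0" for y using b[OF that] by linarith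
  show gi: "set_integrable lebesgue {0<..} g"
    unfolding set_integrable_def
    by (rule Bochner_Integration.integrable_bound[OF Ki[unfolded set_integrable_def] m])
      (auto intro!: AE_I2 ba[simplified] simp: indicator_def)
  assume z: "z \<ge> 0"
  have "0 \<le> K * exp (- c * 1)" using b[of 1] by linarith
  then have K: "K \<ge> 0" by (simp add: zero_le_mult_iff)
  have giz: "set_integrable lebesgue {z<..} g" by (rule set_integrable_subset[OF gi]) (use z in auto)
  have Kiz: "set_integrable lebesgue {z<..} (\<lambda>y. K * exp (- c * y))" by (rule set_integrable_subset[OF Ki]) (use z in auto)
  have "\<bar>tail g z\<bar> \<le> (LINT y:{z<..}|lebesgue. \<bar>g y\<bar>)"
    using integral_abs_bound[of lebesgue "\<lambda>y. indicator {z<..} y *\<^sub>R g y"]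
    by (simp add: tail_def set_lebesgue_integral_def abs_mult)
  also have "\<dots> \<le> (LINT y:{z<..}|lebesgue. K * exp (- c * y))"
    by (rule set_integral_mono[OF set_integrable_abs[OF giz] Kiz]) (use z b in auto)
  also have "\<dots> = K * (LINT y:{z<..}|lebesgue. exp (- c * y))" by simp
  also have "\<dots> \<le> K * (exp (- c * z) / c)"
    using set_integral_exp_minus(2)[OF c] K by (rule mult_left_mono)
  finally show "\<bar>tail g z\<bar> \<le> K / c * exp (- c * z)" by simp
qed

text \<open>By the fundamental theorem \<open>h - tail g\<close> is almost everywhere a constant
  \<open>c\<close>, and a constant that is integrable over a half line is 0.\<close>

lemma weak_deriv_eq_tail:
  assumes w: "has_weak_deriv 1 h g" and h: "set_integrable lebesgue {0<..} h" and g: "set_integrable lebesgue {0<..} g"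
    and tg: "set_integrable lebesgue {0<..} (tail g)"
  shows "AE x in lebesgue. x > 0 \<longrightarrow> h x = tail g x"
proof -
  obtain N where N: "negligible N" "\<And>a b. 0 < a \<Longrightarrow> a < b \<Longrightarrow> a \<notin> N \<Longrightarrow> b \<notin> N \<Longrightarrow>
    h b - h a = (LINT z:{a..b}|lebesgue. g z)" using weak_deriv_FTC[OF w] by blast
  have inc: "h b - tail g b = h a - tail g a" if ab: "0 < a" "a < b" "a \<notin> N" "b \<notin> N" for a b
  proof -
    have "set_integrable lebesgue {a..b} g" by (rule set_integrable_subset[OF g]) (use ab in auto)
    then show ?thesis
      using N(2)[OF ab] tail_split(2)[OF g, of a b] ab set_lebesgue_integral_eq_integral(2)[of "{a..b}" g] by simp
  qed
  have "\<not> negligible {0<..<1::real}" by (intro open_not_negligible) auto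
  then have "\<not> {0<..<1} \<subseteq> N" using negligible_subset[OF N(1)] by blast
  then obtain x0 where x0: "x0 > 0" "x0 \<notin> N" by (meson greaterThanLessThan_iff subsetI)
  define c where "c = h x0 - tail g x0"
  have c: "h x - tail g x = c" if "x > 0" "x \<notin> N" for x
    using inc[of x x0] inc[of x0 x] that x0 by (cases x x0 rule: linorder_cases) (auto simp: c_def)
  have di: "set_integrable lebesgue {0<..} (\<lambda>x. \<bar>h x - tail g x\<bar>)"
    by (intro set_integrable_abs set_integral_diff h tg)
  define I where "I = (LINT x:{0<..}|lebesgue. \<bar>h x - tail g x\<bar>)"
  have cI: "b * \<bar>c\<bar> \<le> I" if b: "b > 0" for b
  proof -
    have ci: "set_integrable lebesgue {0<..b} (\<lambda>_. \<bar>c\<bar>)"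
      by (rule set_integrable_subset[of _ "{0..b}"])
        (auto intro: absolutely_integrable_continuous_real)
    have "b * \<bar>c\<bar> = (LINT x:{0<..b}|lebesgue. \<bar>c\<bar>)"
      unfolding set_lebesgue_integral_def using b by simp
    also have "\<dots> \<le> I"
      unfolding I_def set_lebesgue_integral_def
    proof (rule integral_mono_AE)
      show "integrable lebesgue (\<lambda>x. indicator {0<..b} x *\<^sub>R \<bar>c\<bar>)"
        "integrable lebesgue (\<lambda>x. indicator {0<..} x *\<^sub>R \<bar>h x - tail g x\<bar>)"
        using ci di unfolding set_integrable_def by auto
      have "AE x in lebesgue. x > 0 \<longrightarrow> h x - tail g x = c" by (rule AE_positive_realsI[OF N(1) c])
      then show "AE x in lebesgue. indicator {0<..b} x *\<^sub>R \<bar>c\<bar> \<le> indicator {0<..} x *\<^sub>R \<bar>h x - tail g x\<bar>"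
        by eventually_elim (auto simp: indicator_def)
    qed
    finally show ?thesis .
  qed
  have "c = 0"
  proof (rule ccontr)
    assume "c \<noteq> 0"
    \<comment> \<open>The length is chosen so that the inequality reads
      \<open>\<bar>I\<bar> + 1 \<le> I\<close>.\<close>
    have "(\<bar>I\<bar> + 1) / \<bar>c\<bar> * \<bar>c\<bar> \<le> I" using \<open>c \<noteq> 0\<close> by (intro cI) simp
    then show False using \<open>c \<noteq> 0\<close> by simp
  qed
  then show ?thesis using c by (intro AE_positive_realsI[OF N(1)]) fastforce
qed

text \<open>The points of disagreement in the open half line form an open set, which is empty as
  soon as it is null; the point 0 is reached by a limit from the right.\<close>

lemma AE_eq_continuous_imp_eq:
  fixes f g :: "real \<Rightarrow> real"
  assumes AE: "AE x in lebesgue. x > 0 \<longrightarrow> f x = g x"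
    and f: "continuous_on {0..} f" and g: "continuous_on {0..} g"
    and z: "z \<ge> 0"
  shows "f z = g z"
proof -
  have eq: "f x = g x" if x: "x > 0" for x
  proof (rule ccontr)
    assume ne: "f x \<noteq> g x"
    have c: "continuous_on {0<..} (\<lambda>x. f x - g x)"
      by (intro continuous_intros continuous_on_subset[OF f] continuous_on_subset[OF g]) auto
    have "open ({0<..} \<inter> (\<lambda>x. f x - g x) -` (- {0}))"
      using c by (rule continuous_open_preimage) auto
    then have "\<not> negligible ({0<..} \<inter> (\<lambda>x. f x - g x) -` (- {0}))"
      by (rule open_not_negligible) (use ne x in auto)
    moreover have "negligible {x. \<not> (x > 0 \<longrightarrow> f x = g x)}"
    proof -
      obtain N where "N \<in> null_sets lebesgue" "{x. \<not> (x > 0 \<longrightarrow> f x = g x)} \<subseteq> N"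
        using AE unfolding eventually_ae_filter by auto
      then show ?thesis using negligible_iff_null_sets negligible_subset by blast
    qed
    ultimately show False by (rule notE[OF _ negligible_subset]) auto
  qed
  show ?thesis
  proof (cases "z = 0")
    case True
    have lf: "(f \<longlongrightarrow> f 0) (at_right 0)" "(g \<longlongrightarrow> g 0) (at_right 0)"
      using f g by (auto simp: continuous_on_def intro: tendsto_within_subset)
    have "eventually (\<lambda>x. f x = g x) (at_right 0)"
      using eq by (auto simp: eventually_at_filter)
    then have "(g \<longlongrightarrow> f 0) (at_right 0)" using lf(1) tendsto_cong by blast
    then show ?thesis using lf(2) True tendsto_unique[OF trivial_limit_at_right_real] by blast
  qed (use eq z in auto)
qed

section \<open>The chain of primitives of the initial datum\<close>

lemma mult_exp_minus_le: "(y::real) \<ge> 0 \<Longrightarrow> y * exp (- y) \<le> 2 * exp (- (y / 2))"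
proof -
  assume "y \<ge> 0"
  have "y / 2 \<le> exp (y / 2)" using exp_ge_add_one_self[of "y / 2"] by linarith
  then have "y * exp (- y) \<le> 2 * exp (y / 2) * exp (- y)" by (intro mult_right_mono) auto
  also have "\<dots> = 2 * exp (- (y / 2))" by (simp add: exp_add[symmetric] mult.assoc)
  finally show ?thesis .
qed

text \<open>\<open>F - tail g\<close> is constant and decays, hence vanishes. At 0 this is an
  integration over the whole half line with boundary term \<open>F 0\<close>, the form needed for
  the moment condition.\<close>

lemma exp_decay_FTC:
  assumes F: "continuous_on {0..} F" "\<And>z. z > 0 \<Longrightarrow> (F has_real_derivative g z) (at z)"
    and g: "continuous_on {0<..} g" and c: "c > 0"
    and b: "\<And>y. y > 0 \<Longrightarrow> \<bar>g y\<bar> \<le> K * exp (- c * y)" "\<And>y. y > 0 \<Longrightarrow> \<bar>F y\<bar> \<le> K * exp (- c * y)"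
  shows "F 0 = tail g 0"
proof -
  note gi = exp_decay_integrable(1)[OF g c b(1)]
  note gb = exp_decay_integrable(2)[OF g c b(1)]
  have "\<exists>d. \<forall>x\<in>{0<..}. F x - tail g x = d"
  proof (rule has_field_derivative_zero_constant)
    show "((\<lambda>x. F x - tail g x) has_real_derivative 0) (at x within {0<..})" if "x \<in> {0<..}" for x
    proof -
      have "x > 0" using that by simp
      from DERIV_diff[OF F(2)[OF this] tail_has_derivative[OF gi g this]]
      have "((\<lambda>x. F x - tail g x) has_real_derivative 0) (at x)" by simp
      then show ?thesis by (rule has_field_derivative_at_within)
    qed
  qed auto
  then obtain d where d: "\<And>x. x > 0 \<Longrightarrow> F x - tail g x = d" by auto
  have lim: "((\<lambda>y. (K + K / c) * exp (- c * y)) \<longlongrightarrow> (K + K / c) * 0) at_top"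
    by (intro tendsto_mult_left filterlim_compose[OF exp_at_bot] filterlim_tendsto_neg_mult_at_bot[where c = "-c"])
      (use c in \<open>auto intro: filterlim_ident\<close>)
  have "((\<lambda>y. F y - tail g y) \<longlongrightarrow> 0) at_top"
  proof (rule Lim_null_comparison)
    show "((\<lambda>y. (K + K / c) * exp (- c * y)) \<longlongrightarrow> 0) at_top" using lim by simp
    show "\<forall>\<^sub>F y in at_top. norm (F y - tail g y) \<le> (K + K / c) * exp (- c * y)"
      using eventually_gt_at_top[of 0]
    proof eventually_elim
      case (elim y)
      then show ?case using b(2)[OF elim] gb[of y] by (simp add: algebra_simps)
    qed
  qed
  moreover have "\<forall>\<^sub>F y in at_top. F y - tail g y = d"
    using eventually_gt_at_top[of 0] by eventually_elim (rule d)
  ultimately have "((\<lambda>y. d) \<longlongrightarrow> 0) (at_top :: real filter)" using tendsto_cong by fastforce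
  then have "d = 0" by (simp add: tendsto_const_iff)
  show ?thesis
    by (rule AE_eq_continuous_imp_eq[OF _ F(1) tail_continuous[OF gi]]) (use d \<open>d = 0\<close> in auto)
qed

text \<open>Allows the integration to be iterated: the derivative may be replaced by the continuous
  representative found one order higher.\<close>

lemma weak_deriv_eq_tail_AE:
  assumes w: "has_weak_deriv 1 h g" and h: "set_integrable lebesgue {0<..} h" and g: "set_integrable lebesgue {0<..} g"
    and AE: "AE x in lebesgue. x > 0 \<longrightarrow> g x = g' x"
    and g': "set_integrable lebesgue {0<..} g'" and tg': "set_integrable lebesgue {0<..} (tail g')"
  shows "AE x in lebesgue. x > 0 \<longrightarrow> h x = tail g' x"
proof -
  have eq: "tail g z = tail g' z" if "z > 0" for z
    by (rule tail_cong_AE[OF AE _ g g']) (use that in auto)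
  have "set_integrable lebesgue {0<..} (tail g) \<longleftrightarrow> set_integrable lebesgue {0<..} (tail g')"
    by (rule set_integrable_cong) (use eq in auto)
  then have "AE x in lebesgue. x > 0 \<longrightarrow> h x = tail g x"
    using tg' by (intro weak_deriv_eq_tail[OF w h g]) simp
  then show ?thesis by eventually_elim (use eq in auto)
qed

text \<open>The outcome of the AM-GM estimate at time 0: the norm contributes 1, the inverse weight
  contributes \<open>exp 4\<close>, and the inequality halves their sum.\<close>

definition decay_const :: real where
  "decay_const = (1 + exp 4) / 2"

lemma decay_const_pos: "decay_const > 0"
  by (simp add: decay_const_def add_pos_pos)

lemma initial_data_chain:
  assumes U0: "U0 \<in> Sobolev 3 \<mu>_in" and cont: "continuous_on {0..} U0" and bc: "U0 0 = 0"
    and norm: "Sobolev_norm 3 \<mu>_in U0 \<le> \<epsilon>" and \<epsilon>: "\<epsilon> > 0"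
    and moment: "(LINT z:{0<..}|lebesgue. z * U0 z) = 0"
  shows "\<exists>f :: nat \<Rightarrow> real \<Rightarrow> real.
    (\<forall>k\<le>5. continuous_on {0..} (f k)) \<and>
    (\<forall>k\<le>5. \<forall>z\<ge>0. \<bar>f k z\<bar> \<le> decay_const * \<epsilon> * exp (- z)) \<and>
    (\<forall>k<5. \<forall>z>0. (f k has_real_derivative f (Suc k) z) (at z)) \<and>
    f 1 0 = 0 \<and> f 3 0 = 0 \<and> (\<forall>z\<ge>0. f 3 z = U0 z)"
proof -
  define G where "G i = weak_deriv i U0" for i
  define K where "K = decay_const * \<epsilon>"
  have K: "K > 0" using \<epsilon> decay_const_pos by (simp add: K_def)
  note S = Sobolev_weak_deriv[OF U0 _ \<mu>_continuous[of 0, folded \<mu>_in_def] \<mu>_pos[of 0, folded \<mu>_in_def], folded G_def]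
  have w: "has_weak_deriv 1 (G i) (G (Suc i))" if "i < 3" for i
    by (rule has_weak_deriv_Suc[OF S(1) S(1)]) (use that in auto)
  have loc: "locally_integrable (G i)" if "i \<le> 3" for i
    using S(1)[OF that] by (simp add: has_weak_deriv_def)
  have L2: "set_integrable lebesgue {0<..} (\<lambda>z. \<mu> 0 z * (G i z)\<^sup>2)" if "i \<le> 3" for i
    using S(2)[OF that] by (simp add: \<mu>_in_def)
  have Gint: "set_integrable lebesgue {0<..} (G i)" if "i \<le> 3" for i
    by (rule weighted_L2_imp_L1(1)[OF _ loc[OF that] _ _ L2[OF that], of 0 1]) auto
  \<comment> \<open>Index 6 stands for the weak third derivative \<open>G 3\<close> itself, so that
    three integrations lead to \<open>U0\<close> at index 3 and three more to index 0.\<close>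
  define f where "f k = (tail ^^ (6 - k)) (G 3)" for k
  have f5: "f 5 = tail (G 3)" by (simp add: f_def)
  have fk: "f k = tail (f (Suc k))" if "k < 5" for k
  proof -
    have "6 - k = Suc (6 - Suc k)" using that by simp
    then show ?thesis by (simp add: f_def)
  qed
  have b5: "\<bar>f 5 z\<bar> \<le> K * exp (- z)" if z: "z \<ge> 0" for z
  proof -
    have sn: "(Sobolev_norm 3 \<mu>_in U0)\<^sup>2 \<le> \<epsilon>\<^sup>2"
      using norm by (intro power_mono) (auto simp: Sobolev_norm_def intro!: real_sqrt_ge_zero sum_nonneg)
    have L: "(LINT z:{0<..}|lebesgue. \<mu> 0 z * (G 3 z)\<^sup>2) \<le> \<epsilon>\<^sup>2"
      using S(3)[of 3] sn by (simp add: \<mu>_in_def)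
    define \<rho> where "\<rho> = exp (- z) / \<epsilon>"
    have \<rho>: "\<rho> > 0" using \<epsilon> by (simp add: \<rho>_def)
    have "\<bar>f 5 z\<bar> \<le> (LINT y:{z<..}|lebesgue. \<bar>G 3 y\<bar>)"
      using integral_abs_bound[of lebesgue "\<lambda>y. indicator {z<..} y *\<^sub>R G 3 y"]
      by (simp add: f5 tail_def set_lebesgue_integral_def abs_mult)
    also have "\<dots> \<le> (\<rho> * (LINT z:{0<..}|lebesgue. \<mu> 0 z * (G 3 z)\<^sup>2) + exp (4 * (1 + 0)) * exp (- 2 * z) / \<rho>) / 2"
      by (rule weighted_L2_imp_L1(2)[OF _ loc z \<rho> L2]) auto
    also have "\<dots> \<le> (\<rho> * \<epsilon>\<^sup>2 + exp 4 * exp (- 2 * z) / \<rho>) / 2"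
      using L \<rho> by (intro divide_right_mono add_mono mult_left_mono) auto
    also have "\<rho> * \<epsilon>\<^sup>2 = \<epsilon> * exp (- z)" using \<epsilon> by (simp add: \<rho>_def power2_eq_square)
    also have "exp 4 * exp (- 2 * z) / \<rho> = exp 4 * \<epsilon> * exp (- z)"
    proof -
      have "exp (- 2 * z) = exp (- z) * exp (- z)" by (simp add: exp_add[symmetric])
      then show ?thesis using \<epsilon> by (simp add: \<rho>_def)
    qed
    finally show ?thesis by (simp add: K_def decay_const_def algebra_simps)
  qed
  \<comment> \<open>An induction downwards from index 5, written with
    \<open>j = 5 - k\<close>.\<close>
  have fb: "continuous_on {0..} (f (5 - j)) \<and> (\<forall>z\<ge>0. \<bar>f (5 - j) z\<bar> \<le> K * exp (- z))" if "j \<le> 5" for j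
    using that
  proof (induction j)
    case 0
    show ?case using b5 tail_continuous[OF Gint, of 3] by (simp add: f5)
  next
    case (Suc j)
    define k where "k = 5 - Suc j"
    have k: "5 - j = Suc k" "k < 5" using Suc.prems by (auto simp: k_def)
    have IH: "continuous_on {0..} (f (Suc k))" "\<And>z. z \<ge> 0 \<Longrightarrow> \<bar>f (Suc k) z\<bar> \<le> K * exp (- z)"
      using Suc by (auto simp: k)
    have c: "continuous_on {0<..} (f (Suc k))" by (rule continuous_on_subset[OF IH(1)]) auto
    have b: "\<bar>f (Suc k) y\<bar> \<le> K * exp (- 1 * y)" if "y > 0" for y using IH(2)[of y] that by simp
    note i = exp_decay_integrable[OF c zero_less_one b]
    show ?case unfolding k_def[symmetric] using fk[OF k(2)] tail_continuous[OF i(1)] i(2) by simp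
  qed
  have fc: "continuous_on {0..} (f k)" and fbd: "\<And>z. z \<ge> 0 \<Longrightarrow> \<bar>f k z\<bar> \<le> K * exp (- z)" if "k \<le> 5" for k
    using fb[of "5 - k"] that by auto
  have fc': "continuous_on {0<..} (f k)" if "k \<le> 5" for k
    by (rule continuous_on_subset[OF fc[OF that]]) auto
  have fi: "set_integrable lebesgue {0<..} (f k)" if "k \<le> 5" for k
    by (rule exp_decay_integrable(1)[OF fc'[OF that], of 1 K]) (use fbd[OF that] in auto)
  have fD: "(f k has_real_derivative f (Suc k) z) (at z)" if "k < 5" "z > 0" for k z
    unfolding fk[OF that(1)] using that by (intro tail_has_derivative fi fc') auto
  have fk': "f 4 = tail (f 5)" "f 3 = tail (f 4)" "f 2 = tail (f 3)" "f 1 = tail (f 2)"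
    using fk[of 4] fk[of 3] fk[of 2] fk[of 1] by (simp_all add: eval_nat_numeral)
  \<comment> \<open>From here the weak derivatives of order 2, 1 and 0 are identified in turn with
    \<open>f 5\<close>, \<open>f 4\<close> and \<open>f 3\<close>.\<close>
  have A2: "AE x in lebesgue. x > 0 \<longrightarrow> G 2 x = f 5 x"
  proof -
    have "has_weak_deriv 1 (G 2) (G 3)" using w[of 2] by (simp add: eval_nat_numeral)
    from weak_deriv_eq_tail[OF this Gint Gint] show ?thesis using fi[of 5] by (simp add: f5)
  qed
  have A1: "AE x in lebesgue. x > 0 \<longrightarrow> G 1 x = f 4 x"
  proof -
    have "has_weak_deriv 1 (G 1) (G 2)" using w[of 1] by (simp add: numeral_2_eq_2)
    from weak_deriv_eq_tail_AE[OF this Gint Gint A2 fi] show ?thesis using fi[of 4] by (simp add: fk'(1))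
  qed
  have A0: "AE x in lebesgue. x > 0 \<longrightarrow> G 0 x = f 3 x"
  proof -
    have "has_weak_deriv 1 (G 0) (G 1)" using w[of 0] by simp
    from weak_deriv_eq_tail_AE[OF this Gint Gint A1 fi] show ?thesis using fi[of 3] by (simp add: fk'(2))
  qed
  \<comment> \<open>\<open>G 0\<close> is merely some representative of \<open>U0\<close>; comparing
    it with the trivial one and using continuity gives \<open>f 3 = U0\<close> at every
    point.\<close>
  have "continuous_on {0<..} U0" by (rule continuous_on_subset[OF cont]) auto
  then have "has_weak_deriv 0 U0 U0" by (simp add: has_weak_deriv_def locally_integrable_continuous)
  then have "AE x in lebesgue. x > 0 \<longrightarrow> U0 x = G 0 x"
    by (rule has_weak_deriv_unique) (rule S(1), simp)
  with A0 have "AE x in lebesgue. x > 0 \<longrightarrow> f 3 x = U0 x" by eventually_elim auto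
  then have f3: "f 3 z = U0 z" if "z \<ge> 0" for z
    by (rule AE_eq_continuous_imp_eq) (use fc[of 3] cont that in auto)
  have f1: "f 1 0 = 0"
  proof -
    \<comment> \<open>The factor \<open>y\<close> is paid for with half of the exponent, hence the
      rate 1 / 2 and the constant 2.\<close>
    have yb: "\<bar>y * f k y\<bar> \<le> 2 * K * exp (- (1 / 2) * y)" if "k \<le> 5" "y > 0" for k y
    proof -
      have "\<bar>y * f k y\<bar> \<le> y * (K * exp (- y))"
        using fbd[OF that(1), of y] that by (simp add: abs_mult mult_left_mono)
      also have "\<dots> = K * (y * exp (- y))" by simp
      also have "\<dots> \<le> K * (2 * exp (- (y / 2)))" using mult_exp_minus_le[of y] that K by (intro mult_left_mono) auto
      finally show ?thesis by simp
    qed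
    have eb: "exp (- y) \<le> exp (- (1 / 2) * y)" if "y > 0" for y :: real using that by simp
    have yi: "set_integrable lebesgue {0<..} (\<lambda>y. y * f 3 y)"
      by (rule exp_decay_integrable(1)[of _ "1 / 2" "2 * K"]) (use yb[of 3] in \<open>auto intro!: continuous_intros fc'\<close>)
    \<comment> \<open>The boundary value of \<open>y * f 2 y\<close>. Since its derivative is
      \<open>f 2 y + y * f 3 y\<close>, the integral of \<open>f 2\<close>, which is
      \<open>- f 1 0\<close>, is minus the first moment of \<open>U0\<close>.\<close>
    have "0 * f 2 0 = tail (\<lambda>y. f 2 y + y * f 3 y) 0"
    proof (rule exp_decay_FTC[where c = "1 / 2" and K = "3 * K"])
      show "continuous_on {0..} (\<lambda>y. y * f 2 y)" by (intro continuous_intros fc) auto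
      show "continuous_on {0<..} (\<lambda>y. f 2 y + y * f 3 y)" by (intro continuous_intros fc') auto
      show "((\<lambda>y. y * f 2 y) has_real_derivative f 2 z + z * f 3 z) (at z)" if "z > 0" for z
        using DERIV_mult[OF DERIV_ident fD[of 2 z]] that by (simp add: eval_nat_numeral mult.commute)
      fix y :: real assume y: "y > 0"
      have p: "K * exp (- y) \<le> K * exp (- (1 / 2) * y)" using eb[OF y] K by (intro mult_left_mono) auto
      have q: "\<bar>f 2 y\<bar> \<le> K * exp (- y)" using fbd[of 2 y] y by simp
      show "\<bar>f 2 y + y * f 3 y\<bar> \<le> 3 * K * exp (- (1 / 2) * y)"
        using p q yb[of 3 y] y by linarith
      have "0 \<le> K * exp (- (1 / 2) * y)" using K by simp
      then show "\<bar>y * f 2 y\<bar> \<le> 3 * K * exp (- (1 / 2) * y)" using yb[of 2 y] y by linarith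
    qed simp
    then have "(LINT y:{0<..}|lebesgue. f 2 y + y * f 3 y) = 0" by (simp add: tail_def)
    moreover have "(LINT y:{0<..}|lebesgue. f 2 y + y * f 3 y) = (LINT y:{0<..}|lebesgue. f 2 y) + (LINT y:{0<..}|lebesgue. y * f 3 y)"
      by (rule set_integral_add(2)[OF fi yi]) simp
    moreover have "(LINT y:{0<..}|lebesgue. y * f 3 y) = (LINT y:{0<..}|lebesgue. y * U0 y)"
      by (rule set_integral_cong_positive) (use f3 in auto)
    ultimately show ?thesis using moment unfolding fk'(4) tail_def by simp
  qed
  show ?thesis
    using fc fbd fD f1 f3 bc unfolding K_def by (intro exI[of _ f]) auto
qed

lemma Sobolev_norm_nonneg: "Sobolev_norm m \<nu> h \<ge> 0"
  by (simp add: Sobolev_norm_def sum_nonneg)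

text \<open>The L1 norm of the weak derivative bounds the oscillation, and the value at 0 is known.
  The bound grows with \<open>t\<close>, but the maximum principle needs it only on finite time
  intervals.\<close>

lemma Sobolev_bounded:
  assumes u: "u \<in> Sobolev 3 (\<mu> t)" and t: "t \<ge> 0" and cont: "continuous_on {0..} u" and bc: "u 0 = 0"
    and norm: "Sobolev_norm 3 (\<mu> t) u \<le> M" and z: "z \<ge> 0"
  shows "\<bar>u z\<bar> \<le> (M\<^sup>2 + exp (4 * (1 + t))) / 2"
proof (rule ccontr)
  define B where "B = (M\<^sup>2 + exp (4 * (1 + t))) / 2"
  assume "\<not> \<bar>u z\<bar> \<le> (M\<^sup>2 + exp (4 * (1 + t))) / 2"
  then have big: "\<bar>u z\<bar> > B" by (simp add: B_def)
  note S = Sobolev_weak_deriv[OF u _ \<mu>_continuous \<mu>_pos, of 1]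
  define g where "g = weak_deriv 1 u"
  have w: "has_weak_deriv 1 u g" and L2: "set_integrable lebesgue {0<..} (\<lambda>z. \<mu> t z * (g z)\<^sup>2)"
    and n: "(LINT z:{0<..}|lebesgue. \<mu> t z * (g z)\<^sup>2) \<le> (Sobolev_norm 3 (\<mu> t) u)\<^sup>2"
    using S by (auto simp: g_def)
  have loc: "locally_integrable g" using w by (simp add: has_weak_deriv_def)
  have gi: "set_integrable lebesgue {0<..} g"
    by (rule weighted_L2_imp_L1(1)[OF t loc _ _ L2, of _ 1]) auto
  have "(LINT z:{0<..}|lebesgue. \<bar>g z\<bar>) \<le> (1 * (LINT z:{0<..}|lebesgue. \<mu> t z * (g z)\<^sup>2) + exp (4 * (1 + t)) * exp (- 2 * 0) / 1) / 2"
    by (rule weighted_L2_imp_L1(2)[OF t loc _ _ L2]) auto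
  also have "\<dots> \<le> B"
    using n power_mono[OF norm Sobolev_norm_nonneg, of 2] by (simp add: B_def)
  finally have gB: "(LINT z:{0<..}|lebesgue. \<bar>g z\<bar>) \<le> B" .
  obtain N where N: "negligible N" "\<And>a b. 0 < a \<Longrightarrow> a < b \<Longrightarrow> a \<notin> N \<Longrightarrow> b \<notin> N \<Longrightarrow>
    u b - u a = (LINT z:{a..b}|lebesgue. g z)" using weak_deriv_FTC[OF w] by blast
  have dif: "\<bar>u b - u a\<bar> \<le> B" if ab: "0 < a" "a < b" "a \<notin> N" "b \<notin> N" for a b
  proof -
    have gab: "set_integrable lebesgue {a..b} g" by (rule set_integrable_subset[OF gi]) (use ab in auto)
    have "\<bar>u b - u a\<bar> \<le> (LINT z:{a..b}|lebesgue. \<bar>g z\<bar>)"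
      using integral_abs_bound[of lebesgue "\<lambda>y. indicator {a..b} y *\<^sub>R g y"] N(2)[OF ab]
      by (simp add: set_lebesgue_integral_def abs_mult)
    also have "\<dots> \<le> (LINT z:{0<..}|lebesgue. \<bar>g z\<bar>)"
      unfolding set_lebesgue_integral_def using set_integrable_abs[OF gab] set_integrable_abs[OF gi] ab
      unfolding set_integrable_def by (intro integral_mono) (auto simp: indicator_def)
    finally show ?thesis using gB by simp
  qed
  have pick: "\<exists>x. a < x \<and> x < b \<and> x \<notin> N" if "a < b" for a b
  proof -
    have "\<not> negligible {a<..<b}" using that by (intro open_not_negligible) auto
    then have "\<not> {a<..<b} \<subseteq> N" using negligible_subset[OF N(1)] by blast
    then show ?thesis by (meson greaterThanLessThan_iff subsetI)
  qed
  \<comment> \<open>Half of the supposed excess. Points \<open>a\<close> near 0 and \<open>b\<close>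
    near \<open>z\<close>, both off the null set, cost less than \<open>e\<close> each, so
    \<open>\<bar>u z\<bar>\<close> would be less than
    \<open>B + 2 * e = \<bar>u z\<bar>\<close>.\<close>
  define e where "e = (\<bar>u z\<bar> - B) / 2"
  have e: "e > 0" using big by (simp add: e_def)
  have "B \<ge> 0" by (simp add: B_def)
  then have z0: "z > 0" using big bc z by (cases "z = 0") auto
  obtain d1 where d1: "d1 > 0" "\<And>x. x \<in> {0..} \<Longrightarrow> dist x z < d1 \<Longrightarrow> dist (u x) (u z) < e"
    using cont z e unfolding continuous_on_iff by (metis atLeast_iff)
  obtain d0 where d0: "d0 > 0" "\<And>x. x \<in> {0..} \<Longrightarrow> dist x 0 < d0 \<Longrightarrow> dist (u x) (u 0) < e"
    using cont e unfolding continuous_on_iff by (metis atLeast_iff order_refl)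
  obtain b where b: "z < b" "b < z + d1" "b \<notin> N" using pick[of z "z + d1"] d1(1) by auto
  obtain a where a: "0 < a" "a < min d0 z" "a \<notin> N" using pick[of 0 "min d0 z"] d0(1) z0 by auto
  have "\<bar>u b - u z\<bar> < e" using d1(2)[of b] b z by (simp add: dist_real_def)
  moreover have "\<bar>u a\<bar> < e" using d0(2)[of a] a bc by (simp add: dist_real_def)
  moreover have "\<bar>u b - u a\<bar> \<le> B" by (rule dif) (use a b in auto)
  ultimately show False unfolding e_def by (auto simp: abs_if split: if_splits)
qed

section \<open>Gaussian averages\<close>

text \<open>The expectation of \<open>q(X) * f(z + s * X)\<close> for a standard normal
  \<open>X\<close>. Keeping \<open>z\<close> and \<open>s\<close> in the argument of
  \<open>f\<close> lets derivatives fall on \<open>f\<close>; the polynomial \<open>q\<close>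
  receives what integration by parts takes off again.\<close>

definition gauss_avg :: "real poly \<Rightarrow> (real \<Rightarrow> real) \<Rightarrow> real \<Rightarrow> real \<Rightarrow> real" where
  "gauss_avg q f s z = (LINT x|lborel. std_normal_density x * (poly q x * f (z + s * x)))"

definition gauss_abs :: "real poly \<Rightarrow> real" where
  "gauss_abs q = (LINT x|lborel. std_normal_density x * \<bar>poly q x\<bar>)"

lemma gauss_poly_integrable:
  "integrable lborel (\<lambda>x. std_normal_density x * poly q x)"
  "integrable lborel (\<lambda>x. std_normal_density x * \<bar>poly q x\<bar>)"
proof -
  have "integrable lborel (\<lambda>x. \<Sum>i\<le>degree q. coeff q i * (std_normal_density x * x ^ i))"
    by (intro Bochner_Integration.integrable_sum integrable_mult_right integrable_std_normal_moment)
  moreover have "(\<lambda>x. \<Sum>i\<le>degree q. coeff q i * (std_normal_density x * x ^ i)) = (\<lambda>x. std_normal_density x * poly q x)"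
    by (simp add: poly_altdef sum_distrib_left mult.left_commute)
  ultimately show i: "integrable lborel (\<lambda>x. std_normal_density x * poly q x)" by simp
  show "integrable lborel (\<lambda>x. std_normal_density x * \<bar>poly q x\<bar>)"
    using integrable_abs[OF i] by (simp add: abs_mult)
qed

lemma gauss_abs_nonneg: "gauss_abs q \<ge> 0"
  unfolding gauss_abs_def by (intro integral_nonneg_AE AE_I2) simp

lemma borel_measurable_poly [measurable]: "poly (q :: real poly) \<in> borel_measurable borel"
  by (intro borel_measurable_continuous_onI continuous_intros)

lemma gauss_pointwise_bound:
  assumes b: "\<And>x. \<bar>g x\<bar> \<le> K * \<bar>poly c x\<bar>"
  shows "\<bar>std_normal_density x * (poly q x * g x)\<bar> \<le> K * (std_normal_density x * \<bar>poly (q * c) x\<bar>)"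
proof -
  have "\<bar>std_normal_density x * (poly q x * g x)\<bar> = std_normal_density x * \<bar>poly q x\<bar> * \<bar>g x\<bar>"
    by (simp add: abs_mult)
  also have "\<dots> \<le> std_normal_density x * \<bar>poly q x\<bar> * (K * \<bar>poly c x\<bar>)"
    by (intro mult_left_mono b) simp
  also have "\<dots> = K * (std_normal_density x * \<bar>poly (q * c) x\<bar>)" by (simp add: abs_mult)
  finally show ?thesis .
qed

lemma gauss_integrable:
  assumes g: "g \<in> borel_measurable borel" and b: "\<And>x. \<bar>g x\<bar> \<le> K * \<bar>poly c x\<bar>"
  shows "integrable lborel (\<lambda>x. std_normal_density x * (poly q x * g x))"
proof (rule Bochner_Integration.integrable_bound)
  show "integrable lborel (\<lambda>x. K * (std_normal_density x * \<bar>poly (q * c) x\<bar>))"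
    by (intro integrable_mult_right gauss_poly_integrable)
  show "(\<lambda>x. std_normal_density x * (poly q x * g x)) \<in> borel_measurable lborel" using g by measurable
  show "AE x in lborel. norm (std_normal_density x * (poly q x * g x)) \<le> norm (K * (std_normal_density x * \<bar>poly (q * c) x\<bar>))"
    using gauss_pointwise_bound[OF b] by (intro AE_I2) (metis abs_ge_self order_trans real_norm_def)
qed

lemma gauss_integral_bound:
  assumes g: "g \<in> borel_measurable borel" and b: "\<And>x. \<bar>g x\<bar> \<le> K * \<bar>poly c x\<bar>"
  shows "\<bar>LINT x|lborel. std_normal_density x * (poly q x * g x)\<bar> \<le> K * gauss_abs (q * c)"
proof -
  have "\<bar>LINT x|lborel. std_normal_density x * (poly q x * g x)\<bar> \<le> (LINT x|lborel. \<bar>std_normal_density x * (poly q x * g x)\<bar>)"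
    by (rule integral_abs_bound)
  also have "\<dots> \<le> (LINT x|lborel. K * (std_normal_density x * \<bar>poly (q * c) x\<bar>))"
  proof (rule integral_mono)
    show "integrable lborel (\<lambda>x. \<bar>std_normal_density x * (poly q x * g x)\<bar>)"
      by (intro integrable_abs gauss_integrable[OF g b])
    show "integrable lborel (\<lambda>x. K * (std_normal_density x * \<bar>poly (q * c) x\<bar>))"
      by (intro integrable_mult_right gauss_poly_integrable)
  qed (rule gauss_pointwise_bound[OF b])
  finally show ?thesis by (simp add: gauss_abs_def)
qed

lemma gauss_dominated:
  assumes g: "\<And>n. g n \<in> borel_measurable borel" "h \<in> borel_measurable borel"
    and lim: "AE x in lborel. (\<lambda>n. g n x) \<longlonglongrightarrow> h x" and b: "\<And>n x. \<bar>g n x\<bar> \<le> K * \<bar>poly c x\<bar>"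
  shows "(\<lambda>n. LINT x|lborel. std_normal_density x * (poly q x * g n x))
     \<longlonglongrightarrow> (LINT x|lborel. std_normal_density x * (poly q x * h x))"
proof (rule integral_dominated_convergence)
  show "integrable lborel (\<lambda>x. K * (std_normal_density x * \<bar>poly (q * c) x\<bar>))"
    by (intro integrable_mult_right gauss_poly_integrable)
  show "(\<lambda>x. std_normal_density x * (poly q x * h x)) \<in> borel_measurable lborel" using g(2) by measurable
  show "(\<lambda>x. std_normal_density x * (poly q x * g n x)) \<in> borel_measurable lborel" for n
    using g(1)[of n] by measurable
  show "AE x in lborel. (\<lambda>n. std_normal_density x * (poly q x * g n x)) \<longlonglongrightarrow> std_normal_density x * (poly q x * h x)"
    using lim by eventually_elim (intro tendsto_intros)
  show "AE x in lborel. norm (std_normal_density x * (poly q x * g n x)) \<le> K * (std_normal_density x * \<bar>poly (q * c) x\<bar>)" for n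
    using gauss_pointwise_bound[of "g n", OF b] by simp
qed

lemma gauss_avg_bound:
  assumes f: "f \<in> borel_measurable borel" and b: "\<And>x. \<bar>f x\<bar> \<le> K"
  shows "\<bar>gauss_avg q f s z\<bar> \<le> K * gauss_abs q"
  using gauss_integral_bound[of "\<lambda>x. f (z + s * x)" K 1 q] f b unfolding gauss_avg_def by simp

text \<open>Write \<open>z = (z + s * x) - s * x\<close>. The first part is absorbed by the decay of
  \<open>f\<close>, and the second moves into the polynomial at the price of a factor
  \<open>s\<close>.\<close>

lemma gauss_avg_bound_mult:
  assumes f: "f \<in> borel_measurable borel" and b: "\<And>x. \<bar>f x\<bar> \<le> K" "\<And>x. \<bar>x * f x\<bar> \<le> K" and s: "s \<ge> 0"
  shows "\<bar>z * gauss_avg q f s z\<bar> \<le> K * (gauss_abs q + s * gauss_abs ([:0, 1:] * q))"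
proof -
  define y where "y x = z + s * x" for x
  have m: "(\<lambda>x. f (y x)) \<in> borel_measurable borel" "(\<lambda>x. y x * f (y x)) \<in> borel_measurable borel"
    using f unfolding y_def by measurable
  have "z * gauss_avg q f s z = (LINT x|lborel. z * (std_normal_density x * (poly q x * f (y x))))"
    unfolding gauss_avg_def y_def by simp
  also have "\<dots> = (LINT x|lborel. std_normal_density x * (poly q x * (y x * f (y x)))
      - s * (std_normal_density x * (poly ([:0, 1:] * q) x * f (y x))))"
    by (intro Bochner_Integration.integral_cong) (simp_all add: y_def algebra_simps)
  also have "\<dots> = (LINT x|lborel. std_normal_density x * (poly q x * (y x * f (y x))))
      - s * (LINT x|lborel. std_normal_density x * (poly ([:0, 1:] * q) x * f (y x)))"
    using gauss_integrable[OF m(2), of K 1 q] gauss_integrable[OF m(1), of K 1 "[:0, 1:] * q"] b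
    by (subst Bochner_Integration.integral_diff) simp_all
  finally have e: "z * gauss_avg q f s z = \<dots>" .
  have "\<bar>LINT x|lborel. std_normal_density x * (poly q x * (y x * f (y x)))\<bar> \<le> K * gauss_abs (q * 1)"
    by (rule gauss_integral_bound[OF m(2)]) (use b(2) in simp)
  moreover have "\<bar>LINT x|lborel. std_normal_density x * (poly ([:0, 1:] * q) x * f (y x))\<bar> \<le> K * gauss_abs (([:0, 1:] * q) * 1)"
    by (rule gauss_integral_bound[OF m(1)]) (use b(1) in simp)
  then have "\<bar>s * (LINT x|lborel. std_normal_density x * (poly ([:0, 1:] * q) x * f (y x)))\<bar> \<le> s * (K * gauss_abs ([:0, 1:] * q))"
    using s by (simp add: abs_mult mult_left_mono)
  ultimately show ?thesis unfolding e by (simp add: algebra_simps)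
qed

text \<open>At most one \<open>x\<close> is excluded, and none when \<open>s = 0\<close>. This
  covers time 0 away from the boundary.\<close>

lemma AE_affine_nonzero:
  assumes "s \<noteq> 0 \<or> z \<noteq> (0::real)"
  shows "AE x in lborel. z + s * x \<noteq> 0"
proof (cases "s = 0")
  case False
  have "AE x in lborel. x \<noteq> - z / s" by (rule AE_lborel_singleton)
  then show ?thesis by eventually_elim (use False in \<open>auto simp: field_simps\<close>)
qed (use assms in auto)

section \<open>Continuity and differentiation under the Gaussian\<close>

lemma gauss_avg_tendsto:
  assumes f: "f \<in> borel_measurable borel" and b: "\<And>x. \<bar>f x\<bar> \<le> K"
    and c: "AE x in lborel. isCont f (z + s * x)" and lim: "S \<longlonglongrightarrow> s" "Z \<longlonglongrightarrow> z"
  shows "(\<lambda>n. gauss_avg q f (S n) (Z n)) \<longlonglongrightarrow> gauss_avg q f s z"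
  unfolding gauss_avg_def
proof (rule gauss_dominated[where K = K and c = 1])
  show "(\<lambda>x. f (Z n + S n * x)) \<in> borel_measurable borel" "(\<lambda>x. f (z + s * x)) \<in> borel_measurable borel" for n
    using f by measurable
  show "AE x in lborel. (\<lambda>n. f (Z n + S n * x)) \<longlonglongrightarrow> f (z + s * x)"
    using c by eventually_elim (intro isCont_tendsto_compose[of _ f] tendsto_intros lim)
qed (use b in simp)

text \<open>Made for reflected functions: \<open>f\<close> may have a corner at 0, where
  \<open>f'\<close> may jump and its value is left free.\<close>

definition piecewise_deriv :: "(real \<Rightarrow> real) \<Rightarrow> (real \<Rightarrow> real) \<Rightarrow> bool" where
  "piecewise_deriv f f' \<longleftrightarrow> continuous_on UNIV f \<and> (\<forall>x. x \<noteq> 0 \<longrightarrow> (f has_real_derivative f' x) (at x)) \<and>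
     continuous_on (- {0}) f'"

lemma piecewise_deriv_measurable:
  assumes "piecewise_deriv f f'"
  shows "f \<in> borel_measurable borel" "f' \<in> borel_measurable borel"
  using assms borel_measurable_continuous_countable_exceptions[of "{0}" f']
  by (auto simp: piecewise_deriv_def borel_measurable_continuous_onI)

text \<open>The mean value theorem works on each side of 0, and continuity joins the two estimates
  there. The result dominates difference quotients that straddle the corner.\<close>

lemma piecewise_deriv_lipschitz:
  assumes p: "piecewise_deriv f f'" and b: "\<And>x. \<bar>f' x\<bar> \<le> K"
  shows "\<bar>f x - f y\<bar> \<le> K * \<bar>x - y\<bar>"
proof -
  have cont: "continuous_on S f" for S using p continuous_on_subset unfolding piecewise_deriv_def by blast
  have D: "(f has_real_derivative f' x) (at x)" if "x \<noteq> 0" for x using p that by (auto simp: piecewise_deriv_def)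
  have one: "\<bar>f b - f a\<bar> \<le> K * (b - a)" if "a < b" "0 \<notin> {a<..<b}" for a b
  proof -
    have "f differentiable at x" if "a < x" "x < b" for x
      using D[of x] that \<open>0 \<notin> {a<..<b}\<close> real_differentiable_def by auto
    then obtain l z where z: "a < z" "z < b" "(f has_real_derivative l) (at z)" "f b - f a = (b - a) * l"
      using MVT[OF \<open>a < b\<close> cont] by blast
    have "z \<noteq> 0" using that z by auto
    then have "l = f' z" using D z(3) DERIV_unique by blast
    then show ?thesis using z(4) b[of z] that(1) by (simp add: abs_mult mult.commute mult_right_mono)
  qed
  have two: "\<bar>f b - f a\<bar> \<le> K * (b - a)" if "a < b" for a b
  proof (cases "0 \<in> {a<..<b}")
    case True
    then have "\<bar>f b - f 0\<bar> \<le> K * (b - 0)" "\<bar>f 0 - f a\<bar> \<le> K * (0 - a)" by (intro one; simp)+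
    then show ?thesis by (simp add: algebra_simps)
  qed (use one that in blast)
  show ?thesis using two[of x y] two[of y x]
    by (cases x y rule: linorder_cases) (auto simp: abs_minus_commute)
qed

lemma piecewise_deriv_isCont:
  assumes "piecewise_deriv f f'"
  shows "isCont f x" "x \<noteq> 0 \<Longrightarrow> isCont f' x"
  using assms continuous_on_eq_continuous_at[of "- {0}" f'] continuous_on_eq_continuous_at[of UNIV f]
  by (auto simp: piecewise_deriv_def)

text \<open>Perturbing the argument by \<open>r * poly c x\<close> treats both variables at once:
  \<open>c = 1\<close> is the derivative in \<open>z\<close>, and \<open>c = [:0, 1:]\<close> the
  one in \<open>s\<close>.\<close>

lemma gauss_avg_directional_derivative:
  assumes p: "piecewise_deriv f f'" and b: "\<And>x. \<bar>f x\<bar> \<le> K" "\<And>x. \<bar>f' x\<bar> \<le> K"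
    and nz: "s \<noteq> 0 \<or> z \<noteq> 0"
  shows "((\<lambda>r. LINT x|lborel. std_normal_density x * (poly q x * f (z + s * x + r * poly c x)))
     has_real_derivative gauss_avg (q * c) f' s z) (at 0)"
  unfolding has_field_derivative_iff tendsto_at_iff_sequentially
proof (intro allI impI)
  fix R :: "nat \<Rightarrow> real" assume R: "\<forall>i. R i \<in> UNIV - {0}" "R \<longlonglongrightarrow> 0"
  note m = piecewise_deriv_measurable[OF p]
  define G where "G n x = (f (z + s * x + R n * poly c x) - f (z + s * x)) / R n" for n x
  have "(\<lambda>n. LINT x|lborel. std_normal_density x * (poly q x * G n x))
    \<longlonglongrightarrow> (LINT x|lborel. std_normal_density x * (poly q x * (poly c x * f' (z + s * x))))"
  proof (rule gauss_dominated[where K = K and c = c])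
    show "G n \<in> borel_measurable borel" for n unfolding G_def using m by measurable
    show "(\<lambda>x. poly c x * f' (z + s * x)) \<in> borel_measurable borel" using m by measurable
    show "\<bar>G n x\<bar> \<le> K * \<bar>poly c x\<bar>" for n x
      using piecewise_deriv_lipschitz[OF p b(2), of "z + s * x + R n * poly c x" "z + s * x"] R(1)
      by (simp add: G_def divide_simps abs_mult mult_ac)
    show "AE x in lborel. (\<lambda>n. G n x) \<longlonglongrightarrow> poly c x * f' (z + s * x)"
      using AE_affine_nonzero[OF nz]
    proof eventually_elim
      case (elim x)
      have "((\<lambda>r. f (z + s * x + r * poly c x)) has_real_derivative f' (z + s * x + 0 * poly c x) * poly c x) (at 0)"
        by (rule DERIV_chain'[where g = f])
          (use p elim in \<open>auto intro!: derivative_eq_intros simp: piecewise_deriv_def\<close>)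
      then have "((\<lambda>n. (f (z + s * x + R n * poly c x) - f (z + s * x)) / R n) \<longlonglongrightarrow> f' (z + s * x) * poly c x)"
        using R unfolding has_field_derivative_iff tendsto_at_iff_sequentially by (auto simp: o_def)
      then show ?case by (simp add: G_def mult.commute)
    qed
  qed
  moreover have "(LINT x|lborel. std_normal_density x * (poly q x * G n x)) =
     ((LINT x|lborel. std_normal_density x * (poly q x * f (z + s * x + R n * poly c x)))
       - (LINT x|lborel. std_normal_density x * (poly q x * f (z + s * x)))) / R n" for n
  proof -
    have "integrable lborel (\<lambda>x. std_normal_density x * (poly q x * f (z + s * x + R n * poly c x)))"
      "integrable lborel (\<lambda>x. std_normal_density x * (poly q x * f (z + s * x)))"
      by (rule gauss_integrable[where K = K and c = 1]; use m b(1) in \<open>simp; measurable?\<close>)+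
    then have "(LINT x|lborel. std_normal_density x * (poly q x * f (z + s * x + R n * poly c x)))
       - (LINT x|lborel. std_normal_density x * (poly q x * f (z + s * x)))
      = (LINT x|lborel. R n * (std_normal_density x * (poly q x * G n x)))"
      using R(1) by (subst Bochner_Integration.integral_diff[symmetric])
        (auto intro!: Bochner_Integration.integral_cong simp: G_def field_simps)
    then show ?thesis using R(1) by simp
  qed
  ultimately show "((\<lambda>y. ((LINT x|lborel. std_normal_density x * (poly q x * f (z + s * x + y * poly c x))) -
        (LINT x|lborel. std_normal_density x * (poly q x * f (z + s * x + 0 * poly c x)))) / (y - 0)) \<circ> R)
    \<longlonglongrightarrow> gauss_avg (q * c) f' s z"
    by (simp add: o_def gauss_avg_def mult.assoc)
qed

lemma gauss_avg_deriv_z: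
  assumes "piecewise_deriv f f'" "\<And>x. \<bar>f x\<bar> \<le> K" "\<And>x. \<bar>f' x\<bar> \<le> K" "s \<noteq> 0 \<or> z \<noteq> 0"
  shows "(gauss_avg q f s has_real_derivative gauss_avg q f' s z) (at z)"
proof -
  have "gauss_avg q f s (r + z) = (LINT x|lborel. std_normal_density x * (poly q x * f (z + s * x + r * poly 1 x)))" for r
    by (simp add: gauss_avg_def algebra_simps)
  then show ?thesis
    using gauss_avg_directional_derivative[OF assms, of q 1] DERIV_shift[of "gauss_avg q f s" _ 0 z] by simp
qed

lemma gauss_avg_deriv_s:
  assumes "piecewise_deriv f f'" "\<And>x. \<bar>f x\<bar> \<le> K" "\<And>x. \<bar>f' x\<bar> \<le> K" "s \<noteq> 0 \<or> z \<noteq> 0"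
  shows "((\<lambda>s. gauss_avg q f s z) has_real_derivative gauss_avg (q * [:0, 1:]) f' s z) (at s)"
proof -
  have "gauss_avg q f (r + s) z = (LINT x|lborel. std_normal_density x * (poly q x * f (z + s * x + r * poly [:0, 1:] x)))" for r
    by (simp add: gauss_avg_def algebra_simps)
  then show ?thesis
    using gauss_avg_directional_derivative[OF assms, of q "[:0, 1:]"] DERIV_shift[of "\<lambda>s. gauss_avg q f s z" _ 0 s] by simp
qed

section \<open>Gaussian integration by parts\<close>

lemma gauss_poly_tendsto_0:
  assumes x: "\<And>n. \<bar>x n\<bar> = real n"
  shows "(\<lambda>n. std_normal_density (x n) * poly q (x n)) \<longlonglongrightarrow> 0"
proof -
  have "(\<lambda>n. std_normal_density (x n) * x n ^ i) \<longlonglongrightarrow> 0" for i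
  proof (rule Lim_null_comparison[OF always_eventually])
    show "\<forall>n. norm (std_normal_density (x n) * x n ^ i) \<le> exp (1 / 2) * (real n ^ i / exp (real n))"
    proof
      fix n
      \<comment> \<open>The tangent-line bound that replaces the Gaussian by
        \<open>exp (- real n)\<close>, up to a constant.\<close>
      have "0 \<le> (real n - 1)\<^sup>2" by simp
      then have "- (real n)\<^sup>2 / 2 \<le> 1 / 2 + - real n" by (simp add: power2_eq_square field_simps)
      then have "exp (- (real n)\<^sup>2 / 2) \<le> exp (1 / 2) * exp (- real n)"
        by (simp only: exp_add[symmetric] exp_le_cancel_iff)
      moreover have "1 / sqrt (2 * pi) \<le> 1" using pi_ge_two by (simp add: real_le_rsqrt)
      ultimately have "1 / sqrt (2 * pi) * exp (- (real n)\<^sup>2 / 2) \<le> 1 * (exp (1 / 2) * exp (- real n))"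
        by (intro mult_mono) auto
      moreover have "(x n)\<^sup>2 = (real n)\<^sup>2" using x[of n] by (metis power2_abs)
      ultimately have "std_normal_density (x n) \<le> exp (1 / 2) * exp (- real n)"
        by (simp add: std_normal_density_def)
      then have "std_normal_density (x n) * real n ^ i \<le> exp (1 / 2) * exp (- real n) * real n ^ i"
        by (intro mult_right_mono) auto
      then show "norm (std_normal_density (x n) * x n ^ i) \<le> exp (1 / 2) * (real n ^ i / exp (real n))"
        by (simp add: abs_mult power_abs x exp_minus field_simps)
    qed
    have "(\<lambda>n. exp (1 / 2) * (real n ^ i / exp (real n))) \<longlonglongrightarrow> exp (1 / 2) * 0"
      by (intro tendsto_mult_left filterlim_compose[OF tendsto_power_div_exp_0 filterlim_real_sequentially])
    then show "(\<lambda>n. exp (1 / 2) * (real n ^ i / exp (real n))) \<longlonglongrightarrow> 0" by simp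
  qed
  then have "(\<lambda>n. \<Sum>i\<le>degree q. coeff q i * (std_normal_density (x n) * x n ^ i)) \<longlonglongrightarrow> (\<Sum>i\<le>degree q. coeff q i * 0)"
    by (intro tendsto_sum tendsto_mult_left)
  then show ?thesis by (simp add: poly_altdef sum_distrib_left mult.left_commute)
qed

lemma std_normal_density_has_derivative:
  "(std_normal_density has_real_derivative - x * std_normal_density x) (at x)"
  unfolding std_normal_density_def[abs_def]
  by (auto intro!: derivative_eq_intros simp: field_simps)

text \<open>
  The adjoint of differentiation with respect to the Gaussian; its iterates on \<open>1\<close> are the Hermite
  polynomials.
\<close>

definition herm_step :: "real poly \<Rightarrow> real poly" where
  "herm_step q = [:0, 1:] * q - pderiv q"

text \<open>The density has derivative \<open>- x\<close> times itself, so the product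
  \<open>F\<close> below has derivative \<open>G\<close>, the difference of the two integrands.
  Integrate over \<open>[- n, n]\<close>; the boundary terms vanish in the limit because the density
  beats every polynomial.\<close>

lemma gauss_avg_by_parts:
  assumes p: "piecewise_deriv f f'" and b: "\<And>x. \<bar>f x\<bar> \<le> K" "\<And>x. \<bar>f' x\<bar> \<le> K" and s: "s \<noteq> 0"
  shows "s * gauss_avg q f' s z = gauss_avg (herm_step q) f s z"
proof -
  note m = piecewise_deriv_measurable[OF p]
  define F where "F x = std_normal_density x * (poly q x * f (z + s * x))" for x
  define G where "G x = s * (std_normal_density x * (poly q x * f' (z + s * x)))
     - std_normal_density x * (poly (herm_step q) x * f (z + s * x))" for x
  have i: "integrable lborel (\<lambda>x. std_normal_density x * (poly q x * f' (z + s * x)))"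
    "integrable lborel (\<lambda>x. std_normal_density x * (poly (herm_step q) x * f (z + s * x)))"
    by (rule gauss_integrable[where K = K and c = 1]; use m b in simp)+
  then have Gi: "integrable lborel G" unfolding G_def by (intro Bochner_Integration.integrable_diff integrable_mult_right)
  have cf: "continuous_on S f" for S using p continuous_on_subset unfolding piecewise_deriv_def by blast
  have FTC: "(G has_integral F (real n) - F (- real n)) {- real n..real n}" for n
  \<comment> \<open>The only point where \<open>z + s * x\<close> meets the corner of
    \<open>f\<close>; continuity of \<open>F\<close> suffices there.\<close>
  proof (rule fundamental_theorem_of_calculus_interior_strong[of "{- z / s}"])
    show "continuous_on {- real n..real n} F"
      unfolding F_def std_normal_density_def
      by (intro continuous_intros continuous_on_compose2[OF cf[of UNIV], of _ "\<lambda>x. z + s * x"]) auto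
    fix x assume "x \<in> {- real n<..<real n} - {- z / s}"
    then have x: "z + s * x \<noteq> 0" using s by (auto simp: field_simps add_eq_0_iff)
    have "(f has_real_derivative f' (z + s * x)) (at (z + s * x))" using p x by (simp add: piecewise_deriv_def)
    then have df: "((\<lambda>x. f (z + s * x)) has_real_derivative f' (z + s * x) * s) (at x)"
      by (rule DERIV_chain'[rotated]) (auto intro!: derivative_eq_intros)
    have "(F has_real_derivative - x * std_normal_density x * (poly q x * f (z + s * x)) +
       (poly (pderiv q) x * f (z + s * x) + f' (z + s * x) * s * poly q x) * std_normal_density x) (at x)"
      unfolding F_def by (rule DERIV_mult[OF std_normal_density_has_derivative DERIV_mult[OF poly_DERIV df]])
    moreover have "- x * std_normal_density x * (poly q x * f (z + s * x)) +
       (poly (pderiv q) x * f (z + s * x) + f' (z + s * x) * s * poly q x) * std_normal_density x = G x"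
      by (simp add: G_def herm_step_def algebra_simps)
    ultimately show "(F has_vector_derivative G x) (at x)"
      by (simp add: has_real_derivative_iff_has_vector_derivative)
  qed auto
  have "(LINT x:{- real n..real n}|lborel. G x) = F (real n) - F (- real n)" for n
  proof -
    have "set_integrable lborel {- real n..real n} G"
      unfolding set_integrable_def using Gi by (intro integrable_mult_indicator) auto
    then show ?thesis using set_borel_integral_eq_integral(2) FTC integral_unique by metis
  qed
  moreover have "(\<lambda>n. LINT x:{- real n..real n}|lborel. G x) \<longlonglongrightarrow> (LINT x|lborel. G x)"
    unfolding set_lebesgue_integral_def
  proof (rule integral_dominated_convergence)
    show "integrable lborel (\<lambda>x. \<bar>G x\<bar>)" using Gi by (rule integrable_abs)
    show "G \<in> borel_measurable lborel" using Gi by (rule borel_measurable_integrable)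
    show "(\<lambda>x. indicator {- real n..real n} x *\<^sub>R G x) \<in> borel_measurable lborel" for n
      using borel_measurable_integrable[OF Gi] by measurable
    show "AE x in lborel. (\<lambda>n. indicator {- real n..real n} x *\<^sub>R G x) \<longlonglongrightarrow> G x"
    proof (intro AE_I2)
      fix x :: real
      obtain n0 :: nat where n0: "\<bar>x\<bar> \<le> real n0" using real_arch_simple by blast
      have "indicator {- real n..real n} x *\<^sub>R G x = G x" if "n \<ge> n0" for n
        using n0 that by (auto simp: indicator_def)
      then have "eventually (\<lambda>n. indicator {- real n..real n} x *\<^sub>R G x = G x) sequentially"
        using eventually_sequentially by blast
      then show "(\<lambda>n. indicator {- real n..real n} x *\<^sub>R G x) \<longlonglongrightarrow> G x" by (rule tendsto_eventually)
    qed
    show "AE x in lborel. norm (indicator {- real n..real n} x *\<^sub>R G x) \<le> \<bar>G x\<bar>" for n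
      by (intro AE_I2) (auto simp: indicator_def)
  qed
  moreover have F0: "(\<lambda>n. F (x n)) \<longlonglongrightarrow> 0" if x: "\<And>n. \<bar>x n\<bar> = real n" for x
  proof (rule Lim_null_comparison[OF always_eventually])
    have "(\<lambda>n. \<bar>std_normal_density (x n) * poly q (x n)\<bar> * K) \<longlonglongrightarrow> \<bar>0\<bar> * K"
      by (intro tendsto_intros gauss_poly_tendsto_0 x)
    then show "(\<lambda>n. \<bar>std_normal_density (x n) * poly q (x n)\<bar> * K) \<longlonglongrightarrow> 0" by simp
    have "\<bar>F (x n)\<bar> = \<bar>std_normal_density (x n) * poly q (x n)\<bar> * \<bar>f (z + s * x n)\<bar>" for n
      by (simp add: F_def abs_mult)
    then show "\<forall>n. norm (F (x n)) \<le> \<bar>std_normal_density (x n) * poly q (x n)\<bar> * K"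
      using b(1) by (simp add: mult_left_mono)
  qed
  have "(\<lambda>n. F (real n) - F (- real n)) \<longlonglongrightarrow> 0 - 0"
    by (intro tendsto_diff F0) auto
  ultimately have "(LINT x|lborel. G x) = 0" using LIMSEQ_unique by fastforce
  then show ?thesis using i unfolding G_def gauss_avg_def by simp
qed

text \<open>As \<open>sgn 0 = 0\<close>, an odd extension takes the value 0 at the origin whatever
  \<open>f 0\<close> is; for the last member of the chain this is where the jump sits.\<close>

definition parity_ext :: "nat \<Rightarrow> (real \<Rightarrow> real) \<Rightarrow> real \<Rightarrow> real" where
  "parity_ext k f x = (if even k then f \<bar>x\<bar> else sgn x * f \<bar>x\<bar>)"

lemma piecewise_deriv_parity_ext:
  assumes f: "continuous_on {0..} f" "\<And>z. z > 0 \<Longrightarrow> (f has_real_derivative f' z) (at z)"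
    and f': "continuous_on {0..} f'" and bc: "odd k \<Longrightarrow> f 0 = 0"
  shows "piecewise_deriv (parity_ext k f) (parity_ext (Suc k) f')"
  unfolding piecewise_deriv_def
proof (intro conjI allI impI)
  show "continuous_on UNIV (parity_ext k f)"
  proof (cases "even k")
    case True
    then have "parity_ext k f = (\<lambda>x. f \<bar>x\<bar>)" by (auto simp: parity_ext_def)
    moreover have "continuous_on UNIV (\<lambda>x. f \<bar>x\<bar>)"
      by (rule continuous_on_compose2[OF f(1)]) (auto intro!: continuous_intros)
    ultimately show ?thesis by simp
  next
    case False
    \<comment> \<open>Written with positive and negative parts, the odd extension is visibly
      continuous; the identity uses \<open>f 0 = 0\<close>.\<close>
    then have "parity_ext k f = (\<lambda>x. f (max x 0) - f (max (- x) 0))"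
      using bc by (auto simp: parity_ext_def sgn_if max_def)
    moreover have "continuous_on UNIV (\<lambda>x. f (max x 0))" "continuous_on UNIV (\<lambda>x. f (max (- x) 0))"
      by (rule continuous_on_compose2[OF f(1)]; auto intro!: continuous_intros)+
    ultimately show ?thesis by (simp add: continuous_on_diff)
  qed
  have c: "continuous_on (- {0}) (\<lambda>x::real. f' \<bar>x\<bar>)"
    by (rule continuous_on_compose2[OF f']) (auto intro!: continuous_intros)
  have "continuous_on (- {0}) (\<lambda>x::real. if even (Suc k) then f' \<bar>x\<bar> else sgn x * f' \<bar>x\<bar>)"
    using c by (cases "even (Suc k)") (auto intro!: continuous_intros)
  then show "continuous_on (- {0}) (parity_ext (Suc k) f')" by (simp add: parity_ext_def[abs_def])
  fix x :: real assume x: "x \<noteq> 0"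
  show "(parity_ext k f has_real_derivative parity_ext (Suc k) f' x) (at x)"
  proof (cases "x > 0")
    case True
    have "(f has_real_derivative parity_ext (Suc k) f' x) (at x)"
      using f(2)[OF True] True by (simp add: parity_ext_def)
    then show ?thesis
      by (rule has_field_derivative_transform_within_open[of _ _ _ "{0<..}"])
        (use True in \<open>auto simp: parity_ext_def\<close>)
  next
    case False
    \<comment> \<open>On the negative axis the extension is \<open>\<sigma> * f (- y)\<close>. The
      chain rule flips the sign, which is the change of parity.\<close>
    define \<sigma> :: real where "\<sigma> = (if even k then 1 else - 1)"
    have "((\<lambda>y. f (- y)) has_real_derivative f' (- x) * - 1) (at x)"
      by (rule DERIV_chain'[where g = f]) (use f(2)[of "- x"] False x in \<open>auto intro!: derivative_eq_intros\<close>)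
    from DERIV_cmult[OF this, of \<sigma>]
    have "((\<lambda>y. \<sigma> * f (- y)) has_real_derivative parity_ext (Suc k) f' x) (at x)"
      using False x by (auto simp: parity_ext_def \<sigma>_def)
    then show ?thesis
      by (rule has_field_derivative_transform_within_open[of _ _ _ "{..<0}"])
        (use False x in \<open>auto simp: parity_ext_def \<sigma>_def\<close>)
  qed
qed

lemma parity_ext_bounds:
  assumes b: "\<And>z. z \<ge> 0 \<Longrightarrow> \<bar>f z\<bar> \<le> K * exp (- z)"
  shows "\<bar>parity_ext k f x\<bar> \<le> K" "\<bar>x * parity_ext k f x\<bar> \<le> K"
proof -
  have K: "K \<ge> 0" using b[of 0] by simp
  have p: "\<bar>parity_ext k f x\<bar> \<le> \<bar>f \<bar>x\<bar>\<bar>" by (auto simp: parity_ext_def sgn_if)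
  also have "\<dots> \<le> K * exp (- \<bar>x\<bar>)" using b[of "\<bar>x\<bar>"] by simp
  finally have le: "\<bar>parity_ext k f x\<bar> \<le> K * exp (- \<bar>x\<bar>)" .
  also have "\<dots> \<le> K * 1" using K by (intro mult_left_mono) auto
  finally show "\<bar>parity_ext k f x\<bar> \<le> K" by simp
  have "\<bar>x * parity_ext k f x\<bar> \<le> \<bar>x\<bar> * (K * exp (- \<bar>x\<bar>))"
    using le by (simp add: abs_mult mult_left_mono)
  also have "\<dots> = K * (\<bar>x\<bar> * exp (- \<bar>x\<bar>))" by simp
  also have "\<dots> \<le> K * 1"
  proof (rule mult_left_mono[OF _ K])
    have "\<bar>x\<bar> \<le> exp \<bar>x\<bar>" using exp_ge_add_one_self[of "\<bar>x\<bar>"] by linarith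
    then show "\<bar>x\<bar> * exp (- \<bar>x\<bar>) \<le> 1" by (simp add: exp_minus field_simps)
  qed
  finally show "\<bar>x * parity_ext k f x\<bar> \<le> K" by simp
qed

lemma gauss_avg_zero_width: "gauss_avg 1 f 0 z = f z"
  using integral_std_normal_moment_even[of 0] by (simp add: gauss_avg_def)

text \<open>The density is symmetric under reflection. This is how the odd extension enforces the
  boundary condition at all times.\<close>

lemma gauss_avg_odd_function:
  assumes "\<And>x. f (- x) = - f x"
  shows "gauss_avg 1 f s 0 = 0"
proof -
  let ?g = "\<lambda>x. std_normal_density x * (poly 1 x * f (0 + s * x))"
  have "(LINT x|lborel. ?g x) = \<bar>- 1\<bar> *\<^sub>R (LINT x|lborel. ?g (0 + - 1 * x))"
    by (rule lborel_integral_real_affine) simp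
  also have "\<dots> = (LINT x|lborel. - ?g x)"
    using assms by (auto intro!: Bochner_Integration.integral_cong simp: std_normal_density_def)
  finally show ?thesis by (simp add: gauss_avg_def)
qed

section \<open>Whole-line chains and the decay of their heat evolution\<close>

definition deriv_chain :: "real \<Rightarrow> (nat \<Rightarrow> real \<Rightarrow> real) \<Rightarrow> bool" where
  "deriv_chain K F \<longleftrightarrow> (\<forall>k<5. piecewise_deriv (F k) (F (Suc k))) \<and>
     (\<forall>k\<le>5. \<forall>x. \<bar>F k x\<bar> \<le> K \<and> \<bar>x * F k x\<bar> \<le> K)"

lemma deriv_chain_measurable:
  assumes "deriv_chain K F" "k \<le> 5"
  shows "F k \<in> borel_measurable borel"
proof (cases k)
  case 0
  then show ?thesis using assms piecewise_deriv_measurable(1)[of "F 0" "F 1"] by (auto simp: deriv_chain_def)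
next
  case (Suc j)
  then show ?thesis using assms piecewise_deriv_measurable(2)[of "F j" "F k"] by (auto simp: deriv_chain_def)
qed

lemma deriv_chain_by_parts:
  assumes F: "deriv_chain K F" and "k \<le> 5" and s: "s \<noteq> 0"
  shows "s ^ k * gauss_avg 1 (F k) s z = gauss_avg ((herm_step ^^ k) 1) (F 0) s z"
proof -
  \<comment> \<open>Each integration by parts changes the polynomial, so the induction must range
    over all \<open>q\<close>.\<close>
  have "i + k \<le> 5 \<Longrightarrow> s ^ k * gauss_avg q (F (i + k)) s z = gauss_avg ((herm_step ^^ k) q) (F i) s z" for i q
  proof (induction k arbitrary: q)
    case (Suc k)
    have "s * gauss_avg q (F (Suc (i + k))) s z = gauss_avg (herm_step q) (F (i + k)) s z"
      by (rule gauss_avg_by_parts[of _ _ K]) (use Suc.prems F s in \<open>auto simp: deriv_chain_def\<close>)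
    then have "s ^ Suc k * gauss_avg q (F (i + Suc k)) s z = s ^ k * gauss_avg (herm_step q) (F (i + k)) s z"
      by simp
    also have "\<dots> = gauss_avg ((herm_step ^^ k) (herm_step q)) (F i) s z"
      by (rule Suc.IH) (use Suc.prems in simp)
    finally show ?case by (simp only: funpow_Suc_right o_apply)
  qed simp
  from this[of 0 1] show ?thesis using assms by simp
qed

definition heat_evol :: "(nat \<Rightarrow> real \<Rightarrow> real) \<Rightarrow> nat \<Rightarrow> real \<Rightarrow> real \<Rightarrow> real" where
  "heat_evol F k t z = gauss_avg 1 (F k) (sqrt (2 * t)) z"

text \<open>The condition \<open>z > 0\<close> takes the place of \<open>t > 0\<close>, so that the
  initial time is included.\<close>

lemma heat_evol_deriv_z:
  assumes "deriv_chain K F" "k < 5" "z > 0"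
  shows "(heat_evol F k t has_real_derivative heat_evol F (Suc k) t z) (at z)"
  unfolding heat_evol_def[abs_def]
  by (rule gauss_avg_deriv_z[where K = K]) (use assms in \<open>auto simp: deriv_chain_def\<close>)

text \<open>The heat equation: differentiating in \<open>s\<close> produces the polynomial
  \<open>x\<close>, which is \<open>herm_step 1\<close>, so integration by parts turns it into
  \<open>s\<close> times the average of the second derivative. The inner derivative of
  \<open>sqrt (2 * t)\<close> is \<open>1 / s\<close> and cancels the factor.\<close>

lemma heat_evol_deriv_t:
  assumes F: "deriv_chain K F" and k: "k < 4" and t: "t > 0"
  shows "((\<lambda>t. heat_evol F k t z) has_real_derivative heat_evol F (Suc (Suc k)) t z) (at t)"
proof -
  define s where "s = sqrt (2 * t)"
  have s: "s > 0" using t by (simp add: s_def)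
  have "((\<lambda>s. gauss_avg 1 (F k) s z) has_real_derivative gauss_avg (1 * [:0, 1:]) (F (Suc k)) s z) (at s)"
    by (rule gauss_avg_deriv_s[where K = K]) (use F k s in \<open>auto simp: deriv_chain_def\<close>)
  moreover have "s * gauss_avg 1 (F (Suc (Suc k))) s z = gauss_avg (herm_step 1) (F (Suc k)) s z"
    by (rule gauss_avg_by_parts[of _ _ K]) (use F k s in \<open>auto simp: deriv_chain_def\<close>)
  moreover have "herm_step 1 = 1 * [:0, 1:]" by (simp add: herm_step_def)
  ultimately have "((\<lambda>s. gauss_avg 1 (F k) s z) has_real_derivative s * gauss_avg 1 (F (Suc (Suc k))) s z) (at (sqrt (2 * t)))"
    by (simp add: s_def)
  then have "((\<lambda>t. gauss_avg 1 (F k) (sqrt (2 * t)) z) has_real_derivative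
      s * gauss_avg 1 (F (Suc (Suc k))) s z * (1 / s)) (at t)"
  proof (rule DERIV_chain'[rotated])
    show "((\<lambda>t. sqrt (2 * t)) has_real_derivative 1 / s) (at t)"
      using t by (auto intro!: derivative_eq_intros simp: s_def field_simps)
  qed
  then show ?thesis using s unfolding heat_evol_def s_def by simp
qed

text \<open>Order 5 is included although \<open>F 5\<close> jumps: for \<open>z > 0\<close> the
  argument almost never hits 0, even at width 0. This continuity turns the classical second
  derivative into a weak one.\<close>

lemma heat_evol_continuous_z:
  assumes F: "deriv_chain K F" and k: "k \<le> 5"
  shows "continuous_on {0<..} (heat_evol F k t)"
proof (intro continuous_at_imp_continuous_on ballI)
  fix z :: real assume z: "z \<in> {0<..}"
  have ic: "isCont (F k) y" if "y \<noteq> 0" for y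
  proof (cases "k = 5")
    case True
    then show ?thesis using F piecewise_deriv_isCont(2)[of "F 4" "F 5" y] that
      by (auto simp: deriv_chain_def eval_nat_numeral)
  next
    case False
    then show ?thesis using F k piecewise_deriv_isCont(1)[of "F k" "F (Suc k)" y] by (auto simp: deriv_chain_def)
  qed
  show "isCont (heat_evol F k t) z"
    unfolding continuous_at_sequentially o_def heat_evol_def
  proof (intro allI impI)
    fix Z assume Z: "Z \<longlonglongrightarrow> z"
    show "(\<lambda>n. gauss_avg 1 (F k) (sqrt (2 * t)) (Z n)) \<longlonglongrightarrow> gauss_avg 1 (F k) (sqrt (2 * t)) z"
    proof (rule gauss_avg_tendsto[where K = K])
      show "AE x in lborel. isCont (F k) (z + sqrt (2 * t) * x)"
      proof -
        have "AE x in lborel. z + sqrt (2 * t) * x \<noteq> 0" by (rule AE_affine_nonzero) (use z in simp)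
        then show ?thesis by eventually_elim (rule ic)
      qed
    qed (use F k Z deriv_chain_measurable in \<open>auto simp: deriv_chain_def\<close>)
  qed
qed

lemma heat_evol_continuous:
  assumes F: "deriv_chain K F" and k: "k < 5"
  shows "continuous_on S (\<lambda>(t, z). heat_evol F k t z)"
  unfolding continuous_on_sequentially
proof (intro ballI allI impI)
  fix X a assume X: "(\<forall>n. X n \<in> S) \<and> X \<longlonglongrightarrow> (a :: real \<times> real)"
  then have lim: "(\<lambda>n. fst (X n)) \<longlonglongrightarrow> fst a" "(\<lambda>n. snd (X n)) \<longlonglongrightarrow> snd a" by (auto intro: tendsto_intros)
  have "(\<lambda>n. gauss_avg 1 (F k) (sqrt (2 * fst (X n))) (snd (X n))) \<longlonglongrightarrow> gauss_avg 1 (F k) (sqrt (2 * fst a)) (snd a)"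
  proof (rule gauss_avg_tendsto[where K = K])
    show "AE x in lborel. isCont (F k) (snd a + sqrt (2 * fst a) * x)"
      using F k piecewise_deriv_isCont(1)[of "F k" "F (Suc k)"] by (auto simp: deriv_chain_def)
  qed (use F k deriv_chain_measurable in \<open>auto simp: deriv_chain_def intro!: tendsto_intros lim\<close>)
  then show "((\<lambda>(t, z). heat_evol F k t z) \<circ> X) \<longlonglongrightarrow> (\<lambda>(t, z). heat_evol F k t z) a"
    by (simp add: heat_evol_def o_def case_prod_unfold)
qed

lemma heat_evol_bound:
  assumes "deriv_chain K F" "k \<le> 5"
  shows "\<bar>heat_evol F k t z\<bar> \<le> K * gauss_abs 1"
  unfolding heat_evol_def
  by (rule gauss_avg_bound) (use assms deriv_chain_measurable in \<open>auto simp: deriv_chain_def\<close>)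

lemma heat_evol_bound_mult:
  assumes "deriv_chain K F" "k \<le> 5" "t \<ge> 0"
  shows "\<bar>z * heat_evol F k t z\<bar> \<le> K * (gauss_abs 1 + sqrt (2 * t) * gauss_abs [:0, 1:])"
  using gauss_avg_bound_mult[of "F k" K "sqrt (2 * t)" z 1] assms deriv_chain_measurable[OF assms(1,2)]
  unfolding heat_evol_def by (simp add: deriv_chain_def)

lemma heat_evol_large_time:
  assumes F: "deriv_chain K F" and k: "k \<le> 5" and t: "t > 0"
  shows "sqrt (2 * t) ^ k * \<bar>heat_evol F k t z\<bar> \<le> K * gauss_abs ((herm_step ^^ k) 1)"
    and "sqrt (2 * t) ^ k * \<bar>z * heat_evol F k t z\<bar>
      \<le> K * (gauss_abs ((herm_step ^^ k) 1) + sqrt (2 * t) * gauss_abs ([:0, 1:] * (herm_step ^^ k) 1))"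
proof -
  define s where "s = sqrt (2 * t)"
  have s: "s > 0" using t by (simp add: s_def)
  have e: "s ^ k * heat_evol F k t z = gauss_avg ((herm_step ^^ k) 1) (F 0) s z"
    unfolding heat_evol_def s_def[symmetric] by (rule deriv_chain_by_parts[OF F k]) (use s in simp)
  have m: "F 0 \<in> borel_measurable borel" using deriv_chain_measurable[OF F, of 0] by simp
  have b: "\<bar>F 0 x\<bar> \<le> K" "\<bar>x * F 0 x\<bar> \<le> K" for x using F by (auto simp: deriv_chain_def)
  have "s ^ k * \<bar>heat_evol F k t z\<bar> = \<bar>s ^ k * heat_evol F k t z\<bar>" using s by (simp add: abs_mult)
  then show "sqrt (2 * t) ^ k * \<bar>heat_evol F k t z\<bar> \<le> K * gauss_abs ((herm_step ^^ k) 1)"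
    unfolding e s_def[symmetric] using gauss_avg_bound[OF m b(1)] by simp
  have "s ^ k * \<bar>z * heat_evol F k t z\<bar> = \<bar>z * (s ^ k * heat_evol F k t z)\<bar>" using s by (simp add: abs_mult)
  then show "sqrt (2 * t) ^ k * \<bar>z * heat_evol F k t z\<bar>
      \<le> K * (gauss_abs ((herm_step ^^ k) 1) + sqrt (2 * t) * gauss_abs ([:0, 1:] * (herm_step ^^ k) 1))"
    unfolding e s_def[symmetric] using gauss_avg_bound_mult[OF m b, of s] s by simp
qed

text \<open>A sum simply because it dominates each summand: order 0 serves small times, orders 4 and
  5 serve large times, each with and without the factor from the weight \<open>z\<close>.\<close>

definition rate_const :: real where
  "rate_const = gauss_abs 1 + gauss_abs [:0, 1:]
     + gauss_abs ((herm_step ^^ 4) 1) + gauss_abs ([:0, 1:] * (herm_step ^^ 4) 1)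
     + gauss_abs ((herm_step ^^ 5) 1) + gauss_abs ([:0, 1:] * (herm_step ^^ 5) 1)"

text \<open>Split at \<open>t = 1\<close>. The constant is 12 = 3 * 4: for small times
  \<open>s \<le> 2\<close> bounds everything by three times \<open>rate_const * K\<close>, and the
  decay factor is at least 1 / 4. For large times a factor 2 would do.\<close>

lemma heat_evol_rate:
  assumes F: "deriv_chain K F" and t: "t \<ge> 0"
  shows "\<bar>heat_evol F 4 t z\<bar> \<le> 12 * rate_const * K * (1 + t) powr (- 3 / 2)"
    and "\<bar>z * heat_evol F 4 t z\<bar> \<le> 12 * rate_const * K * (1 + t) powr (- 3 / 2)"
    and "\<bar>z * heat_evol F 5 t z\<bar> \<le> 12 * rate_const * K * (1 + t) powr (- 3 / 2)"
proof -
  define A where "A = rate_const"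
  define s where "s = sqrt (2 * t)"
  define P where "P = (1 + t) powr (- 3 / 2)"
  have "\<bar>F 0 0\<bar> \<le> K" using F by (simp add: deriv_chain_def)
  then have K: "K \<ge> 0" by linarith
  note nn = gauss_abs_nonneg
  have A: "gauss_abs 1 \<le> A" "gauss_abs [:0, 1:] \<le> A"
     "gauss_abs ((herm_step ^^ 4) 1) \<le> A" "gauss_abs ([:0, 1:] * (herm_step ^^ 4) 1) \<le> A"
     "gauss_abs ((herm_step ^^ 5) 1) \<le> A" "gauss_abs ([:0, 1:] * (herm_step ^^ 5) 1) \<le> A"
    using nn[of 1] nn[of "[:0, 1:]"] nn[of "(herm_step ^^ 4) 1"] nn[of "[:0, 1:] * (herm_step ^^ 4) 1"]
      nn[of "(herm_step ^^ 5) 1"] nn[of "[:0, 1:] * (herm_step ^^ 5) 1"]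
    unfolding A_def rate_const_def by linarith+
  have A0: "A \<ge> 0" using A(1) nn[of 1] by linarith
  have "\<bar>heat_evol F 4 t z\<bar> \<le> 12 * A * K * P \<and> \<bar>z * heat_evol F 4 t z\<bar> \<le> 12 * A * K * P \<and> \<bar>z * heat_evol F 5 t z\<bar> \<le> 12 * A * K * P"
  proof (cases "t \<le> 1")
    case True
    have "sqrt (2 * t) \<le> sqrt 4" using True by (intro real_sqrt_le_mono) simp
    then have s: "0 \<le> s" "s \<le> 2" using t by (auto simp: s_def)
    have "(1 / 4 :: real) = 2 powr (- 2)" by (simp add: powr_minus)
    also have "\<dots> \<le> 2 powr (- 3 / 2)" by (rule powr_mono) auto
    also have "\<dots> \<le> P" unfolding P_def by (rule powr_mono2') (use t True in auto)
    finally have "12 * A * K * (1 / 4) \<le> 12 * A * K * P" using A0 K by (intro mult_left_mono) auto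
    then have P: "3 * (A * K) \<le> 12 * A * K * P" by simp
    have AK: "A * K \<ge> 0" using A0 K by simp
    have 1: "K * gauss_abs 1 \<le> A * K" using mult_right_mono[OF A(1) K] by (simp add: mult.commute)
    have "gauss_abs 1 + s * gauss_abs [:0, 1:] \<le> A + 2 * A"
      using s A(1,2) nn by (intro add_mono mult_mono) auto
    from mult_left_mono[OF this K]
    have 2: "K * (gauss_abs 1 + s * gauss_abs [:0, 1:]) \<le> 3 * (A * K)"
      by (simp add: algebra_simps)
    show ?thesis
    proof (intro conjI)
      have "\<bar>heat_evol F 4 t z\<bar> \<le> K * gauss_abs 1" by (rule heat_evol_bound[OF F]) simp
      then show "\<bar>heat_evol F 4 t z\<bar> \<le> 12 * A * K * P" using 1 P AK by linarith
      have "\<bar>z * heat_evol F k t z\<bar> \<le> 3 * (A * K)" if "k \<le> 5" for k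
        using heat_evol_bound_mult[OF F that t, of z] 2 unfolding s_def by linarith
      from this[of 4] this[of 5] P
      show "\<bar>z * heat_evol F 4 t z\<bar> \<le> 12 * A * K * P" "\<bar>z * heat_evol F 5 t z\<bar> \<le> 12 * A * K * P"
        by simp_all
    qed
  next
    case False
    have s1: "s \<ge> 1" using False by (simp add: s_def)
    \<comment> \<open>Here \<open>t > 1\<close> gives \<open>2 * t \<ge> 1 + t\<close>, which
      converts powers of \<open>s\<close> into powers of \<open>1 + t\<close>.\<close>
    have "s ^ 3 = (2 * t) powr (3 / 2)"
      using t False by (simp add: s_def powr_half_sqrt[symmetric] powr_power)
    also have "\<dots> \<ge> (1 + t) powr (3 / 2)" using False by (intro powr_mono2) auto
    finally have s3: "(1 + t) powr (3 / 2) \<le> s ^ 3" .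
    have P: "P = 1 / (1 + t) powr (3 / 2)" 
      using powr_minus_divide[of "1 + t" "3 / 2"] by (simp only: P_def minus_divide_left)
    have "1 / s ^ 3 \<le> P" unfolding P using s3 t s1 by (intro divide_left_mono) auto
    then have s3P: "1 \<le> P * s ^ 3" using s1 by (simp add: divide_le_eq)
    have P0: "P \<ge> 0" by (simp add: P_def)
    \<comment> \<open>One estimate for all three quantities. Since \<open>s \<ge> 1\<close>, order 5
      may be weakened to order 4 and \<open>a\<close> to \<open>s * A\<close>; what remains is
      \<open>s\<close> against \<open>s ^ 4\<close>, that is \<open>s ^ (- 3)\<close>.\<close>
    have fin: "y \<le> 12 * A * K * P" if y: "s ^ k * y \<le> K * (a + s * b)" "y \<ge> 0" and ab: "a \<le> A" "b \<le> A" and k: "k \<ge> 4" for y a b k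
    proof -
      have "s ^ 4 * y \<le> s ^ k * y" using s1 k y(2) by (intro mult_right_mono power_increasing) auto
      also have "\<dots> \<le> K * (a + s * b)" by (rule y)
      also have "\<dots> \<le> K * (s * A + s * A)"
      proof (intro mult_left_mono add_mono K)
        have "1 * A \<le> s * A" using s1 A0 by (intro mult_right_mono) auto
        then show "a \<le> s * A" using ab by linarith
      qed (use s1 ab in auto)
      also have "\<dots> = s * (2 * K * A)" by simp
      also have "\<dots> \<le> s * (2 * K * A * (P * s ^ 3))"
        using mult_left_mono[OF s3P, of "2 * K * A"] K A0 s1 by (intro mult_left_mono) auto
      also have "\<dots> = s ^ 4 * (2 * K * A * P)" by (simp add: eval_nat_numeral)
      finally have "y \<le> 2 * K * A * P" using s1 by simp
      also have "\<dots> \<le> 12 * A * K * P" using K A0 P0 by (simp add: mult_right_mono)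
      finally show ?thesis .
    qed
    have t0: "t > 0" using False by simp
    note L4 = heat_evol_large_time[OF F _ t0, of 4 z, folded s_def]
    note L5 = heat_evol_large_time[OF F _ t0, of 5 z, folded s_def]
    show ?thesis
    proof (intro conjI)
      show "\<bar>heat_evol F 4 t z\<bar> \<le> 12 * A * K * P"
        by (rule fin[of 4 _ "gauss_abs ((herm_step ^^ 4) 1)" 0]) (use L4(1) A A0 in auto)
      show "\<bar>z * heat_evol F 4 t z\<bar> \<le> 12 * A * K * P"
        by (rule fin[OF L4(2)]) (use A in auto)
      show "\<bar>z * heat_evol F 5 t z\<bar> \<le> 12 * A * K * P"
        by (rule fin[OF L5(2)]) (use A in auto)
    qed
  qed
  then show "\<bar>heat_evol F 4 t z\<bar> \<le> 12 * rate_const * K * (1 + t) powr (- 3 / 2)"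
    "\<bar>z * heat_evol F 4 t z\<bar> \<le> 12 * rate_const * K * (1 + t) powr (- 3 / 2)"
    "\<bar>z * heat_evol F 5 t z\<bar> \<le> 12 * rate_const * K * (1 + t) powr (- 3 / 2)"
    unfolding A_def P_def by auto
qed

section \<open>The maximum principle\<close>

text \<open>On the unbounded strip a maximum need not exist, so the argument runs on
  \<open>z \<le> R\<close>, with \<open>K\<close> controlling the artificial boundary. At a positive
  maximum the time derivative of \<open>v\<close> is at least 0 and the second space derivative at
  most 0; the common value \<open>a\<close> in \<open>heat\<close> makes these incompatible.\<close>

lemma heat_max_principle:
  fixes D :: "real \<Rightarrow> real \<Rightarrow> real"
  assumes cont: "continuous_on ({0..} \<times> {0..}) (\<lambda>(t, z). D t z)"
    and heat: "\<And>t z. t > 0 \<Longrightarrow> z > 0 \<Longrightarrow> \<exists>a g. ((\<lambda>s. D s z) has_real_derivative a) (at t) \<and>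
       (\<forall>y>0. (D t has_real_derivative g y) (at y)) \<and> (g has_real_derivative a) (at z)"
    and init: "\<And>z. z \<ge> 0 \<Longrightarrow> D 0 z \<le> 0" and bc: "\<And>t. t \<ge> 0 \<Longrightarrow> D t 0 \<le> 0"
    and bound: "\<And>t z. 0 \<le> t \<Longrightarrow> t \<le> T \<Longrightarrow> z \<ge> 0 \<Longrightarrow> D t z \<le> K"
    and T: "T \<ge> 0" and z0: "z0 \<ge> 0" and K: "K \<ge> 0"
  shows "D T z0 \<le> 0"
proof -
  have est: "D T z0 \<le> K * (z0\<^sup>2 + 2 * T) / R\<^sup>2 + \<delta> * T" if R: "R > z0" and \<delta>: "\<delta> > 0" for R \<delta>
  proof -
    \<comment> \<open>The caloric function \<open>z\<^sup>2 + 2 t\<close>, scaled by \<open>K / R\<^sup>2\<close>, dominates \<open>D\<close> at \<open>z = R\<close>; \<open>\<delta> t\<close> makes the inequality strict.\<close>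
    define v where "v t z = D t z - K * (z\<^sup>2 + 2 * t) / R\<^sup>2 - \<delta> * t" for t z
    have R0: "R > 0" using R z0 by simp
    let ?Q = "{0..T} \<times> {0..R}"
    have "continuous_on ?Q (\<lambda>(t, z). D t z)" by (rule continuous_on_subset[OF cont]) auto
    then have "continuous_on ?Q (\<lambda>p. D (fst p) (snd p))" by (simp add: case_prod_unfold)
    then have "continuous_on ?Q (\<lambda>p. v (fst p) (snd p))"
      unfolding v_def using R0 by (auto intro!: continuous_intros)
    moreover have "compact ?Q" "?Q \<noteq> {}" using T R0 by (auto intro: compact_Times)
    ultimately obtain p where p: "p \<in> ?Q" "\<And>q. q \<in> ?Q \<Longrightarrow> v (fst q) (snd q) \<le> v (fst p) (snd p)"
      using continuous_attains_sup by (metis (no_types, lifting))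
    define t1 where "t1 = fst p"
    define z1 where "z1 = snd p"
    have tz: "0 \<le> t1" "t1 \<le> T" "0 \<le> z1" "z1 \<le> R" using p(1) by (auto simp: t1_def z1_def)
    have max: "v t z \<le> v t1 z1" if "0 \<le> t" "t \<le> T" "0 \<le> z" "z \<le> R" for t z
      using p(2)[of "(t, z)"] that by (simp add: t1_def z1_def)
    have "v t1 z1 \<le> 0"
    proof (rule ccontr)
      assume "\<not> v t1 z1 \<le> 0"
      then have pos: "v t1 z1 > 0" by simp
      have nn: "K * (z1\<^sup>2 + 2 * t1) / R\<^sup>2 \<ge> 0" "\<delta> * t1 \<ge> 0" using K tz \<delta> by auto
      have Dpos: "D t1 z1 > 0" using pos nn by (simp add: v_def)
      have t1: "t1 > 0" using Dpos init[of z1] tz by (cases "t1 = 0") auto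
      have z1: "z1 > 0" using Dpos bc[of t1] tz by (cases "z1 = 0") auto
      have zR: "z1 < R"
      proof (rule ccontr)
        assume "\<not> z1 < R"
        then have "z1 = R" using tz by simp
        then have "K * (z1\<^sup>2 + 2 * t1) / R\<^sup>2 = K + K * (2 * t1) / R\<^sup>2" using R0 by (simp add: field_simps)
        moreover have "K * (2 * t1) / R\<^sup>2 \<ge> 0" using K tz by simp
        ultimately have "v t1 z1 \<le> D t1 z1 - K" using nn by (simp add: v_def)
        then show False using pos bound[of t1 z1] tz by simp
      qed
      obtain a g where a: "((\<lambda>s. D s z1) has_real_derivative a) (at t1)"
        and g: "\<And>y. y > 0 \<Longrightarrow> (D t1 has_real_derivative g y) (at y)" and ga: "(g has_real_derivative a) (at z1)"
        using heat[OF t1 z1] by blast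
      have vt: "((\<lambda>s. v s z1) has_real_derivative a - K * 2 / R\<^sup>2 - \<delta>) (at t1)"
        unfolding v_def using R0
        by (auto intro!: derivative_eq_intros a simp: power2_eq_square power4_eq_xxxx divide_simps)
      \<comment> \<open>Only earlier times are compared, since the maximum may be attained at
        \<open>t1 = T\<close>.\<close>
      have "a - K * 2 / R\<^sup>2 - \<delta> \<ge> 0"
      proof (rule ccontr)
        assume "\<not> ?thesis"
        then obtain d where d: "d > 0" "\<forall>h>0. h < d \<longrightarrow> v t1 z1 < v (t1 - h) z1"
          using DERIV_neg_dec_left[OF vt] by auto
        define h where "h = min (d / 2) t1"
        have "h > 0" "h < d" "h \<le> t1" using d(1) t1 by (auto simp: h_def)
        then show False using d(2)[rule_format, of h] max[of "t1 - h" z1] tz by auto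
      qed
      then have pa: "a - K * 2 / R\<^sup>2 > 0" using \<delta> by simp
      define w where "w y = g y - K * (2 * y) / R\<^sup>2" for y
      have vz: "(v t1 has_real_derivative w y) (at y)" if "y > 0" for y
      proof -
        have "((\<lambda>z. D t1 z - K * (z\<^sup>2 + 2 * t1) / R\<^sup>2 - \<delta> * t1) has_real_derivative w y) (at y)"
          unfolding w_def using R0 by (auto intro!: derivative_eq_intros g that
            simp: power2_eq_square power4_eq_xxxx divide_simps)
        then show ?thesis by (simp add: v_def[abs_def])
      qed
      have wd: "(w has_real_derivative a - K * 2 / R\<^sup>2) (at z1)"
        unfolding w_def using R0
        by (auto intro!: derivative_eq_intros ga simp: power2_eq_square power4_eq_xxxx divide_simps)
      have w0: "w z1 = 0"
      proof (rule DERIV_local_max[OF vz[OF z1]])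
        show "0 < min z1 (R - z1)" using z1 zR by simp
        show "\<forall>y. \<bar>z1 - y\<bar> < min z1 (R - z1) \<longrightarrow> v t1 y \<le> v t1 z1"
          using max[of t1] tz by auto
      qed
      \<comment> \<open>A positive derivative of \<open>w\<close> at its zero \<open>z1\<close>
        makes \<open>v t1\<close> grow to the right of \<open>z1\<close>, against
        maximality.\<close>
      obtain d where d: "d > 0" "\<forall>h>0. h < d \<longrightarrow> w z1 < w (z1 + h)"
        using DERIV_pos_inc_right[OF wd pa] by blast
      define h where "h = min (d / 2) (R - z1)"
      have h: "h > 0" "h < d" "z1 + h \<le> R" using d(1) zR by (auto simp: h_def)
      have "\<exists>\<xi>. z1 < \<xi> \<and> \<xi> < z1 + h \<and> v t1 (z1 + h) - v t1 z1 = (z1 + h - z1) * w \<xi>"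
        by (rule MVT2) (use h z1 vz in auto)
      then obtain \<xi> where \<xi>: "z1 < \<xi>" "\<xi> < z1 + h" "v t1 (z1 + h) - v t1 z1 = h * w \<xi>" by auto
      have "w \<xi> > 0" using d(2)[rule_format, of "\<xi> - z1"] \<xi> h w0 by simp
      then have "h * w \<xi> > 0" using h by simp
      then show False using \<xi>(3) max[of t1 "z1 + h"] tz h by simp
    qed
    moreover have "v T z0 \<le> v t1 z1" by (rule max) (use T z0 R in auto)
    ultimately show ?thesis by (simp add: v_def)
  qed
  show ?thesis
  proof (rule ccontr)
    assume "\<not> D T z0 \<le> 0"
    then have pos: "D T z0 > 0" by simp
    define C where "C = K * (z0\<^sup>2 + 2 * T) + T"
    have C: "C \<ge> 0" using K T by (simp add: C_def)
    \<comment> \<open>With \<open>\<delta> = 1 / R\<close> and \<open>R \<ge> 1\<close> the estimate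
      gives \<open>D T z0 * R \<le> C\<close>; this \<open>R\<close> makes the left side exceed
      \<open>C\<close> by \<open>D T z0 * (z0 + 1)\<close>.\<close>
    define R where "R = z0 + 1 + C / D T z0"
    have R: "R > z0" "R \<ge> 1" using z0 C pos by (auto simp: R_def add_pos_nonneg)
    have "D T z0 \<le> K * (z0\<^sup>2 + 2 * T) / R\<^sup>2 + 1 / R * T"
      by (rule est) (use R in auto)
    also have "K * (z0\<^sup>2 + 2 * T) / R\<^sup>2 \<le> K * (z0\<^sup>2 + 2 * T) / R"
      using R K T by (intro divide_left_mono) (auto simp: power2_eq_square)
    also have "K * (z0\<^sup>2 + 2 * T) / R + 1 / R * T = C / R" by (simp add: C_def add_divide_distrib)
    finally have "D T z0 * R \<le> C" using R by (simp add: field_simps)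
    moreover have "D T z0 * R = D T z0 * (z0 + 1) + C" using pos by (simp add: R_def field_simps)
    moreover have "D T z0 * (z0 + 1) > 0" using pos z0 by simp
    ultimately show False by linarith
  qed
qed

section \<open>Decay of solutions\<close>

lemma LinfI:
  assumes m: "(\<lambda>x. indicator {0<..} x * h x) \<in> borel_measurable lebesgue"
    and AE: "AE x in lebesgue. x > 0 \<longrightarrow> \<bar>h x\<bar> \<le> B" and B: "B \<ge> 0"
  shows "h \<in> Linf" "\<bar>Linf_norm h\<bar> \<le> B"
proof -
  let ?M = "lebesgue_on {0::real<..}"
  let ?e = "esssup ?M (\<lambda>z. ereal \<bar>h z\<bar>)"
  have hm: "h \<in> borel_measurable ?M"
    using m by (subst borel_measurable_restrict_space_iff) auto
  then have em: "(\<lambda>z. ereal \<bar>h z\<bar>) \<in> borel_measurable ?M" by measurable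
  have le: "?e \<le> ereal B"
    by (rule esssup_I[OF em]) (use AE in \<open>auto simp: AE_restrict_space_iff\<close>)
  \<comment> \<open>A negative essential supremum of an absolute value would make the half line a
    null set.\<close>
  have ge: "?e \<ge> 0"
  proof (rule ccontr)
    assume "\<not> ?e \<ge> 0"
    have "AE x in ?M. ereal \<bar>h x\<bar> \<le> ?e" by (rule esssup_AE)
    then have "AE x in ?M. False"
    proof eventually_elim
      case (elim x)
      have "0 \<le> ereal \<bar>h x\<bar>" by simp
      then show ?case using elim \<open>\<not> ?e \<ge> 0\<close> order_trans by blast
    qed
    then have "AE x in lebesgue. \<not> (x > (0::real))" by (simp add: AE_restrict_space_iff)
    then obtain N where "N \<in> null_sets lebesgue" "{x. x > (0::real)} \<subseteq> N"
      unfolding eventually_ae_filter by auto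
    then have "negligible {x. x > (0::real)}" using negligible_iff_null_sets negligible_subset by blast
    moreover have "\<not> negligible {x. x > (0::real)}"
      by (rule open_not_negligible) (auto simp: open_Collect_less intro: exI[of _ 1])
    ultimately show False by blast
  qed
  show "h \<in> Linf" unfolding Linf_def using hm le by (auto intro: le_less_trans)
  show "\<bar>Linf_norm h\<bar> \<le> B" unfolding Linf_norm_def using le ge B by (cases ?e) auto
qed

text \<open>Both signs of the difference fall under the maximum principle. The bound may depend on
  \<open>T\<close>, because each application stays within a strip of finite height.\<close>

lemma heat_solution_unique:
  assumes sol: "heat_solution U0 U" and F: "deriv_chain K F" and odd: "\<And>x. F 3 (- x) = - F 3 x"
    and init: "\<And>z. z \<ge> 0 \<Longrightarrow> F 3 z = U0 z"
    and bound: "\<And>T. T \<ge> 0 \<Longrightarrow> \<exists>B. \<forall>t z. 0 \<le> t \<longrightarrow> t \<le> T \<longrightarrow> z \<ge> 0 \<longrightarrow> \<bar>U t z\<bar> \<le> B"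
    and tz: "t \<ge> 0" "z \<ge> 0"
  shows "U t z = heat_evol F 3 t z"
proof -
  let ?u = "heat_evol F 3"
  have cont: "continuous_on ({0..} \<times> {0..}) (\<lambda>(t, z). U t z)" "continuous_on ({0..} \<times> {0..}) (\<lambda>(t, z). ?u t z)"
    using sol heat_evol_continuous[OF F, of 3] by (auto simp: heat_solution_def)
  obtain B where B: "\<And>s y. 0 \<le> s \<Longrightarrow> s \<le> t \<Longrightarrow> y \<ge> 0 \<Longrightarrow> \<bar>U s y\<bar> \<le> B" using bound[OF tz(1)] by blast
  define C where "C = B + K * gauss_abs 1"
  have C: "\<bar>U s y - ?u s y\<bar> \<le> C" if "0 \<le> s" "s \<le> t" "y \<ge> 0" for s y
    using B[OF that] heat_evol_bound[OF F, of 3 s y] by (simp add: C_def)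
  have C0: "C \<ge> 0" using C[of 0 0] tz by simp
  have zero: "U 0 y - ?u 0 y = 0" if "y \<ge> 0" for y
    using sol init that by (simp add: heat_solution_def heat_evol_def gauss_avg_zero_width)
  have bc: "U s 0 - ?u s 0 = 0" if "s \<ge> 0" for s
    using sol that gauss_avg_odd_function[of "F 3", OF odd] by (simp add: heat_solution_def heat_evol_def)
  have heat: "\<exists>a g. ((\<lambda>s. U s y - ?u s y) has_real_derivative a) (at s) \<and>
       (\<forall>y>0. ((\<lambda>y. U s y - ?u s y) has_real_derivative g y) (at y)) \<and> (g has_real_derivative a) (at y)"
    if s: "s > 0" and y: "y > 0" for s y
  proof -
    define a where "a = deriv (\<lambda>s. U s y) s"
    have *: "(\<lambda>r. U r x) differentiable (at s)" "U s differentiable (at x)" "deriv (U s) differentiable (at x)"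
      "deriv (\<lambda>r. U r x) s = deriv (deriv (U s)) x" if "x > 0" for x
      using sol s that by (auto simp: heat_solution_def)
    have "((\<lambda>r. U r y) has_real_derivative a) (at s)"
      "\<And>x. x > 0 \<Longrightarrow> (U s has_real_derivative deriv (U s) x) (at x)"
      "(deriv (U s) has_real_derivative a) (at y)"
      unfolding a_def using * y by (simp_all add: DERIV_deriv_iff_real_differentiable[symmetric])
    \<comment> \<open>The time derivative moves two steps up the chain, from index 3 to 5, just as
      two space derivatives do.\<close>
    moreover have "((\<lambda>r. ?u r y) has_real_derivative heat_evol F 5 s y) (at s)"
      using heat_evol_deriv_t[OF F _ s, of 3 y] by (simp add: eval_nat_numeral)
    moreover have "(?u s has_real_derivative heat_evol F 4 s x) (at x)" if "x > 0" for x
      using heat_evol_deriv_z[OF F _ that, of 3 s] by (simp add: eval_nat_numeral)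
    moreover have "(heat_evol F 4 s has_real_derivative heat_evol F 5 s y) (at y)"
      using heat_evol_deriv_z[OF F _ y, of 4 s] by (simp add: eval_nat_numeral)
    ultimately show ?thesis
      by (intro exI[of _ "a - heat_evol F 5 s y"] exI[of _ "\<lambda>x. deriv (U s) x - heat_evol F 4 s x"])
        (auto intro: DERIV_diff)
  qed
  have "U t z - ?u t z \<le> 0"
  proof (rule heat_max_principle[where D = "\<lambda>t z. U t z - ?u t z" and K = C, OF _ heat])
    show "continuous_on ({0..} \<times> {0..}) (\<lambda>(t, z). U t z - ?u t z)"
      using continuous_on_diff[OF cont] by (simp add: case_prod_unfold)
    show "U s y - ?u s y \<le> C" if "0 \<le> s" "s \<le> t" "0 \<le> y" for s y using C[OF that] by simp
  qed (use zero bc tz C0 in auto)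
  moreover have "- (U t z - ?u t z) \<le> 0"
  proof (rule heat_max_principle[where D = "\<lambda>t z. - (U t z - ?u t z)" and K = C])
    show "continuous_on ({0..} \<times> {0..}) (\<lambda>(t, z). - (U t z - ?u t z))"
      using continuous_on_minus[OF continuous_on_diff[OF cont]] by (simp add: case_prod_unfold)
    show "- (U s y - ?u s y) \<le> C" if "0 \<le> s" "s \<le> t" "0 \<le> y" for s y using C[OF that] by simp
    show "\<exists>a g. ((\<lambda>s. - (U s y - ?u s y)) has_real_derivative a) (at s) \<and>
       (\<forall>y>0. ((\<lambda>y. - (U s y - ?u s y)) has_real_derivative g y) (at y)) \<and> (g has_real_derivative a) (at y)"
      if sy: "s > 0" "y > 0" for s y
    proof -
      obtain a g where "((\<lambda>s. U s y - ?u s y) has_real_derivative a) (at s)"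
       "\<forall>y>0. ((\<lambda>y. U s y - ?u s y) has_real_derivative g y) (at y)" "(g has_real_derivative a) (at y)"
        using heat[OF sy] by blast
      then show ?thesis by (intro exI[of _ "- a"] exI[of _ "\<lambda>x. - g x"] conjI allI impI DERIV_minus) auto
    qed
  qed (use zero bc tz C0 in auto)
  ultimately show ?thesis by simp
qed

lemma heat_solution_decay:
  assumes U0: "U0 \<in> Sobolev 3 \<mu>_in" "U0 0 = 0" and \<epsilon>: "Sobolev_norm 3 \<mu>_in U0 \<le> \<epsilon>" "\<epsilon> > 0"
    and moment: "(LINT z:{0<..}|lebesgue. z * U0 z) = 0"
    and sol: "heat_solution U0 U" and S: "\<And>t. t \<ge> 0 \<Longrightarrow> U t \<in> Sobolev 3 (\<mu> t)"
    and M: "\<And>t. t \<ge> 0 \<Longrightarrow> Sobolev_norm 3 (\<mu> t) (U t) \<le> M" and t: "t \<ge> 0"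
  defines "B \<equiv> 12 * rate_const * (decay_const * \<epsilon>) * (1 + t) powr (- 3 / 2)"
  shows "weak_deriv 1 (U t) \<in> Linf" "\<bar>Linf_norm (weak_deriv 1 (U t))\<bar> \<le> B"
    and "(\<lambda>z. z * weak_deriv 1 (U t) z) \<in> Linf" "\<bar>Linf_norm (\<lambda>z. z * weak_deriv 1 (U t) z)\<bar> \<le> B"
    and "(\<lambda>z. z * weak_deriv 2 (U t) z) \<in> Linf" "\<bar>Linf_norm (\<lambda>z. z * weak_deriv 2 (U t) z)\<bar> \<le> B"
proof -
  have Uc: "continuous_on {0..} (U s)" if "s \<ge> 0" for s
  proof -
    have c: "continuous_on ({0..} \<times> {0..}) (\<lambda>(t, z). U t z)" using sol by (simp add: heat_solution_def)
    have "continuous_on {0..} (\<lambda>z. case (s, z) of (t, z) \<Rightarrow> U t z)"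
      by (rule continuous_on_compose2[OF c]) (use that in \<open>auto intro!: continuous_intros\<close>)
    then show ?thesis by simp
  qed
  have U0c: "continuous_on {0..} U0"
    by (rule continuous_on_eq[OF Uc[of 0]]) (use sol in \<open>auto simp: heat_solution_def\<close>)
  obtain f :: "nat \<Rightarrow> real \<Rightarrow> real" where f0:
    "(\<forall>k\<le>5. continuous_on {0..} (f k)) \<and>
     (\<forall>k\<le>5. \<forall>z\<ge>0. \<bar>f k z\<bar> \<le> decay_const * \<epsilon> * exp (- z)) \<and>
     (\<forall>k<5. \<forall>z>0. (f k has_real_derivative f (Suc k) z) (at z)) \<and>
     f 1 0 = 0 \<and> f 3 0 = 0 \<and> (\<forall>z\<ge>0. f 3 z = U0 z)"
    using initial_data_chain[OF U0(1) U0c U0(2) \<epsilon> moment] by (rule exE)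
  have f: "\<And>k. k \<le> 5 \<Longrightarrow> continuous_on {0..} (f k)"
    "\<And>k z. k \<le> 5 \<Longrightarrow> z \<ge> 0 \<Longrightarrow> \<bar>f k z\<bar> \<le> decay_const * \<epsilon> * exp (- z)"
    "\<And>k z. k < 5 \<Longrightarrow> z > 0 \<Longrightarrow> (f k has_real_derivative f (Suc k) z) (at z)"
    "f 1 0 = 0" "f 3 0 = 0" "\<And>z. z \<ge> 0 \<Longrightarrow> f 3 z = U0 z"
    using f0 by simp_all
  define F where "F k = parity_ext k (f k)" for k
  define K where "K = decay_const * \<epsilon>"
  have F: "deriv_chain K F"
    unfolding deriv_chain_def
  proof (intro conjI allI impI)
    show "piecewise_deriv (F k) (F (Suc k))" if "k < 5" for k
      unfolding F_def
    proof (rule piecewise_deriv_parity_ext)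
      assume "odd k"
      then have "k = 1 \<or> k = 3" using that by presburger
      then show "f k 0 = 0" using f(4,5) by auto
    qed (use f(1,3) that in auto)
    show "\<bar>F k x\<bar> \<le> K" "\<bar>x * F k x\<bar> \<le> K" if "k \<le> 5" for k x
      unfolding F_def by (rule parity_ext_bounds; use f(2) that in \<open>simp add: K_def\<close>)+
  qed
  have eq: "U t z = heat_evol F 3 t z" if "z > 0" for z
  proof (rule heat_solution_unique[OF sol F])
    show "F 3 (- x) = - F 3 x" for x by (simp add: F_def parity_ext_def)
    show "F 3 y = U0 y" if "y \<ge> 0" for y using that f(5) f(6)[OF that]
      by (cases "y = 0") (auto simp: F_def parity_ext_def)
    show "\<exists>C. \<forall>s y. 0 \<le> s \<longrightarrow> s \<le> T \<longrightarrow> y \<ge> 0 \<longrightarrow> \<bar>U s y\<bar> \<le> C" if "T \<ge> 0" for T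
    proof (intro exI allI impI)
      fix s y :: real assume s: "0 \<le> s" "s \<le> T" "y \<ge> 0"
      have "\<bar>U s y\<bar> \<le> (M\<^sup>2 + exp (4 * (1 + s))) / 2"
        by (rule Sobolev_bounded[OF S[OF s(1)] s(1) Uc[OF s(1)] _ M[OF s(1)] s(3)])
          (use sol s in \<open>auto simp: heat_solution_def\<close>)
      also have "\<dots> \<le> (M\<^sup>2 + exp (4 * (1 + T))) / 2" using s by simp
      finally show "\<bar>U s y\<bar> \<le> (M\<^sup>2 + exp (4 * (1 + T))) / 2" .
    qed
  qed (use t that in auto)
  have D: "(heat_evol F 3 t has_real_derivative heat_evol F 4 t z) (at z)"
    "(heat_evol F 4 t has_real_derivative heat_evol F 5 t z) (at z)" if "z > 0" for z
    using heat_evol_deriv_z[OF F _ that, of 3 t] heat_evol_deriv_z[OF F _ that, of 4 t] by (simp_all add: eval_nat_numeral)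
  \<comment> \<open>\<open>U t\<close> sits at index 3, so its first two derivatives are the
    evolutions at indices 4 and 5; uniqueness of weak derivatives carries their bounds over to
    \<open>weak_deriv\<close>.\<close>
  have wc: "has_weak_deriv 1 (U t) (heat_evol F 4 t)" "has_weak_deriv 2 (U t) (heat_evol F 5 t)"
    by (rule has_weak_deriv_classical[OF eq D heat_evol_continuous_z[OF F]]; simp)+
  have w: "has_weak_deriv i (U t) (weak_deriv i (U t))" if "i \<le> 3" for i
    by (rule Sobolev_weak_deriv(1)[OF S[OF t] that \<mu>_continuous \<mu>_pos])
  have AE1: "AE x in lebesgue. x > 0 \<longrightarrow> weak_deriv 1 (U t) x = heat_evol F 4 t x"
    by (rule has_weak_deriv_unique[OF w wc(1)]) simp
  have AE2: "AE x in lebesgue. x > 0 \<longrightarrow> weak_deriv 2 (U t) x = heat_evol F 5 t x"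
    by (rule has_weak_deriv_unique[OF w wc(2)]) simp
  have m: "(\<lambda>x. indicator {0<..} x * weak_deriv i (U t) x) \<in> borel_measurable lebesgue" if "i \<le> 3" for i
    by (rule locally_integrable_borel_measurable) (use w[OF that] in \<open>simp add: has_weak_deriv_def\<close>)
  have xm: "(\<lambda>x. indicator {0<..} x * (x * weak_deriv i (U t) x)) \<in> borel_measurable lebesgue" if "i \<le> 3" for i
  proof -
    have "(\<lambda>x::real. x) \<in> borel_measurable lebesgue" by (simp add: measurable_completion)
    from borel_measurable_times[OF this m[OF that]] show ?thesis by (simp add: mult.left_commute)
  qed
  note R = heat_evol_rate[OF F t, unfolded K_def, folded B_def]
  have B: "B \<ge> 0" using R(1)[of 0] by linarith
  have "AE x in lebesgue. x > 0 \<longrightarrow> \<bar>weak_deriv 1 (U t) x\<bar> \<le> B"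
    using AE1 by eventually_elim (use R(1) in auto)
  from LinfI[OF m this B] show "weak_deriv 1 (U t) \<in> Linf" "\<bar>Linf_norm (weak_deriv 1 (U t))\<bar> \<le> B" by simp_all
  have "AE x in lebesgue. x > 0 \<longrightarrow> \<bar>x * weak_deriv 1 (U t) x\<bar> \<le> B"
    using AE1 by eventually_elim (use R(2) in auto)
  from LinfI[OF xm this B]
  show "(\<lambda>z. z * weak_deriv 1 (U t) z) \<in> Linf" "\<bar>Linf_norm (\<lambda>z. z * weak_deriv 1 (U t) z)\<bar> \<le> B" by simp_all
  have "AE x in lebesgue. x > 0 \<longrightarrow> \<bar>x * weak_deriv 2 (U t) x\<bar> \<le> B"
    using AE2 by eventually_elim (use R(3) in auto)
  from LinfI[OF xm this B]
  show "(\<lambda>z. z * weak_deriv 2 (U t) z) \<in> Linf" "\<bar>Linf_norm (\<lambda>z. z * weak_deriv 2 (U t) z)\<bar> \<le> B" by simp_all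
qed

lemma pair_norm_le:
  assumes "\<bar>N A\<bar> \<le> c" "\<bar>N B\<bar> \<le> c"
  shows "pair_norm N A B \<le> 2 * c"
proof -
  have "pair_norm N A B \<le> \<bar>N A\<bar> + \<bar>N B\<bar>"
    unfolding pair_norm_def by (rule sqrt_sum_squares_le_sum_abs)
  then show ?thesis using assms by linarith
qed

lemma le_pair_norm: "N A \<le> pair_norm N A B" "N B \<le> pair_norm N A B"
  unfolding pair_norm_def by (auto intro: real_le_rsqrt)

theorem proposition1p2:
  shows "\<exists>C1::real. C1 > 0 \<and>
    (\<forall>(\<epsilon>1::real) (U0::real \<Rightarrow> real) (V0::real \<Rightarrow> real)
      (U::real \<Rightarrow> real \<Rightarrow> real) (V::real \<Rightarrow> real \<Rightarrow> real).
      \<epsilon>1 > 0 \<longrightarrow>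
      U0 0 = 0 \<and> V0 0 = 0 \<longrightarrow>
      U0 \<in> Sobolev 3 \<mu>_in \<and> V0 \<in> Sobolev 3 \<mu>_in \<longrightarrow>
      pair_norm (Sobolev_norm 3 \<mu>_in) U0 V0 \<le> \<epsilon>1 \<longrightarrow>
      heat_solution U0 U \<and> heat_solution V0 V \<longrightarrow>
      (\<forall>t\<ge>0. U t \<in> Sobolev 3 (\<mu> t) \<and> V t \<in> Sobolev 3 (\<mu> t)) \<longrightarrow>
      (\<exists>M. \<forall>t\<ge>0. pair_norm (Sobolev_norm 3 (\<mu> t)) (U t) (V t) \<le> M) \<longrightarrow>
      (LINT z:{0<..}|lebesgue. z * U0 z) = 0 \<and> (LINT z:{0<..}|lebesgue. z * V0 z) = 0 \<longrightarrow>
      (\<forall>t\<ge>0.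
        (\<forall>W\<in>{U, V}. weak_deriv 1 (W t) \<in> Linf \<and>
           (\<lambda>z. z * weak_deriv 1 (W t) z) \<in> Linf \<and>
           (\<lambda>z. z * weak_deriv 2 (W t) z) \<in> Linf) \<and>
        pair_norm Linf_norm (weak_deriv 1 (U t)) (weak_deriv 1 (V t))
        + pair_norm Linf_norm (\<lambda>z. z * weak_deriv 1 (U t) z) (\<lambda>z. z * weak_deriv 1 (V t) z)
        + pair_norm Linf_norm (\<lambda>z. z * weak_deriv 2 (U t) z) (\<lambda>z. z * weak_deriv 2 (V t) z)
        \<le> C1 * \<epsilon>1 * (1 + t) powr (- 3 / 2)))"
proof (intro exI[of _ "72 * rate_const * decay_const + 1"] conjI allI impI)
  have rc: "rate_const \<ge> 0" by (simp add: rate_const_def gauss_abs_nonneg)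
  \<comment> \<open>The factor 72 is 12 from the rate, times 2 for the pair, times 3 for the three
    norms. Adding 1 secures strict positivity, as \<open>rate_const\<close> is only known to be
    nonnegative.\<close>
  have "rate_const * decay_const \<ge> 0" using rc decay_const_pos by simp
  then show "0 < 72 * rate_const * decay_const + 1" by linarith
  fix \<epsilon>1 :: real and U0 V0 :: "real \<Rightarrow> real" and U V :: "real \<Rightarrow> real \<Rightarrow> real" and t :: real
  assume \<epsilon>: "\<epsilon>1 > 0" and bc: "U0 0 = 0 \<and> V0 0 = 0"
    and S0: "U0 \<in> Sobolev 3 \<mu>_in \<and> V0 \<in> Sobolev 3 \<mu>_in"
    and n: "pair_norm (Sobolev_norm 3 \<mu>_in) U0 V0 \<le> \<epsilon>1"
    and sol: "heat_solution U0 U \<and> heat_solution V0 V"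
    and S: "\<forall>t\<ge>0. U t \<in> Sobolev 3 (\<mu> t) \<and> V t \<in> Sobolev 3 (\<mu> t)"
    and M: "\<exists>M. \<forall>t\<ge>0. pair_norm (Sobolev_norm 3 (\<mu> t)) (U t) (V t) \<le> M"
    and mom: "(LINT z:{0<..}|lebesgue. z * U0 z) = 0 \<and> (LINT z:{0<..}|lebesgue. z * V0 z) = 0"
    and t: "t \<ge> 0"
  obtain M where M: "\<And>t. t \<ge> 0 \<Longrightarrow> pair_norm (Sobolev_norm 3 (\<mu> t)) (U t) (V t) \<le> M" using M by blast
  have nU: "Sobolev_norm 3 \<mu>_in U0 \<le> \<epsilon>1" and nV: "Sobolev_norm 3 \<mu>_in V0 \<le> \<epsilon>1"
    using n le_pair_norm order_trans by metis+
  have MU: "Sobolev_norm 3 (\<mu> t) (U t) \<le> M" and MV: "Sobolev_norm 3 (\<mu> t) (V t) \<le> M" if "t \<ge> 0" for t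
    using M[OF that] le_pair_norm order_trans by metis+
  define P where "P = (1 + t) powr (- 3 / 2)"
  define B where "B = 12 * rate_const * (decay_const * \<epsilon>1) * P"
  note DU = heat_solution_decay[of U0 \<epsilon>1 U M t, folded P_def, folded B_def]
  note DV = heat_solution_decay[of V0 \<epsilon>1 V M t, folded P_def, folded B_def]
  note U = DU[OF _ _ nU \<epsilon> _ _ _ MU t]
  note V = DV[OF _ _ nV \<epsilon> _ _ _ MV t]
  show "\<forall>W\<in>{U, V}. weak_deriv 1 (W t) \<in> Linf \<and> (\<lambda>z. z * weak_deriv 1 (W t) z) \<in> Linf \<and>
      (\<lambda>z. z * weak_deriv 2 (W t) z) \<in> Linf"
    using U(1,3,5) V(1,3,5) bc S0 sol S mom by auto
  have b1: "pair_norm Linf_norm (weak_deriv 1 (U t)) (weak_deriv 1 (V t)) \<le> 2 * B"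
    by (rule pair_norm_le; rule U(2) V(2); use bc S0 sol S mom in auto)
  have b2: "pair_norm Linf_norm (\<lambda>z. z * weak_deriv 1 (U t) z) (\<lambda>z. z * weak_deriv 1 (V t) z) \<le> 2 * B"
    by (rule pair_norm_le; rule U(4) V(4); use bc S0 sol S mom in auto)
  have b3: "pair_norm Linf_norm (\<lambda>z. z * weak_deriv 2 (U t) z) (\<lambda>z. z * weak_deriv 2 (V t) z) \<le> 2 * B"
    by (rule pair_norm_le; rule U(6) V(6); use bc S0 sol S mom in auto)
  have "6 * B = 72 * rate_const * decay_const * \<epsilon>1 * P" by (simp add: B_def)
  also have "\<dots> \<le> (72 * rate_const * decay_const + 1) * \<epsilon>1 * P"
    using \<epsilon> by (intro mult_right_mono) (auto simp: P_def)
  finally show "pair_norm Linf_norm (weak_deriv 1 (U t)) (weak_deriv 1 (V t))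
        + pair_norm Linf_norm (\<lambda>z. z * weak_deriv 1 (U t) z) (\<lambda>z. z * weak_deriv 1 (V t) z)
        + pair_norm Linf_norm (\<lambda>z. z * weak_deriv 2 (U t) z) (\<lambda>z. z * weak_deriv 2 (V t) z)
        \<le> (72 * rate_const * decay_const + 1) * \<epsilon>1 * (1 + t) powr (- 3 / 2)"
    using b1 b2 b3 unfolding P_def by linarith
qed

end
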